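(* Let $K$ be an infinite field of characteristic $p$ ($p=0$ or $p$ prime), let $d>1$, and let $C(3,d,K)$ be the nilpotency degree of the relatively free algebra $N_{3,d}$. Then: - if $p=0$ or $p>3$, then $C(3,d,K)=6$; - if $p=2$, then $C(3,d,K)=d+3$ for $d\ge 3$, and $C(3,d,K)=6$ for $d=2$; - if $p=3$, then $C(3,d,K)=3d+1$.
   Context: $K\langle x_1,\ldots,x_d\rangle^{\#}$ is the free associative non-unitary $K$-algebra on $x_1,\dots,x_d$. $N_{3,d}$ is its quotient by the ideal generated by all elements $a^3$, $a\in K\langle x_1,\ldots,x_d\rangle^{\#}$. The nilpotency degree of a non-unitary algebra $A$ is the least $C>0$ such that $a_1\cdots a_C=0$ for all $a_1,\ldots,a_C\in A$. *)

theory Defs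
  imports
    "HOL-Library.Poly_Mapping"
    "HOL-Library.Extended_Nat"
    "HOL-Computational_Algebra.Computational_Algebra"
    "HOL-Algebra.Congruence"
begin

section \<open>Associative algebras without unit\<close>

text \<open>
  The rings of HOL-Algebra are unital, so associative algebras without a unit over a field (given
  by a type of class \<^class>\<open>field\<close>) are introduced here.
\<close>

record ('k, 'a) nu_algebra = "'a partial_object" +
  nu_zero :: 'a
  nu_add :: "'a \<Rightarrow> 'a \<Rightarrow> 'a"
  nu_mult :: "'a \<Rightarrow> 'a \<Rightarrow> 'a"
  nu_scale :: "'k \<Rightarrow> 'a \<Rightarrow> 'a"

locale nonunital_algebra =
  fixes A :: "('k :: field, 'a) nu_algebra"
  assumes zero_closed: "nu_zero A \<in> carrier A"
    and add_closed: "\<lbrakk>a \<in> carrier A; b \<in> carrier A\<rbrakk> \<Longrightarrow> nu_add A a b \<in> carrier A"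
    and mult_closed: "\<lbrakk>a \<in> carrier A; b \<in> carrier A\<rbrakk> \<Longrightarrow> nu_mult A a b \<in> carrier A"
    and scale_closed: "a \<in> carrier A \<Longrightarrow> nu_scale A r a \<in> carrier A"
    and add_assoc: "\<lbrakk>a \<in> carrier A; b \<in> carrier A; c \<in> carrier A\<rbrakk> \<Longrightarrow>
      nu_add A (nu_add A a b) c = nu_add A a (nu_add A b c)"
    and add_commute: "\<lbrakk>a \<in> carrier A; b \<in> carrier A\<rbrakk> \<Longrightarrow> nu_add A a b = nu_add A b a"
    and add_zero: "a \<in> carrier A \<Longrightarrow> nu_add A (nu_zero A) a = a"
    and add_inverse: "a \<in> carrier A \<Longrightarrow> \<exists>b \<in> carrier A. nu_add A a b = nu_zero A"
    and scale_add_right: "\<lbrakk>a \<in> carrier A; b \<in> carrier A\<rbrakk> \<Longrightarrow>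
      nu_scale A r (nu_add A a b) = nu_add A (nu_scale A r a) (nu_scale A r b)"
    and scale_add_left: "a \<in> carrier A \<Longrightarrow>
      nu_scale A (r + s) a = nu_add A (nu_scale A r a) (nu_scale A s a)"
    and scale_scale: "a \<in> carrier A \<Longrightarrow> nu_scale A r (nu_scale A s a) = nu_scale A (r * s) a"
    and scale_one: "a \<in> carrier A \<Longrightarrow> nu_scale A 1 a = a"
    and mult_assoc: "\<lbrakk>a \<in> carrier A; b \<in> carrier A; c \<in> carrier A\<rbrakk> \<Longrightarrow>
      nu_mult A (nu_mult A a b) c = nu_mult A a (nu_mult A b c)"
    and mult_add_left: "\<lbrakk>a \<in> carrier A; b \<in> carrier A; c \<in> carrier A\<rbrakk> \<Longrightarrow>
      nu_mult A (nu_add A a b) c = nu_add A (nu_mult A a c) (nu_mult A b c)"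
    and mult_add_right: "\<lbrakk>a \<in> carrier A; b \<in> carrier A; c \<in> carrier A\<rbrakk> \<Longrightarrow>
      nu_mult A a (nu_add A b c) = nu_add A (nu_mult A a b) (nu_mult A a c)"
    and mult_scale_left: "\<lbrakk>a \<in> carrier A; b \<in> carrier A\<rbrakk> \<Longrightarrow>
      nu_mult A (nu_scale A r a) b = nu_scale A r (nu_mult A a b)"
    and mult_scale_right: "\<lbrakk>a \<in> carrier A; b \<in> carrier A\<rbrakk> \<Longrightarrow>
      nu_mult A a (nu_scale A r b) = nu_scale A r (nu_mult A a b)"

text \<open>The product of a list; meaningful only for nonempty lists, as there is no unit.\<close>

definition nu_prod :: "('k, 'a) nu_algebra \<Rightarrow> 'a list \<Rightarrow> 'a" where
  "nu_prod A as = foldl (nu_mult A) (hd as) (tl as)"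

definition nu_power :: "('k, 'a) nu_algebra \<Rightarrow> 'a \<Rightarrow> nat \<Rightarrow> 'a" where
  "nu_power A a n = nu_prod A (replicate n a)"

text \<open>The infimum in \<^typ>\<open>enat\<close> is the least element, and \<open>\<infinity>\<close> if \<open>A\<close> is not nilpotent.\<close>

definition nilpotency_degree :: "('k, 'a) nu_algebra \<Rightarrow> enat" where
  "nilpotency_degree A =
     Inf (enat ` {C. 0 < C \<and>
       (\<forall>as. length as = C \<and> set as \<subseteq> carrier A \<longrightarrow> nu_prod A as = nu_zero A)})"


section \<open>Ideals and quotients\<close>

definition nu_ideal :: "'a set \<Rightarrow> ('k, 'a) nu_algebra \<Rightarrow> bool" where
  "nu_ideal I A \<longleftrightarrow>
     I \<subseteq> carrier A \<and> nu_zero A \<in> I \<and>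
     (\<forall>a\<in>I. \<forall>b\<in>I. nu_add A a b \<in> I) \<and>
     (\<forall>r. \<forall>a\<in>I. nu_scale A r a \<in> I) \<and>
     (\<forall>a\<in>I. \<forall>b\<in>carrier A. nu_mult A a b \<in> I \<and> nu_mult A b a \<in> I)"

definition nu_genideal :: "('k, 'a) nu_algebra \<Rightarrow> 'a set \<Rightarrow> 'a set" where
  "nu_genideal A S = \<Inter>{I. nu_ideal I A \<and> S \<subseteq> I}"

definition nu_coset :: "('k, 'a) nu_algebra \<Rightarrow> 'a set \<Rightarrow> 'a \<Rightarrow> 'a set" where
  "nu_coset A I a = nu_add A a ` I"

definition nu_quotient :: "('k, 'a) nu_algebra \<Rightarrow> 'a set \<Rightarrow> ('k, 'a set) nu_algebra" where
  "nu_quotient A I =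
     \<lparr>carrier = nu_coset A I ` carrier A,
      nu_zero = I,
      nu_add = \<lambda>X Y. \<Union>x\<in>X. \<Union>y\<in>Y. nu_coset A I (nu_add A x y),
      nu_mult = \<lambda>X Y. \<Union>x\<in>X. \<Union>y\<in>Y. nu_coset A I (nu_mult A x y),
      nu_scale = \<lambda>r X. \<Union>x\<in>X. nu_coset A I (nu_scale A r x)\<rparr>"

lemma nu_genideal_is_ideal:
  assumes A: "nonunital_algebra A" and S: "S \<subseteq> carrier A"
  shows "nu_ideal (nu_genideal A S) A" "S \<subseteq> nu_genideal A S"
proof -
  have "nu_ideal (carrier A) A"
    using A by (auto simp: nu_ideal_def nonunital_algebra_def)
  then show "nu_ideal (nu_genideal A S) A"
    using S by (auto simp: nu_ideal_def nu_genideal_def)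
  show "S \<subseteq> nu_genideal A S"
    by (auto simp: nu_genideal_def)
qed

context
  fixes A :: "('k :: field, 'a) nu_algebra" and I
  assumes A: "nonunital_algebra A" and I: "nu_ideal I A"
begin

interpretation nonunital_algebra A by (rule A)

private lemma I_sub: "x \<in> I \<Longrightarrow> x \<in> carrier A"
  using I by (auto simp: nu_ideal_def)

private lemma scale_zero: "a \<in> carrier A \<Longrightarrow> nu_scale A 0 a = nu_zero A"
proof -
  assume a: "a \<in> carrier A"
  define z where "z = nu_scale A 0 a"
  have z: "z \<in> carrier A" "nu_add A z z = z"
    using a scale_add_left[of a 0 0] by (simp_all add: z_def scale_closed)
  obtain b where b: "b \<in> carrier A" "nu_add A z b = nu_zero A"
    using add_inverse z(1) by blast
  have "nu_zero A = nu_add A (nu_add A z z) b"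
    using z b by simp
  also have "\<dots> = nu_add A z (nu_zero A)"
    using z(1) b by (simp add: add_assoc)
  also have "\<dots> = z"
    using z(1) zero_closed by (simp add: add_commute[of z] add_zero)
  finally show ?thesis
    by (simp add: z_def)
qed

private lemma add_neg: "a \<in> carrier A \<Longrightarrow> nu_add A a (nu_scale A (-1) a) = nu_zero A"
  using scale_add_left[of a 1 "-1"] by (simp add: scale_one scale_zero)

private lemma add_swap:
  assumes "a \<in> carrier A" "b \<in> carrier A" "c \<in> carrier A" "d \<in> carrier A"
  shows "nu_add A (nu_add A a b) (nu_add A c d) = nu_add A (nu_add A a c) (nu_add A b d)"
proof -
  have "nu_add A (nu_add A a b) (nu_add A c d) = nu_add A a (nu_add A (nu_add A b c) d)"
    using assms by (simp add: add_assoc add_closed)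
  also have "nu_add A b c = nu_add A c b"
    using assms by (simp add: add_commute)
  also have "nu_add A a (nu_add A (nu_add A c b) d) = nu_add A (nu_add A a c) (nu_add A b d)"
    using assms by (simp add: add_assoc add_closed)
  finally show ?thesis .
qed

private lemma coset_shift:
  assumes a: "a \<in> carrier A" and x: "x \<in> I"
  shows "nu_coset A I (nu_add A a x) = nu_coset A I a"
proof -
  have sub: "nu_coset A I (nu_add A b y) \<subseteq> nu_coset A I b" if "b \<in> carrier A" "y \<in> I" for b y
    using that I I_sub by (auto simp: nu_coset_def add_assoc nu_ideal_def)
  have n: "nu_scale A (-1) x \<in> I"
    using I x by (auto simp: nu_ideal_def)
  have "nu_add A (nu_add A a x) (nu_scale A (-1) x) = a"
    using a x n I_sub zero_closed by (simp add: add_assoc add_neg add_commute[of a "nu_zero A"] add_zero)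
  then have "nu_coset A I a \<subseteq> nu_coset A I (nu_add A a x)"
    using sub[of "nu_add A a x" "nu_scale A (-1) x"] a x n I_sub add_closed by auto
  then show ?thesis
    using sub[OF a x] by auto
qed

private lemma I_nonempty: "I \<noteq> {}"
  using I by (auto simp: nu_ideal_def)

lemma nu_quotient_add:
  assumes "a \<in> carrier A" "b \<in> carrier A"
  shows "nu_add (nu_quotient A I) (nu_coset A I a) (nu_coset A I b) = nu_coset A I (nu_add A a b)"
proof -
  have "nu_coset A I (nu_add A (nu_add A a x) (nu_add A b y)) = nu_coset A I (nu_add A a b)"
    if "x \<in> I" "y \<in> I" for x y
    using that assms I by (auto simp: add_swap I_sub coset_shift add_closed nu_ideal_def)
  then show ?thesis
    using I_nonempty by (auto simp: nu_quotient_def nu_coset_def[of A I a] nu_coset_def[of A I b])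
qed

lemma nu_quotient_mult:
  assumes "a \<in> carrier A" "b \<in> carrier A"
  shows "nu_mult (nu_quotient A I) (nu_coset A I a) (nu_coset A I b) = nu_coset A I (nu_mult A a b)"
proof -
  have "nu_coset A I (nu_mult A (nu_add A a x) (nu_add A b y)) = nu_coset A I (nu_mult A a b)"
    if xy: "x \<in> I" "y \<in> I" for x y
  proof -
    have c: "x \<in> carrier A" "y \<in> carrier A"
      using xy I_sub by auto
    have "nu_mult A (nu_add A a x) (nu_add A b y) =
        nu_add A (nu_mult A a b) (nu_add A (nu_mult A a y) (nu_mult A x (nu_add A b y)))"
      using assms c mult_add_left[of a x "nu_add A b y"] mult_add_right[of a b y]
      by (simp add: add_assoc add_closed mult_closed)
    moreover have "nu_add A (nu_mult A a y) (nu_mult A x (nu_add A b y)) \<in> I"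
      using I xy c assms add_closed by (auto simp: nu_ideal_def)
    ultimately show ?thesis
      using assms by (simp add: coset_shift mult_closed)
  qed
  then show ?thesis
    using I_nonempty by (auto simp: nu_quotient_def nu_coset_def[of A I a] nu_coset_def[of A I b])
qed

lemma nu_quotient_scale:
  assumes "a \<in> carrier A"
  shows "nu_scale (nu_quotient A I) r (nu_coset A I a) = nu_coset A I (nu_scale A r a)"
proof -
  have "nu_coset A I (nu_scale A r (nu_add A a x)) = nu_coset A I (nu_scale A r a)"
    if "x \<in> I" for x
    using that assms I by (auto simp: scale_add_right I_sub coset_shift scale_closed nu_ideal_def)
  then show ?thesis
    using I_nonempty by (auto simp: nu_quotient_def nu_coset_def[of A I a])
qed

lemma nu_quotient_zero: "nu_zero (nu_quotient A I) = nu_coset A I (nu_zero A)"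
  using I_sub by (force simp: nu_quotient_def nu_coset_def add_zero image_def)

lemma nonunital_algebra_quotient: "nonunital_algebra (nu_quotient A I)"
proof -
  have car: "carrier (nu_quotient A I) = nu_coset A I ` carrier A"
    by (simp add: nu_quotient_def)
  note ops = nu_quotient_add nu_quotient_mult nu_quotient_scale nu_quotient_zero
  note closed = zero_closed add_closed mult_closed scale_closed
  show ?thesis
  proof
    fix a assume "a \<in> carrier (nu_quotient A I)"
    then obtain x where x: "x \<in> carrier A" "a = nu_coset A I x"
      by (auto simp: car)
    obtain y where y: "y \<in> carrier A" "nu_add A x y = nu_zero A"
      using add_inverse x(1) by blast
    show "\<exists>b\<in>carrier (nu_quotient A I). nu_add (nu_quotient A I) a b = nu_zero (nu_quotient A I)"
      using x y by (intro bexI[of _ "nu_coset A I y"]) (simp_all add: car ops)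
  next
    fix a b assume "a \<in> carrier (nu_quotient A I)" "b \<in> carrier (nu_quotient A I)"
    then obtain x y where "x \<in> carrier A" "a = nu_coset A I x" "y \<in> carrier A" "b = nu_coset A I y"
      by (auto simp: car)
    then show "nu_add (nu_quotient A I) a b = nu_add (nu_quotient A I) b a"
      by (simp add: nu_quotient_add add_commute[of x])
  qed (auto simp: car ops closed add_assoc add_zero scale_add_right scale_add_left scale_scale
      scale_one mult_assoc mult_add_left mult_add_right mult_scale_left mult_scale_right)
qed

end


section \<open>The free associative algebra without unit\<close>

text \<open>
  Words form a monoid under concatenation, so that \<open>'x word \<Rightarrow>\<^sub>0 'k\<close>, with its library
  multiplication, is the unital free algebra; the free algebra without unit consists of the
  elements supported on nonempty words.
\<close>

datatype 'x word = Word (letters: "'x list")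

instantiation word :: (type) monoid_add
begin

definition zero_word :: "'a word" where
  "zero_word = Word []"

definition plus_word :: "'a word \<Rightarrow> 'a word \<Rightarrow> 'a word" where
  "plus_word u v = Word (letters u @ letters v)"

instance
  by standard (auto simp: zero_word_def plus_word_def)

end

definition free_nu_algebra ::
    "'x set \<Rightarrow> ('k :: field, 'x word \<Rightarrow>\<^sub>0 'k) nu_algebra" where
  "free_nu_algebra X =
     \<lparr>carrier = {f. \<forall>w \<in> Poly_Mapping.keys f. letters w \<noteq> [] \<and> set (letters w) \<subseteq> X},
      nu_zero = 0,
      nu_add = (+),
      nu_mult = (*),
      nu_scale = \<lambda>r. Poly_Mapping.map ((*) r)\<rparr>"

lemma map_mult_eq_single_times:
  "Poly_Mapping.map ((*) r) f = Poly_Mapping.single 0 r * (f :: 'x word \<Rightarrow>\<^sub>0 'k :: field)"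
proof (rule poly_mapping_eqI)
  fix k
  have "Poly_Mapping.lookup (Poly_Mapping.single 0 r * f) k =
      Sum_any (\<lambda>l :: 'x word. (r * Poly_Mapping.lookup f k) when l = 0)"
    unfolding lookup_mult by (rule arg_cong[where f = Sum_any]) (auto simp: lookup_single when_def)
  then show "Poly_Mapping.lookup (Poly_Mapping.map ((*) r) f) k =
      Poly_Mapping.lookup (Poly_Mapping.single 0 r * f) k"
    by (simp add: map.rep_eq when_def)
qed

lemma single_zero_commutes:
  "f * Poly_Mapping.single 0 r = Poly_Mapping.single 0 r * (f :: 'x word \<Rightarrow>\<^sub>0 'k :: field)"
proof (rule poly_mapping_eqI)
  fix k
  have inner: "Sum_any (\<lambda>q. Poly_Mapping.lookup (Poly_Mapping.single 0 r) q when k = l + q) =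
      (r when k = l)" for l :: "'x word"
  proof -
    have "Sum_any (\<lambda>q. Poly_Mapping.lookup (Poly_Mapping.single 0 r) q when k = l + q) =
        Sum_any (\<lambda>q :: 'x word. (r when k = l) when q = 0)"
      by (rule arg_cong[where f = Sum_any]) (auto simp: lookup_single when_def fun_eq_iff)
    then show ?thesis by simp
  qed
  have "Poly_Mapping.lookup (f * Poly_Mapping.single 0 r) k =
      Sum_any (\<lambda>l. (r * Poly_Mapping.lookup f k) when l = k)"
    unfolding lookup_mult inner
    by (rule arg_cong[where f = Sum_any]) (auto simp: when_def fun_eq_iff)
  then show "Poly_Mapping.lookup (f * Poly_Mapping.single 0 r) k =
      Poly_Mapping.lookup (Poly_Mapping.single 0 r * f) k"
    by (simp flip: map_mult_eq_single_times add: map.rep_eq when_def)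
qed

lemma nonunital_algebra_free:
  "nonunital_algebra (free_nu_algebra X :: ('b :: field, 'a word \<Rightarrow>\<^sub>0 'b) nu_algebra)"
proof
  fix a :: "'a word \<Rightarrow>\<^sub>0 'b" assume a: "a \<in> carrier (free_nu_algebra X)"
  have "- a \<in> carrier (free_nu_algebra X)"
    using a by (simp add: free_nu_algebra_def in_keys_iff)
  then show "\<exists>b\<in>carrier (free_nu_algebra X).
      nu_add (free_nu_algebra X) a b = nu_zero (free_nu_algebra X)"
    by (intro bexI[of _ "- a"]) (simp_all add: free_nu_algebra_def)
next
  fix a b :: "'a word \<Rightarrow>\<^sub>0 'b"
  assume ab: "a \<in> carrier (free_nu_algebra X)" "b \<in> carrier (free_nu_algebra X)"
  show "nu_add (free_nu_algebra X) a b \<in> carrier (free_nu_algebra X)"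
    using ab keys_add[of a b] by (auto simp: free_nu_algebra_def)
  show "nu_mult (free_nu_algebra X) a b \<in> carrier (free_nu_algebra X)"
    using ab keys_mult[of a b] by (fastforce simp: free_nu_algebra_def plus_word_def)
next
  fix a :: "'a word \<Rightarrow>\<^sub>0 'b" and r assume "a \<in> carrier (free_nu_algebra X)"
  then show "nu_scale (free_nu_algebra X) r a \<in> carrier (free_nu_algebra X)"
    by (auto simp: free_nu_algebra_def in_keys_iff map.rep_eq when_def)
next
  fix a b :: "'a word \<Rightarrow>\<^sub>0 'b" and r
  show "nu_mult (free_nu_algebra X) a (nu_scale (free_nu_algebra X) r b) =
      nu_scale (free_nu_algebra X) r (nu_mult (free_nu_algebra X) a b)"
    by (simp add: free_nu_algebra_def map_mult_eq_single_times)
      (metis mult.assoc single_zero_commutes)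
next
  fix a :: "'a word \<Rightarrow>\<^sub>0 'b" and r s :: 'b
  have "Poly_Mapping.single 0 (r * s) =
      Poly_Mapping.single 0 r * Poly_Mapping.single (0 :: 'a word) s"
    by (simp add: mult_single)
  then show "nu_scale (free_nu_algebra X) r (nu_scale (free_nu_algebra X) s a) =
      nu_scale (free_nu_algebra X) (r * s) a"
    by (simp add: free_nu_algebra_def map_mult_eq_single_times mult.assoc)
next
  fix a :: "'a word \<Rightarrow>\<^sub>0 'b" and r s :: 'b
  show "nu_scale (free_nu_algebra X) (r + s) a =
      nu_add (free_nu_algebra X) (nu_scale (free_nu_algebra X) r a)
        (nu_scale (free_nu_algebra X) s a)"
    by (simp add: free_nu_algebra_def map_mult_eq_single_times single_add distrib_right)
  show "nu_scale (free_nu_algebra X) 1 a = a"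
    by (simp add: free_nu_algebra_def map_mult_eq_single_times)
next
  fix a b :: "'a word \<Rightarrow>\<^sub>0 'b" and r
  show "nu_scale (free_nu_algebra X) r (nu_add (free_nu_algebra X) a b) =
      nu_add (free_nu_algebra X) (nu_scale (free_nu_algebra X) r a)
        (nu_scale (free_nu_algebra X) r b)"
    by (simp add: free_nu_algebra_def map_mult_eq_single_times distrib_left)
  show "nu_mult (free_nu_algebra X) (nu_scale (free_nu_algebra X) r a) b =
      nu_scale (free_nu_algebra X) r (nu_mult (free_nu_algebra X) a b)"
    by (simp add: free_nu_algebra_def map_mult_eq_single_times mult.assoc)
qed (simp_all add: free_nu_algebra_def distrib_left distrib_right mult.assoc add_ac)


section \<open>The relatively free algebra with identity \<open>x^n = 0\<close>\<close>

text \<open>The letters \<open>x\<^sub>1, \<dots>, x\<^sub>d\<close> are the natural numbers below \<open>d\<close>.\<close>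

definition nil_relatively_free ::
    "nat \<Rightarrow> nat \<Rightarrow> ('k :: field, (nat word \<Rightarrow>\<^sub>0 'k) set) nu_algebra" where
  "nil_relatively_free n d =
     (let F = free_nu_algebra {..<d}
      in nu_quotient F (nu_genideal F ((\<lambda>a. nu_power F a n) ` carrier F)))"

end

theory Submission
  imports Defs "HOL-Library.Multiset" "HOL-Library.Function_Algebras"
begin

text \<open>
  The ideal generated by the cubes contains their polarizations, because the field is infinite:
  \<open>s x a = x\<^sup>2a + xax + ax\<^sup>2\<close> and its linearization, the sum of the products of three elements in
  all six orders. The free algebra is spanned by words, so the nilpotency degree is \<open>C\<close> as soon as
  all words of length \<open>C\<close> lie in the ideal and some word of length \<open>C - 1\<close> does not.

  Upper bounds. The relation \<open>s x a = 0\<close> brings two equal letters together and implies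
  \<open>x\<^sup>2ax = - xax\<^sup>2\<close>; hence a word with four equal letters vanishes (\<open>four_times\<close>), and by the
  pigeonhole principle so does every word longer than \<open>3d\<close>. Outside characteristic 3, Higman's
  argument gives \<open>x\<^sup>2ay\<^sup>2 = 0\<close> (\<open>higman\<close>). In characteristic 2 this kills words in which three
  letters are repeated, and words of length at least 6 in which one letter occurs three times and
  another one twice; what survives has length at most \<open>d + 2\<close> or at most 5. When 2 and 3 are invertible,
  \<open>x\<^sup>2ay\<^sup>2 = 0\<close> makes a product of six elements change sign under each exchange of neighbours; blocks
  of two letters then commute with everything, so the sum of the products of \<open>ab\<close>, \<open>cd\<close>, \<open>e\<close> in all
  orders, times \<open>f\<close>, is \<open>6abcdef\<close>, and it is zero (\<open>six\<close>).

  Lower bounds. A word is outside the ideal if some linear functional on words is nonzero there and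
  kills the polarized cubes with arbitrary words on both sides (\<open>not_in_cube_ideal\<close>). For length 5
  over two letters there is an integral functional on words in \<open>00011\<close> (\<open>gap_sign\<close>). In
  characteristic 2 the functional on words with three zeros and every other letter once counts the
  pairs of adjacent zeros.

  In characteristic 3 the functional lives on words containing every letter three times. Modulo 3,
  the identity for three elements says that \<open>[[a,b],c]\<close> changes sign when \<open>b\<close> and \<open>c\<close> are exchanged,
  so commutators behave like differential forms: \<open>[a,b][c,d]\<close> and \<open>[[a,b],c]\<close> are both alternating.
  A word is read as a path in the lattice of letter counts, with anticommuting symbols \<open>\<xi>\<^sub>i\<close> for the
  steps. Its \<open>transport\<close> is the product of the factors \<open>1 + (\<Sum>\<^sub>j n\<^sub>j \<xi>\<^sub>j) \<xi>\<^sub>i\<close> over the steps, where \<open>n\<close>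
  is the current position, and records the 2-forms; its \<open>height\<close> is the sum over the steps of a
  3-form quadratic in the position, and records the double commutators. The functional is the
  coefficient of \<open>\<xi>\<^sub>0 \<dots> \<xi>\<^sub>d\<^sub>-\<^sub>1\<close> in the transport if \<open>d\<close> is even, and in transport times height if
  \<open>d\<close> is odd; the latter contains a single 3-form and so has odd degree. Words composed of the loops
  \<open>001011\<close> and, for odd \<open>d\<close>, one loop \<open>001120122\<close> have nonzero value, because both quantities are
  multiplicative, respectively additive, along loops.
\<close>

section \<open>Consequences of the identity\<close>

text \<open>
  \<open>A\<close> plays the algebra without unit and \<open>B\<close> the one with unit adjoined; \<open>I\<close> is an ideal of both. Keeping
  the unit in \<open>B\<close> lets empty words be used as factors of elements of \<open>I\<close>.
\<close>

locale nil_cube =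
  fixes A B I :: "'r :: ring_1 set"
  assumes A_B: "A \<subseteq> B"
    and one_B: "1 \<in> B"
    and A_add: "a \<in> A \<Longrightarrow> b \<in> A \<Longrightarrow> a + b \<in> A"
    and A_uminus: "a \<in> A \<Longrightarrow> - a \<in> A"
    and A_mult: "a \<in> A \<Longrightarrow> b \<in> A \<Longrightarrow> a * b \<in> A"
    and I_add: "x \<in> I \<Longrightarrow> y \<in> I \<Longrightarrow> x + y \<in> I"
    and I_uminus: "x \<in> I \<Longrightarrow> - x \<in> I"
    and I_mult_left: "b \<in> B \<Longrightarrow> x \<in> I \<Longrightarrow> b * x \<in> I"
    and I_mult_right: "b \<in> B \<Longrightarrow> x \<in> I \<Longrightarrow> x * b \<in> I"
    and cube: "x \<in> A \<Longrightarrow> x * x * x \<in> I"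
    and polar: "x \<in> A \<Longrightarrow> a \<in> A \<Longrightarrow> x * x * a + x * a * x + a * x * x \<in> I"
begin

lemma A_in_B: "a \<in> A \<Longrightarrow> a \<in> B"
  using A_B by auto

lemma I_diff: "x \<in> I \<Longrightarrow> y \<in> I \<Longrightarrow> x - y \<in> I"
  using I_add[of x "- y"] I_uminus by simp

lemma I_ml: "a \<in> A \<Longrightarrow> x \<in> I \<Longrightarrow> a * x \<in> I"
  and I_mr: "a \<in> A \<Longrightarrow> x \<in> I \<Longrightarrow> x * a \<in> I"
  using I_mult_left I_mult_right A_in_B by auto

lemma polar3:
  assumes "x \<in> A" "y \<in> A" "a \<in> A"
  shows "x * y * a + y * x * a + x * a * y + y * a * x + a * x * y + a * y * x \<in> I"
proof -
  define s where "s x a = x * x * a + x * a * x + a * x * x" for x a :: 'r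
  have "s (x + y) a - s x a - s y a \<in> I"
    unfolding s_def using assms by (intro I_diff polar A_add)
  then show ?thesis
    by (simp add: s_def algebra_simps)
qed

lemma sq_mid_swap:
  assumes "x \<in> A" "a \<in> A"
  shows "x * x * a * x + x * a * x * x \<in> I"
proof -
  have "x * (x * x * a + x * a * x + a * x * x) - (x * x * x) * a \<in> I"
    using assms by (intro I_diff I_ml I_mr polar cube)
  then show ?thesis
    by (simp add: algebra_simps)
qed

text \<open>
  Multiplying \<open>x\<^sup>2ax = - xax\<^sup>2\<close> by \<open>x\<close> on the right leaves only \<open>x\<^sup>2ax\<^sup>2\<close>.
\<close>

lemma sq_mid_sq_same:
  assumes "x \<in> A" "a \<in> A"
  shows "x * x * a * x * x \<in> I"
proof -
  have "(x * x * a * x + x * a * x * x) * x - (x * a) * (x * x * x) \<in> I"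
    using assms by (intro I_diff I_ml I_mr sq_mid_swap cube A_mult)
  then show ?thesis
    by (simp add: algebra_simps)
qed

lemma four_times_sq:
  assumes "x \<in> A" "a \<in> A" "c \<in> insert 1 A"
  shows "x * x * a * x * c * x \<in> I"
proof (cases "c \<in> A")
  case True
  have "(x * x * a) * (x * x * c + x * c * x + c * x * x) - (x * x * a * x * x) * c
      - x * x * (a * c) * x * x \<in> I"
    using assms True by (intro I_diff I_ml I_mr polar sq_mid_sq_same A_mult)
  then show ?thesis
    by (simp add: algebra_simps)
next
  case False
  then show ?thesis
    using assms sq_mid_sq_same by auto
qed

text \<open>
  The first two occurrences of \<open>x\<close> are brought together by the polarized identity; the remaining
  ones then meet a square, and \<open>x\<^sup>2ax\<^sup>2 = 0\<close> applies. The separators may be empty, which is the case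
  of the value 1.
\<close>

lemma four_times:
  assumes x: "x \<in> A" and a: "a \<in> insert 1 A" and b: "b \<in> insert 1 A" and c: "c \<in> insert 1 A"
  shows "x * a * x * b * x * c * x \<in> I"
proof -
  have cx: "c * x \<in> A"
    using x c A_mult by auto
  have sq: "x * x * b * x * c * x \<in> I"
  proof (cases "b \<in> A")
    case True
    then show ?thesis
      using four_times_sq x c by blast
  next
    case False
    then have "b = 1"
      using b by blast
    then show ?thesis
      using I_mr[OF cx cube[OF x]] by (simp add: algebra_simps)
  qed
  show ?thesis
  proof (cases "a \<in> A")
    case True
    have ab: "a * b \<in> A"
      using True b A_mult by auto
    have bxcx: "b * x * c * x \<in> A"
      using b cx x A_mult by (auto simp: mult.assoc)
    have "(x * x * a + x * a * x + a * x * x) * (b * x * c * x) - x * x * (a * b) * x * c * x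
        - a * (x * x * b * x * c * x) \<in> I"
      using x True c bxcx ab by (intro I_diff I_ml I_mr polar sq four_times_sq)
    then show ?thesis
      by (simp add: algebra_simps)
  next
    case False
    then show ?thesis
      using a sq by (auto simp: algebra_simps)
  qed
qed

text \<open>
  Higman's computation: in the sum of \<open>x\<^sup>i a y\<^sup>j x\<^sup>2\<^sup>-\<^sup>i y\<^sup>2\<^sup>-\<^sup>j\<close> over \<open>i\<close> and \<open>j\<close>, summing over
  \<open>i\<close> first gives zero. Summing over \<open>j\<close> first gives zero for \<open>i < 2\<close>, and \<open>3x\<^sup>2ay\<^sup>2\<close> for \<open>i = 2\<close>.
\<close>

lemma higman:
  assumes x: "x \<in> A" and a: "a \<in> A" and y: "y \<in> A"
  shows "x * x * a * y * y + x * x * a * y * y + x * x * a * y * y \<in> I"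
proof -
  define s where "s x a = x * x * a + x * a * x + a * x * x" for x a :: 'r
  have s: "s u v \<in> I" if "u \<in> A" "v \<in> A" for u v
    unfolding s_def using that by (rule polar)
  have "s x (a * y * y) + s x (a * y) * y + s x a * (y * y)
      - (x * a) * s y x - a * s y (x * x) \<in> I"
    using assms by (intro I_diff I_add I_ml I_mr s A_mult)
  then show ?thesis
    by (simp add: s_def algebra_simps)
qed

text \<open>
  The element \<open>xaxbx\<close> can be expanded by moving together the first two or the last two occurrences
  of \<open>x\<close>; comparing the results shows that \<open>\<delta> a = x\<^sup>2ax\<close> satisfies
  \<open>- 2 \<delta> (ab) = a \<delta> b + \<delta> a b\<close>.
\<close>

lemma almost_derivation:
  assumes x: "x \<in> A" and a: "a \<in> A" and b: "b \<in> A"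
  shows "a * x * x * b * x + x * x * a * x * b + x * x * a * b * x + x * x * a * b * x \<in> I"
proof -
  have h: "(x * x * a + x * a * x + a * x * x) * (b * x) \<in> I"
    "(x * a) * (x * x * b + x * b * x + b * x * x) \<in> I"
    "(x * x * a * x + x * a * x * x) * b \<in> I"
    "x * x * (a * b) * x + x * (a * b) * x * x \<in> I"
    using I_mr[OF A_mult[OF b x] polar[OF x a]] I_ml[OF A_mult[OF x a] polar[OF x b]]
      I_mr[OF b sq_mid_swap[OF x a]] sq_mid_swap[OF x A_mult[OF a b]] by auto
  have "(x * x * a + x * a * x + a * x * x) * (b * x)
      - (x * a) * (x * x * b + x * b * x + b * x * x)
      + (x * x * a * x + x * a * x * x) * b
      + (x * x * (a * b) * x + x * (a * b) * x * x) \<in> I"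
    by (rule I_add[OF I_add[OF I_diff[OF h(1,2)] h(3)] h(4)])
  then show ?thesis
    by (simp add: algebra_simps)
qed

lemma prod_list_A: "set l \<subseteq> A \<Longrightarrow> l \<noteq> [] \<Longrightarrow> prod_list l \<in> A"
proof (induction l)
  case (Cons a l)
  then show ?case
    by (cases "l = []") (auto intro: A_mult)
qed simp

lemma prod_list_A1: "set l \<subseteq> A \<Longrightarrow> prod_list l \<in> insert 1 A"
  using prod_list_A[of l] by (cases "l = []") auto

lemma prod_list_B: "set l \<subseteq> A \<Longrightarrow> prod_list l \<in> B"
  using prod_list_A1[of l] one_B A_in_B by auto

lemma I_sandwich:
  assumes "set u \<subseteq> A" "set v \<subseteq> A" "x \<in> I"
  shows "prod_list u * x * prod_list v \<in> I"
  using assms I_mult_left I_mult_right prod_list_B by blast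

text \<open>
  Vanishing of a multiset of factors, in whatever order they are multiplied. This is the right notion
  for induction: gathering equal factors loses control over the order of the others.
\<close>

definition vanishes :: "'r multiset \<Rightarrow> bool" where
  "vanishes M \<longleftrightarrow> (\<forall>l. mset l = M \<longrightarrow> set l \<subseteq> A \<longrightarrow> prod_list l \<in> I)"

lemma mset_split:
  assumes "mset l = add_mset x M"
  obtains u v where "l = u @ x # v" "mset (u @ v) = M"
proof -
  have "x \<in> set l"
    using assms by (metis set_mset_mset union_single_eq_member)
  then obtain u v where "l = u @ x # v"
    by (meson split_list)
  then show ?thesis
    using assms that by auto
qed

lemma vanishes_square:
  assumes sq: "vanishes (add_mset (x * x) M)"
  shows "vanishes (add_mset x (add_mset x M))"
  unfolding vanishes_def
proof (intro allI impI)
  fix l assume l: "mset l = add_mset x (add_mset x M)" "set l \<subseteq> A"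
  obtain u l' where u: "l = u @ x # l'" "mset (u @ l') = add_mset x M"
    using mset_split[OF l(1)] .
  have "\<exists>u a v. l = u @ x # a @ x # v \<and> mset (u @ a @ v) = M"
  proof (cases "x \<in> set l'")
    case True
    then obtain a v where "l' = a @ x # v"
      by (meson split_list)
    then show ?thesis
      using u by (intro exI[of _ u] exI[of _ a] exI[of _ v]) auto
  next
    case False
    then have "x \<in> set u"
      using arg_cong[OF u(2), of set_mset] by auto
    then obtain a v where "u = a @ x # v"
      by (meson split_list)
    then show ?thesis
      using u by (intro exI[of _ a] exI[of _ v] exI[of _ l']) auto
  qed
  then obtain u a v where l_eq: "l = u @ x # a @ x # v" and M: "mset (u @ a @ v) = M"
    by blast
  have x: "x \<in> A" and sub: "set u \<subseteq> A" "set a \<subseteq> A" "set v \<subseteq> A"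
    using l(2) l_eq by auto
  have ins: "prod_list (p @ (x * x) # q) \<in> I" if "p @ q = u @ a @ v" for p q
  proof -
    have "set (p @ q) \<subseteq> A"
      unfolding that using sub by simp
    moreover have "mset (p @ (x * x) # q) = add_mset (x * x) M"
      using M arg_cong[OF that, of mset] by simp
    ultimately show ?thesis
      using sq[unfolded vanishes_def, rule_format, of "p @ (x * x) # q"] x A_mult by simp
  qed
  show "prod_list l \<in> I"
  proof (cases "a = []")
    case True
    then show ?thesis
      using ins[of u v] l_eq by (simp add: mult.assoc)
  next
    case False
    define s where "s = x * x * prod_list a + x * prod_list a * x + prod_list a * x * x"
    have "s \<in> I"
      unfolding s_def using polar x prod_list_A sub False by blast
    then have "prod_list u * s * prod_list v \<in> I"
      using sub by (intro I_sandwich)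
    then have "prod_list u * s * prod_list v
        - prod_list (u @ (x * x) # a @ v) - prod_list ((u @ a) @ (x * x) # v) \<in> I"
      by (intro I_diff ins) simp_all
    then show ?thesis
      by (simp add: s_def l_eq algebra_simps)
  qed
qed

text \<open>
  Three equal factors can be brought into the shape \<open>x\<^sup>2 a x\<close> with \<open>a\<close> nonempty, since the only
  other shape, \<open>x a x\<^sup>2\<close>, is its negative and \<open>x\<^sup>3\<close> is zero.
\<close>

lemma vanishes_cube:
  assumes step: "\<And>u a v. \<lbrakk>mset (u @ a @ v) = M; set (u @ a @ v) \<subseteq> A; a \<noteq> []\<rbrakk> \<Longrightarrow>
    prod_list u * (x * x * prod_list a * x) * prod_list v \<in> I"
  shows "vanishes (add_mset x (add_mset x (add_mset x M)))"
proof (rule vanishes_square, unfold vanishes_def, intro allI impI)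
  fix l assume l: "mset l = add_mset (x * x) (add_mset x M)" "set l \<subseteq> A"
  have "mset l = add_mset x (add_mset (x * x) M)"
    using l by simp
  then obtain u0 v0 where u0: "l = u0 @ x # v0" "mset (u0 @ v0) = add_mset (x * x) M"
    by (rule mset_split)
  have sub: "x \<in> A" "set u0 \<subseteq> A" "set v0 \<subseteq> A"
    using l(2) u0(1) by auto
  obtain p q where pq: "u0 @ v0 = p @ (x * x) # q" "mset (p @ q) = M"
    using mset_split[OF u0(2)] .
  have "x * x \<in> set u0 \<or> x * x \<in> set v0"
    using arg_cong[OF pq(1), of set] by auto
  then show "prod_list l \<in> I"
  proof
    assume "x * x \<in> set u0"
    then obtain u a where ua: "u0 = u @ (x * x) # a"
      by (meson split_list)
    have M: "mset (u @ a @ v0) = M"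
      using u0(2) ua by simp
    have s: "set u \<subseteq> A" "set a \<subseteq> A"
      using sub ua by auto
    show ?thesis
    proof (cases "a = []")
      case True
      have "prod_list u * (x * x * x) * prod_list v0 \<in> I"
        using sub s by (intro I_sandwich cube)
      then show ?thesis
        using u0 ua True by (simp add: mult.assoc)
    next
      case False
      then show ?thesis
        using step[OF M] s sub u0 ua by (simp add: mult.assoc)
    qed
  next
    assume "x * x \<in> set v0"
    then obtain a v where av: "v0 = a @ (x * x) # v"
      by (meson split_list)
    have M: "mset (u0 @ a @ v) = M"
      using u0(2) av by simp
    have s: "set a \<subseteq> A" "set v \<subseteq> A"
      using sub av by auto
    show ?thesis
    proof (cases "a = []")
      case True
      have "prod_list u0 * (x * x * x) * prod_list v \<in> I"
        using sub s by (intro I_sandwich cube)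
      then show ?thesis
        using u0 av True by (simp add: mult.assoc)
    next
      case False
      have "prod_list u0 * (x * x * prod_list a * x + x * prod_list a * x * x) * prod_list v \<in> I"
        using sub s False by (intro I_sandwich sq_mid_swap prod_list_A)
      moreover have "prod_list u0 * (x * x * prod_list a * x) * prod_list v \<in> I"
        using sub s step[OF M] False by simp
      ultimately have "prod_list u0 * (x * x * prod_list a * x + x * prod_list a * x * x) * prod_list v
          - prod_list u0 * (x * x * prod_list a * x) * prod_list v \<in> I"
        by (rule I_diff)
      then show ?thesis
        using u0 av by (simp add: algebra_simps)
    qed
  qed
qed

end

locale nil_cube_no3 = nil_cube +
  assumes no3: "x + x + x \<in> I \<Longrightarrow> x \<in> I"
begin

lemma sq_mid_sq: "x \<in> A \<Longrightarrow> a \<in> A \<Longrightarrow> y \<in> A \<Longrightarrow> x * x * a * y * y \<in> I"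
  using higman no3 by blast

lemma separated_squares:
  assumes "x \<in> A" "y \<in> A" "set (u @ a @ v) \<subseteq> A" "a \<noteq> []"
  shows "prod_list (u @ (x * x) # a @ (y * y) # v) \<in> I"
proof -
  have "prod_list u * (x * x * prod_list a * y * y) * prod_list v \<in> I"
    using assms by (intro I_sandwich sq_mid_sq prod_list_A) auto
  then show ?thesis
    by (simp add: mult.assoc)
qed

text \<open>
  After the three pairs have been gathered into squares, the outer two squares are separated by
  the third one.
\<close>

lemma vanishes_three_pairs:
  assumes "x \<in> A" "y \<in> A" "z \<in> A"
  shows "vanishes ({#x, x, y, y, z, z#} + M)"
proof -
  let ?X = "{x * x, y * y, z * z}"
  have "vanishes ({#x * x, y * y, z * z#} + M)"
    unfolding vanishes_def
  proof (intro allI impI)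
    fix l assume l: "mset l = {#x * x, y * y, z * z#} + M" "set l \<subseteq> A"
    have "size (filter_mset (\<lambda>e. e \<in> ?X) (mset l)) \<ge> 3"
      unfolding l by simp
    then have len: "length (filter (\<lambda>e. e \<in> ?X) l) \<ge> 3"
      by (metis mset_filter size_mset)
    then have "\<exists>e\<in>set l. e \<in> ?X"
      by (metis (no_types, lifting) filter_False list.size(3) not_numeral_le_zero)
    then obtain u s r where 1: "l = u @ s # r" "s \<in> ?X" "\<forall>e\<in>set u. e \<notin> ?X"
      by (rule split_list_first_propE) blast
    have len2: "length (filter (\<lambda>e. e \<in> ?X) r) \<ge> 2"
      using len 1 by (simp add: filter_False)
    then have "\<exists>e\<in>set r. e \<in> ?X"
      by (metis (no_types, lifting) filter_False list.size(3) not_numeral_le_zero)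
    then obtain a t v where 2: "r = a @ t # v" "t \<in> ?X" "\<forall>e\<in>set v. e \<notin> ?X"
      by (rule split_list_last_propE) blast
    have "a \<noteq> []"
      using len2 2 by (auto simp: filter_False)
    moreover obtain s' t' where "s = s' * s'" "t = t' * t'" "s' \<in> A" "t' \<in> A"
      using 1 2 assms by auto
    ultimately show "prod_list l \<in> I"
      using separated_squares[of s' t' u a v] l(2) 1 2 by auto
  qed
  then have "vanishes (add_mset x (add_mset x ({#y * y, z * z#} + M)))"
    by (intro vanishes_square) simp
  then have "vanishes (add_mset (y * y) ({#x, x, z * z#} + M))"
    by (simp add: add_mset_commute)
  then have "vanishes (add_mset y (add_mset y ({#x, x, z * z#} + M)))"
    by (rule vanishes_square)
  then have "vanishes (add_mset (z * z) ({#x, x, y, y#} + M))"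
    by (simp add: add_mset_commute)
  then have "vanishes (add_mset z (add_mset z ({#x, x, y, y#} + M)))"
    by (rule vanishes_square)
  then show ?thesis
    by (simp add: add_mset_commute)
qed

end

locale nil_cube_char2 = nil_cube_no3 +
  assumes char2: "x + x = (0 :: 'a)"
begin

text \<open>
  In characteristic 2 the middle term of \<open>almost_derivation\<close> disappears, and the operator
  \<open>\<delta> a = x\<^sup>2ax\<close> slides along a product.
\<close>

lemma slide_sq:
  assumes "x \<in> A" "a \<in> A" "b \<in> A"
  shows "a * x * x * b * x + x * x * a * x * b \<in> I"
proof -
  have "x * x * a * b * x + x * x * a * b * x = 0"
    by (rule char2)
  then show ?thesis
    using almost_derivation[OF assms] by (simp add: add.assoc)
qed

text \<open>
  Up to sign, only \<open>x\<^sup>2y\<^sup>2x\<close> avoids two squares with a gap between them; the extra factor makes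
  it possible to slide \<open>x\<close> away from \<open>y\<^sup>2\<close> and open such a gap.
\<close>

lemma vanishes_cube_pair:
  assumes x: "x \<in> A" and y: "y \<in> A" and M: "M \<noteq> {#}"
  shows "vanishes ({#x, x, x, y, y#} + M)"
proof -
  have "vanishes (add_mset x (add_mset x (add_mset x (add_mset (y * y) M))))"
  proof (rule vanishes_cube)
    fix u a v assume uav: "mset (u @ a @ v) = add_mset (y * y) M" "set (u @ a @ v) \<subseteq> A" "a \<noteq> []"
    have sub: "set u \<subseteq> A" "set a \<subseteq> A" "set v \<subseteq> A" "prod_list a \<in> A"
      using uav prod_list_A by auto
    let ?goal = "prod_list u * (x * x * prod_list a * x) * prod_list v"
    have sm: "prod_list p * (x * x * b * x + x * b * x * x) * prod_list q \<in> I"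
      if "set p \<subseteq> A" "set q \<subseteq> A" "b \<in> A" for p q b
      using that x by (intro I_sandwich sq_mid_swap)
    have gap: "prod_list p * (s * s * b * t * t) * prod_list q \<in> I"
      if "set p \<subseteq> A" "set q \<subseteq> A" "b \<in> A" "s \<in> A" "t \<in> A" for p q s t b
      using that by (intro I_sandwich sq_mid_sq)
    have "y * y \<in> set (u @ a @ v)"
      using uav(1) by (metis set_mset_mset union_single_eq_member)
    then consider "y * y \<in> set u" | "y * y \<in> set v" | "y * y \<in> set a"
      by auto
    then show "?goal \<in> I"
    proof cases
      case 1
      then obtain u1 u2 where u: "u = u1 @ (y * y) # u2"
        by (meson split_list)
      show ?thesis
      proof (cases "u2 = []")
        case True
        have "prod_list u1 * (y * y) * (x * x * prod_list a * x + x * prod_list a * x * x)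
            * prod_list v - prod_list u1 * (y * y * (x * prod_list a) * x * x) * prod_list v \<in> I"
          using sm[of "u1 @ [y * y]" v "prod_list a"] gap[of u1 v "x * prod_list a" y x]
            u sub x y A_mult by (intro I_diff) auto
        then show ?thesis
          using u True by (simp add: algebra_simps)
      next
        case False
        have "prod_list u1 * (y * y * prod_list u2 * x * x) * prod_list ((prod_list a * x) # v) \<in> I"
          using u False sub x y by (intro gap prod_list_A) (auto intro: A_mult)
        then show ?thesis
          using u by (simp add: mult.assoc)
      qed
    next
      case 2
      then obtain v1 v2 where v: "v = v1 @ (y * y) # v2"
        by (meson split_list)
      have "prod_list u * (x * x * prod_list (a @ x # v1) * y * y) * prod_list v2 \<in> I"
        using v sub x y by (intro gap prod_list_A) auto
      then show ?thesis
        using v by (simp add: mult.assoc)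
    next
      case 3
      then obtain a1 a2 where a: "a = a1 @ (y * y) # a2"
        by (meson split_list)
      show ?thesis
      proof (cases "a1 = []")
        case False
        have "prod_list u * (x * x * prod_list a1 * y * y) * prod_list (a2 @ x # v) \<in> I"
          using a sub x y False by (intro gap prod_list_A) auto
        then show ?thesis
          using a by (simp add: mult.assoc)
      next
        case a1: True
        show ?thesis
        proof (cases "a2 = []")
          case False
          have "prod_list u * (x * x * prod_list a * x + x * prod_list a * x * x) * prod_list v
              - prod_list (u @ [x]) * (y * y * prod_list a2 * x * x) * prod_list v \<in> I"
            using a sub x y False by (intro I_diff sm gap prod_list_A) auto
          then show ?thesis
            using a a1 by (simp add: algebra_simps)
        next
          case a2: True
          have yy: "y * y \<in> A"
            using y A_mult by auto
          have "u \<noteq> [] \<or> v \<noteq> []"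
            using uav(1) M a a1 a2 by auto
          then show ?thesis
          proof
            assume "u \<noteq> []"
            then have pu: "prod_list u \<in> A"
              using sub prod_list_A by blast
            have "(prod_list u * x * x * (y * y) * x + x * x * prod_list u * x * (y * y)
                - x * x * (prod_list u * x) * y * y) * prod_list v \<in> I"
              using pu x y yy sub
              by (intro I_mult_right I_diff slide_sq sq_mid_sq A_mult prod_list_B)
            then show ?thesis
              using a a1 a2 by (simp add: algebra_simps)
          next
            assume "v \<noteq> []"
            then have pv: "prod_list v \<in> A"
              using sub prod_list_A by blast
            have "prod_list u * ((y * y * x * x * prod_list v * x + x * x * (y * y) * x * prod_list v)
              - (y * y) * (x * x * prod_list v * x + x * prod_list v * x * x)
              + y * y * (x * prod_list v) * x * x) \<in> I"
              using pv x y yy sub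
              by (intro I_mult_left I_diff I_add slide_sq sq_mid_sq sq_mid_swap A_mult prod_list_B
                  A_in_B)
            then show ?thesis
              using a a1 a2 by (simp add: algebra_simps)
          qed
        qed
      qed
    qed
  qed
  then have "vanishes (add_mset (y * y) ({#x, x, x#} + M))"
    by (simp add: add_mset_commute)
  then have "vanishes (add_mset y (add_mset y ({#x, x, x#} + M)))"
    by (rule vanishes_square)
  then show ?thesis
    by (simp add: add_mset_commute)
qed

end

locale nil_cube_no23 = nil_cube_no3 +
  assumes no2: "x + x \<in> I \<Longrightarrow> x \<in> I"
begin

lemma sq_mid_anti:
  assumes "x \<in> A" "a \<in> A" "y \<in> A" "z \<in> A"
  shows "x * x * a * y * z + x * x * a * z * y \<in> I"
proof -
  have "x * x * a * (y + z) * (y + z) - x * x * a * y * y - x * x * a * z * z \<in> I"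
    using assms by (intro I_diff sq_mid_sq A_add)
  then show ?thesis
    by (simp add: algebra_simps)
qed

lemma anti_mid_sq:
  assumes "x \<in> A" "a \<in> A" "y \<in> A" "z \<in> A"
  shows "y * z * a * x * x + z * y * a * x * x \<in> I"
proof -
  have "(y + z) * (y + z) * a * x * x - y * y * a * x * x - z * z * a * x * x \<in> I"
    using assms by (intro I_diff sq_mid_sq A_add)
  then show ?thesis
    by (simp add: algebra_simps)
qed

text \<open>
  Behind \<open>x\<^sup>2 a\<close> factors anticommute. Moving \<open>bc\<close> past \<open>d\<close> as one block costs one sign, as two
  factors two signs.
\<close>

lemma sq_four:
  assumes "x \<in> A" "a \<in> A" "b \<in> A" "c \<in> A" "d \<in> A"
  shows "x * x * a * b * c * d \<in> I"
proof -
  have "(x * x * a * (b * c) * d + x * x * a * d * (b * c))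
      + (x * x * (a * b) * c * d + x * x * (a * b) * d * c)
      - (x * x * a * b * d + x * x * a * d * b) * c \<in> I"
    using assms by (intro I_add I_diff I_mr sq_mid_anti A_mult)
  then have "x * x * a * b * c * d + x * x * a * b * c * d \<in> I"
    by (simp add: algebra_simps)
  then show ?thesis
    by (rule no2)
qed

lemma four_sq:
  assumes "x \<in> A" "a \<in> A" "b \<in> A" "c \<in> A" "d \<in> A"
  shows "d * c * b * a * x * x \<in> I"
proof -
  have "(d * (c * b) * a * x * x + (c * b) * d * a * x * x)
      + (d * c * (b * a) * x * x + c * d * (b * a) * x * x)
      - c * (d * b * a * x * x + b * d * a * x * x) \<in> I"
    using assms by (intro I_add I_diff I_ml anti_mid_sq A_mult)
  then have "d * c * b * a * x * x + d * c * b * a * x * x \<in> I"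
    by (simp add: algebra_simps)
  then show ?thesis
    by (rule no2)
qed

lemma anti_four:
  assumes "x \<in> A" "y \<in> A" "a \<in> A" "b \<in> A" "c \<in> A" "d \<in> A"
  shows "x * y * a * b * c * d + y * x * a * b * c * d \<in> I"
proof -
  have "(x + y) * (x + y) * a * b * c * d - x * x * a * b * c * d - y * y * a * b * c * d \<in> I"
    using assms by (intro I_diff sq_four A_add)
  then show ?thesis
    by (simp add: algebra_simps)
qed

lemma four_anti:
  assumes "x \<in> A" "y \<in> A" "a \<in> A" "b \<in> A" "c \<in> A" "d \<in> A"
  shows "a * b * c * d * x * y + a * b * c * d * y * x \<in> I"
proof -
  have "a * b * c * d * (x + y) * (x + y) - a * b * c * d * x * x - a * b * c * d * y * y \<in> I"
    using assms by (intro I_diff four_sq A_add)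
  then show ?thesis
    by (simp add: algebra_simps)
qed

text \<open>
  Write \<open>P\<close> and \<open>Q\<close> for the two products. Splitting \<open>x\<close> around \<open>de\<close>, and then moving one \<open>x\<close> to the
  far left or to the far right of the product, expresses \<open>axdexf\<close> in two ways and yields
  \<open>P + 2Q = 0\<close> and \<open>2P + Q = 0\<close>.
\<close>

lemma one_sq_three_and_three_sq_one:
  assumes A: "a \<in> A" "x \<in> A" "d \<in> A" "e \<in> A" "f \<in> A"
  shows "a * x * x * d * e * f \<in> I" and "a * d * e * x * x * f \<in> I"
proof -
  define P where "P = a * x * x * d * e * f"
  define Q where "Q = a * d * e * x * x * f"
  have mid: "P + a * x * d * e * x * f + Q \<in> I"
  proof -
    have "a * (x * x * (d * e) + x * (d * e) * x + (d * e) * x * x) * f \<in> I"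
      using A by (intro I_ml I_mr polar A_mult)
    then show ?thesis
      by (simp add: P_def Q_def algebra_simps)
  qed
  have E1: "P + Q + Q \<in> I"
  proof -
    have "(P + a * x * d * e * x * f + Q)
        - (a * x * d * e * x * f + x * a * d * e * x * f)
        + (x * x * (a * d * e) + x * (a * d * e) * x + (a * d * e) * x * x) * f
        - x * x * a * d * e * f \<in> I"
      using A by (intro I_diff I_add mid anti_four sq_four I_mr polar A_mult)
    then show ?thesis
      by (simp add: P_def Q_def algebra_simps)
  qed
  have E2: "P + P + Q \<in> I"
  proof -
    have "(P + a * x * d * e * x * f + Q)
        - (a * x * d * e * x * f + a * x * d * e * f * x)
        + a * (x * x * (d * e * f) + x * (d * e * f) * x + (d * e * f) * x * x)
        - a * d * e * f * x * x \<in> I"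
      using A by (intro I_diff I_add mid four_anti four_sq I_ml polar A_mult)
    then show ?thesis
      by (simp add: P_def Q_def algebra_simps)
  qed
  have "P + P + P \<in> I" "Q + Q + Q \<in> I"
    using I_diff[OF I_add[OF E2 E2] E1] I_diff[OF I_add[OF E1 E1] E2]
    by (simp_all add: algebra_simps)
  then show "a * x * x * d * e * f \<in> I" "a * d * e * x * x * f \<in> I"
    unfolding P_def Q_def by (auto intro: no3)
qed

lemma one_anti_three:
  assumes "a \<in> A" "x \<in> A" "y \<in> A" "d \<in> A" "e \<in> A" "f \<in> A"
  shows "a * x * y * d * e * f + a * y * x * d * e * f \<in> I"
proof -
  have "a * (x + y) * (x + y) * d * e * f - a * x * x * d * e * f - a * y * y * d * e * f \<in> I"
    using assms by (intro I_diff one_sq_three_and_three_sq_one A_add)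
  then show ?thesis
    by (simp add: algebra_simps)
qed

lemma three_anti_one:
  assumes "a \<in> A" "x \<in> A" "y \<in> A" "d \<in> A" "e \<in> A" "f \<in> A"
  shows "a * d * e * x * y * f + a * d * e * y * x * f \<in> I"
proof -
  have "a * d * e * (x + y) * (x + y) * f - a * d * e * x * x * f - a * d * e * y * y * f \<in> I"
    using assms by (intro I_diff one_sq_three_and_three_sq_one A_add)
  then show ?thesis
    by (simp add: algebra_simps)
qed

text \<open>
  Here the exchanged neighbours are in the centre. In the polarized identity for \<open>ab\<close>, \<open>x\<close>, \<open>y\<close> the
  exchanges already available cancel two terms and identify the other four in pairs.
\<close>

lemma two_anti_two:
  assumes A: "a \<in> A" "b \<in> A" "x \<in> A" "y \<in> A" "e \<in> A" "f \<in> A"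
  shows "a * b * x * y * e * f + a * b * y * x * e * f \<in> I"
proof -
  define W where "W p q r s = p * q * r * s * e * f" for p q r s
  have a12: "W p q r s + W q p r s \<in> I" and a23: "W p q r s + W p r q s \<in> I"
    if "p \<in> A" "q \<in> A" "r \<in> A" "s \<in> A" for p q r s
    unfolding W_def using that A by (auto intro: anti_four one_anti_three)
  have T: "W a b x y + W x a b y + W a b y x + W x y a b + W y a b x + W y x a b \<in> I"
  proof -
    have "((a * b) * x * y + x * (a * b) * y + (a * b) * y * x + x * y * (a * b)
        + y * (a * b) * x + y * x * (a * b)) * (e * f) \<in> I"
      using polar3[of "a * b" x y] A
      by (intro I_mr A_mult) (auto intro: A_mult simp: add_ac)
    then show ?thesis
      by (simp add: W_def algebra_simps)
  qed
  have "W a b x y + W x a b y + W a b y x + W x y a b + W y a b x + W y x a b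
      - (W x y a b + W y x a b) - (W x a b y + W a x b y) + (W a x b y + W a b x y)
      - (W y a b x + W a y b x) + (W a y b x + W a b y x) \<in> I"
    using A by (intro I_diff I_add T a12 a23)
  then have "(W a b x y + W a b y x) + (W a b x y + W a b y x) \<in> I"
    by (simp add: algebra_simps)
  then show ?thesis
    unfolding W_def by (rule no2)
qed

lemma six:
  assumes A: "a \<in> A" "b \<in> A" "c \<in> A" "d \<in> A" "e \<in> A" "f \<in> A"
  shows "a * b * c * d * e * f \<in> I"
proof -
  define W where "W p q r s t = p * q * r * s * t * f" for p q r s t
  have a12: "W p q r s t + W q p r s t \<in> I" and a23: "W p q r s t + W p r q s t \<in> I"
    and a34: "W p q r s t + W p q s r t \<in> I" and a45: "W p q r s t + W p q r t s \<in> I"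
    if "p \<in> A" "q \<in> A" "r \<in> A" "s \<in> A" "t \<in> A" for p q r s t
    unfolding W_def using that A
    by (auto intro: anti_four one_anti_three two_anti_two three_anti_one)
  have m23: "W p q r s t - W p r s q t \<in> I" and m12: "W p q r s t - W q r p s t \<in> I"
    and m34: "W p q r s t - W p q s t r \<in> I"
    if "p \<in> A" "q \<in> A" "r \<in> A" "s \<in> A" "t \<in> A" for p q r s t
    using that I_diff[OF a23[of p q r s t] a34[of p r q s t]]
      I_diff[OF a12[of p q r s t] a23[of q p r s t]]
      I_diff[OF a34[of p q r s t] a45[of p q s r t]] by simp_all
  have T: "W a b c d e + W c d a b e + W a b e c d + W c d e a b + W e a b c d + W e c d a b \<in> I"
  proof -
    have "((a * b) * (c * d) * e + (c * d) * (a * b) * e + (a * b) * e * (c * d)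
        + (c * d) * e * (a * b) + e * (a * b) * (c * d) + e * (c * d) * (a * b)) * f \<in> I"
      using A by (intro I_mr polar3 A_mult)
    then show ?thesis
      by (simp add: W_def algebra_simps)
  qed
  \<comment> \<open>Moving a block of two letters is an even permutation, so all six words in \<open>T\<close> agree.\<close>
  have s1: "W a b c d e - W c d a b e \<in> I"
  proof -
    have "(W a b c d e - W a c d b e) + (W a c d b e - W c d a b e) \<in> I"
      using A by (intro I_add m12 m23)
    then show ?thesis by simp
  qed
  have s3: "W a b c d e - W a b e c d \<in> I"
  proof -
    have "(W a b c d e - W a b d e c) + (W a b d e c - W a b e c d) \<in> I"
      using A by (intro I_add m34)
    then show ?thesis by simp
  qed
  have s4: "W c d a b e - W c d e a b \<in> I"
  proof -
    have "(W c d a b e - W c d b e a) + (W c d b e a - W c d e a b) \<in> I"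
      using A by (intro I_add m34)
    then show ?thesis by simp
  qed
  have s5: "W e a b c d - W a b e c d \<in> I" and s6: "W e c d a b - W c d e a b \<in> I"
    using A by (intro m12; simp)+
  have s31: "W a b c d e - W c d e a b \<in> I"
    using I_add[OF s1 s4] by simp
  have sixfold: "(w0 + w0) + (w0 + w0) + (w0 + w0) \<in> I"
    if "w0 + w1 + w2 + w3 + w4 + w5 \<in> I" "w0 - w1 \<in> I" "w0 - w2 \<in> I" "w0 - w3 \<in> I"
      "w4 - w2 \<in> I" "w5 - w3 \<in> I" for w0 w1 w2 w3 w4 w5
  proof -
    have "w0 + w1 + w2 + w3 + w4 + w5 - (w4 - w2) - (w5 - w3) + (w0 - w1)
        + ((w0 - w2) + (w0 - w2)) + ((w0 - w3) + (w0 - w3)) \<in> I"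
      using that by (blast intro: I_add I_diff)
    moreover have "w0 + w1 + w2 + w3 + w4 + w5 - (w4 - w2) - (w5 - w3) + (w0 - w1)
        + ((w0 - w2) + (w0 - w2)) + ((w0 - w3) + (w0 - w3)) = (w0 + w0) + (w0 + w0) + (w0 + w0)"
      by simp
    ultimately show ?thesis
      by simp
  qed
  have "(W a b c d e + W a b c d e) + (W a b c d e + W a b c d e) + (W a b c d e + W a b c d e) \<in> I"
    by (rule sixfold[OF T s1 s3 s31 s5 s6])
  then show ?thesis
    unfolding W_def by (rule no2[OF no3])
qed

end

section \<open>The relatively free algebra\<close>

abbreviation free_alg :: "nat \<Rightarrow> ('k :: field, nat word \<Rightarrow>\<^sub>0 'k) nu_algebra" where
  "free_alg d \<equiv> free_nu_algebra {..<d}"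

definition cube_ideal :: "nat \<Rightarrow> (nat word \<Rightarrow>\<^sub>0 'k :: field) set" where
  "cube_ideal d = nu_genideal (free_alg d) ((\<lambda>a. nu_power (free_alg d) a 3) ` carrier (free_alg d))"

definition mon :: "nat list \<Rightarrow> (nat word \<Rightarrow>\<^sub>0 'k :: field)" where
  "mon w = Poly_Mapping.single (Word w) 1"

lemma mon_append: "mon (u @ v) = mon u * mon v"
  by (simp add: mon_def mult_single plus_word_def)

lemma mon_Nil: "mon [] = 1"
  by (simp add: mon_def flip: zero_word_def)

lemma prod_list_mon: "prod_list (map (\<lambda>x. mon [x]) w) = mon w"
proof (induction w)
  case (Cons x w)
  then show ?case
    by (simp add: mon_append[of "[x]" w, simplified])
qed (simp add: mon_Nil)

lemma single_eq_scaled_mon: "Poly_Mapping.single w c = Poly_Mapping.single 0 c * mon (letters w)"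
  by (simp add: mon_def mult_single)

lemma sum_single_keys:
  "(\<Sum>w\<in>Poly_Mapping.keys f. Poly_Mapping.single w (Poly_Mapping.lookup f w)) = f"
proof (rule poly_mapping_eqI)
  fix v
  have "(\<Sum>w\<in>Poly_Mapping.keys f. Poly_Mapping.lookup f w when w = v) = Poly_Mapping.lookup f v"
    by (simp add: when_def sum.delta in_keys_iff)
  then show "Poly_Mapping.lookup (\<Sum>w\<in>Poly_Mapping.keys f.
      Poly_Mapping.single w (Poly_Mapping.lookup f w)) v = Poly_Mapping.lookup f v"
    by (simp add: lookup_sum lookup_single)
qed

lemma carrier_free: "carrier (free_alg d) =
    {f. \<forall>w\<in>Poly_Mapping.keys f. letters w \<noteq> [] \<and> set (letters w) \<subseteq> {..<d}}"
  by (simp add: free_nu_algebra_def)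

lemma mon_in_free: "mon w \<in> carrier (free_alg d) \<longleftrightarrow> w \<noteq> [] \<and> set w \<subseteq> {..<d}"
  by (simp add: carrier_free mon_def)

lemma free_ops [simp]:
  "nu_zero (free_alg d) = 0" "nu_add (free_alg d) = (+)" "nu_mult (free_alg d) = (*)"
  "nu_scale (free_alg d) r f = Poly_Mapping.single 0 r * f"
  by (simp_all add: free_nu_algebra_def map_mult_eq_single_times)

lemma nu_prod_free: "as \<noteq> [] \<Longrightarrow> nu_prod (free_alg d) as = prod_list as"
proof -
  have "foldl (*) a as = a * prod_list as" for a :: "nat word \<Rightarrow>\<^sub>0 'a" and as
    by (induction as arbitrary: a) (simp_all add: mult.assoc)
  then show "as \<noteq> [] \<Longrightarrow> ?thesis"
    by (cases as) (simp_all add: nu_prod_def)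
qed

lemma cube_free: "nu_power (free_alg d) a 3 = a * a * a"
  by (simp add: nu_power_def nu_prod_free numeral_3_eq_3 mult.assoc)

lemma nu_prod_quotient:
  assumes A: "nonunital_algebra A" and I: "nu_ideal I A"
    and as: "as \<noteq> []" "set as \<subseteq> carrier A"
  shows "nu_prod A as \<in> carrier A \<and>
    nu_prod (nu_quotient A I) (map (nu_coset A I) as) = nu_coset A I (nu_prod A as)"
proof -
  have "foldl (nu_mult A) a bs \<in> carrier A \<and>
      foldl (nu_mult (nu_quotient A I)) (nu_coset A I a) (map (nu_coset A I) bs) =
        nu_coset A I (foldl (nu_mult A) a bs)"
    if "a \<in> carrier A" "set bs \<subseteq> carrier A" for a bs
    using that
  proof (induction bs arbitrary: a)
    case (Cons b bs)
    then show ?case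
      using nonunital_algebra.mult_closed[OF A, of a b] by (simp add: nu_quotient_mult[OF A I])
  qed simp
  then show ?thesis
    using as by (cases as) (simp_all add: nu_prod_def)
qed

lemma cube_ideal: "nu_ideal (cube_ideal d) (free_alg d :: ('k :: field, _) nu_algebra)"
  "a \<in> carrier (free_alg d) \<Longrightarrow> a * a * a \<in> (cube_ideal d :: (nat word \<Rightarrow>\<^sub>0 'k) set)"
proof -
  have sub: "(\<lambda>a. nu_power (free_alg d) a 3) ` carrier (free_alg d) \<subseteq>
      carrier (free_alg d :: ('k, _) nu_algebra)"
    using nonunital_algebra.mult_closed[OF nonunital_algebra_free[where 'b = 'k], of _ "{..<d}"]
    by (auto simp: cube_free)
  show "nu_ideal (cube_ideal d) (free_alg d :: ('k, _) nu_algebra)"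
    unfolding cube_ideal_def by (rule nu_genideal_is_ideal(1)[OF nonunital_algebra_free sub])
  show "a * a * a \<in> (cube_ideal d :: (nat word \<Rightarrow>\<^sub>0 'k) set)" if "a \<in> carrier (free_alg d)"
    using nu_genideal_is_ideal(2)[OF nonunital_algebra_free sub] that
    unfolding cube_ideal_def by (force simp: cube_free)
qed

lemma cube_ideal_add: "x \<in> cube_ideal d \<Longrightarrow> y \<in> cube_ideal d \<Longrightarrow> x + y \<in> cube_ideal d"
  and cube_ideal_scale: "x \<in> cube_ideal d \<Longrightarrow> Poly_Mapping.single 0 c * x \<in> cube_ideal d"
  and cube_ideal_zero: "0 \<in> cube_ideal d"
  using cube_ideal(1)[of d] by (auto simp: nu_ideal_def)

lemma cube_ideal_mult:
  assumes "x \<in> cube_ideal d" "b \<in> carrier (free_alg d)"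
  shows "b * x \<in> cube_ideal d" "x * b \<in> cube_ideal d"
  using cube_ideal(1)[of d] assms by (auto simp: nu_ideal_def)

lemma cube_ideal_sum: "(\<And>i. i \<in> S \<Longrightarrow> f i \<in> cube_ideal d) \<Longrightarrow> sum f S \<in> cube_ideal d"
  by (induction S rule: infinite_finite_induct) (auto intro: cube_ideal_add cube_ideal_zero)

lemma cube_ideal_from_mons:
  fixes f :: "nat word \<Rightarrow>\<^sub>0 'k :: field"
  assumes "\<And>w. w \<in> Poly_Mapping.keys f \<Longrightarrow>
    mon (letters w) \<in> (cube_ideal d :: (nat word \<Rightarrow>\<^sub>0 'k) set)"
  shows "f \<in> cube_ideal d"
proof -
  have "(\<Sum>w\<in>Poly_Mapping.keys f. Poly_Mapping.single w (Poly_Mapping.lookup f w)) \<in> cube_ideal d"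
  proof (rule cube_ideal_sum)
    fix w assume "w \<in> Poly_Mapping.keys f"
    then have "Poly_Mapping.single 0 (Poly_Mapping.lookup f w) * mon (letters w) \<in> cube_ideal d"
      using assms by (intro cube_ideal_scale)
    then show "Poly_Mapping.single w (Poly_Mapping.lookup f w) \<in> cube_ideal d"
      by (simp flip: single_eq_scaled_mon)
  qed
  then show ?thesis
    by (simp add: sum_single_keys)
qed

text \<open>
  The polarized identity is extracted by comparing \<open>(a + x)\<^sup>3\<close> with \<open>(a + tx)\<^sup>3\<close>: a single scalar \<open>t\<close>
  different from 0 and 1 suffices to separate the parts of degree 1 and 2 in \<open>x\<close>.
\<close>

lemma nil_cube_free:
  assumes inf: "infinite (UNIV :: 'k :: field set)"
  shows "nil_cube (carrier (free_alg d)) {f. \<forall>w\<in>Poly_Mapping.keys f. set (letters w) \<subseteq> {..<d}}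
    (cube_ideal d :: (nat word \<Rightarrow>\<^sub>0 'k) set)"
proof -
  let ?A = "carrier (free_alg d :: ('k, _) nu_algebra)"
  let ?I = "cube_ideal d :: (nat word \<Rightarrow>\<^sub>0 'k) set"
  interpret F: nonunital_algebra "free_alg d :: ('k, _) nu_algebra"
    by (rule nonunital_algebra_free)
  have uminus: "- x = Poly_Mapping.single 0 (- 1) * x" for x :: "nat word \<Rightarrow>\<^sub>0 'k"
    by (simp add: single_uminus)
  have diff: "x - y \<in> ?I" if "x \<in> ?I" "y \<in> ?I" for x y
    using cube_ideal_add[OF that(1) cube_ideal_scale[OF that(2), of "- 1"]]
    unfolding uminus[of y, symmetric] by simp
  have expand: "b = (\<Sum>w\<in>Poly_Mapping.keys b. Poly_Mapping.single w (Poly_Mapping.lookup b w))"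
    for b :: "nat word \<Rightarrow>\<^sub>0 'k"
    by (simp add: sum_single_keys)
  have scaled: "Poly_Mapping.single w c * x \<in> ?I \<and> x * Poly_Mapping.single w c \<in> ?I"
    if "set (letters w) \<subseteq> {..<d}" "x \<in> ?I" for w c x
  proof (cases "letters w = []")
    case True
    then have "w = 0"
      by (metis letters_def word.collapse zero_word_def)
    then show ?thesis
      using that cube_ideal_scale[of x d c] by (simp add: single_zero_commutes)
  next
    case False
    then have "Poly_Mapping.single w c \<in> ?A"
      using that by (auto simp: carrier_free)
    then show ?thesis
      using that cube_ideal_mult by auto
  qed
  show ?thesis
  proof
    fix b x :: "nat word \<Rightarrow>\<^sub>0 'k"
    assume b: "b \<in> {f. \<forall>w\<in>Poly_Mapping.keys f. set (letters w) \<subseteq> {..<d}}" and x: "x \<in> ?I"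
    have "(\<Sum>w\<in>Poly_Mapping.keys b. Poly_Mapping.single w (Poly_Mapping.lookup b w) * x) \<in> ?I"
      "(\<Sum>w\<in>Poly_Mapping.keys b. x * Poly_Mapping.single w (Poly_Mapping.lookup b w)) \<in> ?I"
      using b x scaled by (auto intro!: cube_ideal_sum)
    then show "b * x \<in> ?I" "x * b \<in> ?I"
      by (simp_all add: sum_single_keys flip: sum_distrib_left sum_distrib_right)
  next
    fix a x assume a: "a \<in> ?A" and x: "x \<in> ?A"
    define s where "s x a = x * x * a + x * a * x + a * x * x" for x a :: "nat word \<Rightarrow>\<^sub>0 'k"
    \<comment> \<open>A scalar for which the vectors \<open>(1, 1)\<close> and \<open>(t, t\<^sup>2)\<close> are independent.\<close>
    have "\<exists>t. t \<notin> {0, 1 :: 'k}"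
      using inf by (metis ex_new_if_finite finite.emptyI finite.insertI)
    then obtain t :: 'k where t: "t \<noteq> 0" "t \<noteq> 1"
      by auto
    define \<tau> where "\<tau> = Poly_Mapping.single (0 :: nat word) t"
    have comm: "f * \<tau> = \<tau> * f" for f
      unfolding \<tau>_def by (rule single_zero_commutes)
    have ta: "\<tau> * x \<in> ?A"
      using F.scale_closed[OF x, of t] by (simp add: \<tau>_def)
    have "(a + x) * (a + x) * (a + x) - a * a * a - x * x * x \<in> ?I"
      using a x F.add_closed[OF a x] by (intro diff cube_ideal(2)) simp_all
    then have 1: "s a x + s x a \<in> ?I"
      by (simp add: s_def algebra_simps)
    have "(a + \<tau> * x) * (a + \<tau> * x) * (a + \<tau> * x) - a * a * a
        - (\<tau> * x) * (\<tau> * x) * (\<tau> * x) \<in> ?I"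
      using a ta F.add_closed[OF a ta] by (intro diff cube_ideal(2)) simp_all
    moreover have "(a + \<tau> * x) * (a + \<tau> * x) * (a + \<tau> * x) - a * a * a
        - (\<tau> * x) * (\<tau> * x) * (\<tau> * x) = \<tau> * s a x + \<tau> * \<tau> * s x a"
    proof -
      have "x * (\<tau> * g) = \<tau> * (x * g)" "a * (\<tau> * g) = \<tau> * (a * g)" for g
        by (metis comm mult.assoc)+
      then show ?thesis
        by (simp add: s_def algebra_simps)
    qed
    ultimately have "\<tau> * s a x + \<tau> * \<tau> * s x a - \<tau> * (s a x + s x a) \<in> ?I"
      using diff cube_ideal_scale[OF 1, of t] by (simp add: \<tau>_def)
    moreover have "\<tau> * s a x + \<tau> * \<tau> * s x a - \<tau> * (s a x + s x a) =
        Poly_Mapping.single 0 (t * t - t) * s x a"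
      by (simp add: \<tau>_def algebra_simps mult_single single_diff)
    ultimately have "Poly_Mapping.single 0 (inverse (t * t - t)) *
        (Poly_Mapping.single 0 (t * t - t) * s x a) \<in> ?I"
      using cube_ideal_scale by metis
    moreover have "t * t - t \<noteq> 0"
      using t by simp
    ultimately have "s x a \<in> ?I"
      by (simp add: mult_single flip: mult.assoc)
    then show "x * x * a + x * a * x + a * x * x \<in> ?I"
      by (simp add: s_def)
  next
    fix x assume "x \<in> ?I"
    then show "- x \<in> ?I"
      using cube_ideal_scale uminus by metis
  next
    fix a b assume "a \<in> ?A" "b \<in> ?A"
    then show "a + b \<in> ?A" "a * b \<in> ?A"
      using F.add_closed F.mult_closed by auto
  next
    fix a assume "a \<in> ?A"
    then show "- a \<in> ?A"
      using F.scale_closed[of a "- 1"] by (simp add: uminus)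
  qed (use cube_ideal cube_ideal_add in \<open>auto simp: carrier_free zero_word_def\<close>)
qed

lemma cube_ideal_unscale:
  assumes "Poly_Mapping.single 0 c * x \<in> cube_ideal d" "c \<noteq> 0"
  shows "x \<in> cube_ideal d"
  using cube_ideal_scale[OF assms(1), of "inverse c"] assms(2)
  by (simp add: mult_single flip: mult.assoc)

lemma triple_in_cube_ideal:
  assumes "x + x + x \<in> cube_ideal d" "(3 :: 'k :: field) \<noteq> 0"
  shows "(x :: nat word \<Rightarrow>\<^sub>0 'k) \<in> cube_ideal d"
proof (rule cube_ideal_unscale[of "1 + 1 + 1"])
  show "Poly_Mapping.single 0 (1 + 1 + 1) * x \<in> cube_ideal d"
    using assms(1) by (simp only: single_add distrib_right) simp
qed (use assms(2) in simp)

lemma double_in_cube_ideal: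
  assumes "x + x \<in> cube_ideal d" "(2 :: 'k :: field) \<noteq> 0"
  shows "(x :: nat word \<Rightarrow>\<^sub>0 'k) \<in> cube_ideal d"
proof (rule cube_ideal_unscale[of "1 + 1"])
  show "Poly_Mapping.single 0 (1 + 1) * x \<in> cube_ideal d"
    using assms(1) by (simp only: single_add distrib_right) simp
qed (use assms(2) in simp)

lemma keys_prod_list:
  fixes as :: "(nat word \<Rightarrow>\<^sub>0 'k :: field) list"
  assumes "set as \<subseteq> carrier (free_alg d)" "w \<in> Poly_Mapping.keys (prod_list as)"
  shows "length (letters w) \<ge> length as \<and> set (letters w) \<subseteq> {..<d}"
  using assms
proof (induction as arbitrary: w)
  case Nil
  then show ?case
    by (simp add: zero_word_def)
next
  case (Cons a as)
  then obtain u v where "w = u + v" "u \<in> Poly_Mapping.keys a" "v \<in> Poly_Mapping.keys (prod_list as)"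
    using keys_mult[of a "prod_list as"] by auto
  moreover have "length (letters u) \<ge> 1" "set (letters u) \<subseteq> {..<d}"
    using Cons.prems(1) calculation(2) by (auto simp: carrier_free Suc_le_eq)
  ultimately show ?case
    using Cons.IH[of v] Cons.prems(1) by (auto simp: plus_word_def)
qed

lemma nu_coset_eq_zero_iff:
  fixes I :: "(nat word \<Rightarrow>\<^sub>0 'k :: field) set"
  assumes "nu_ideal I (free_alg d)"
  shows "nu_coset (free_alg d) I a = I \<longleftrightarrow> a \<in> I"
proof
  have zero: "0 \<in> I"
    using assms by (auto simp: nu_ideal_def)
  show "a \<in> I" if "nu_coset (free_alg d) I a = I"
    using that zero unfolding nu_coset_def by (metis add.right_neutral free_ops(2) imageI)
  assume a: "a \<in> I"
  have "x \<in> (+) a ` I" if "x \<in> I" for x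
  proof -
    have "Poly_Mapping.single 0 (- 1) * a + x \<in> I"
      using assms a that by (auto simp: nu_ideal_def)
    then have "x - a \<in> I"
      by (simp add: single_uminus)
    then show ?thesis
      by (rule rev_image_eqI) simp
  qed
  moreover have "a + x \<in> I" if "x \<in> I" for x
    using assms a that by (auto simp: nu_ideal_def)
  ultimately show "nu_coset (free_alg d) I a = I"
    by (auto simp: nu_coset_def)
qed

text \<open>
  Shorter products cannot all vanish, as a prefix of the nonzero word would then be zero.
\<close>

lemma nilpotency_degree_eqI:
  fixes C d :: nat
  assumes "C > 1"
    and zero: "\<And>w. length w = C \<Longrightarrow> set w \<subseteq> {..<d} \<Longrightarrow>
      mon w \<in> (cube_ideal d :: (nat word \<Rightarrow>\<^sub>0 'k :: field) set)"
    and v: "length v = C - 1" "set v \<subseteq> {..<d}" "mon v \<notin> (cube_ideal d :: (nat word \<Rightarrow>\<^sub>0 'k) set)"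
  shows "nilpotency_degree (nil_relatively_free 3 d :: ('k, _) nu_algebra) = enat C"
proof -
  let ?F = "free_alg d :: ('k, _) nu_algebra"
  let ?I = "cube_ideal d :: (nat word \<Rightarrow>\<^sub>0 'k) set"
  let ?N = "nil_relatively_free 3 d :: ('k, _) nu_algebra"
  have N: "?N = nu_quotient ?F ?I"
    by (simp add: nil_relatively_free_def cube_ideal_def Let_def)
  note quot = nu_prod_quotient[OF nonunital_algebra_free cube_ideal(1)]
  define nil where "nil m \<longleftrightarrow> (\<forall>as. length as = m \<and> set as \<subseteq> carrier ?N \<longrightarrow> nu_prod ?N as = nu_zero ?N)"
    for m
  have nil_iff: "nil m \<longleftrightarrow> (\<forall>as. length as = m \<and> set as \<subseteq> carrier ?F \<longrightarrow> prod_list as \<in> ?I)"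
    if "m > 0" for m
  proof
    assume m: "nil m"
    show "\<forall>as. length as = m \<and> set as \<subseteq> carrier ?F \<longrightarrow> prod_list as \<in> ?I"
    proof (intro allI impI)
      fix as assume as: "length as = m \<and> set as \<subseteq> carrier ?F"
      then have "as \<noteq> []"
        using that by auto
      have "set (map (nu_coset ?F ?I) as) \<subseteq> carrier ?N"
        using as by (auto simp: N nu_quotient_def)
      then have "nu_prod ?N (map (nu_coset ?F ?I) as) = nu_zero ?N"
        using m as unfolding nil_def by (metis length_map)
      then have "nu_coset ?F ?I (nu_prod ?F as) = ?I"
        using quot[of as] as \<open>as \<noteq> []\<close> by (simp add: N nu_quotient_def)
      then show "prod_list as \<in> ?I"
        by (simp add: nu_coset_eq_zero_iff[OF cube_ideal(1)] nu_prod_free \<open>as \<noteq> []\<close>)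
    qed
  next
    assume m: "\<forall>as. length as = m \<and> set as \<subseteq> carrier ?F \<longrightarrow> prod_list as \<in> ?I"
    show "nil m"
      unfolding nil_def
    proof (intro allI impI)
      fix bs assume bs: "length bs = m \<and> set bs \<subseteq> carrier ?N"
      then have "bs \<in> lists (nu_coset ?F ?I ` carrier ?F)"
        by (auto simp: N nu_quotient_def)
      then obtain as where as: "bs = map (nu_coset ?F ?I) as" "set as \<subseteq> carrier ?F"
        unfolding lists_image by auto
      then have ne: "as \<noteq> []" and "length as = m"
        using bs that by auto
      then have "nu_coset ?F ?I (prod_list as) = ?I"
        using m as nu_coset_eq_zero_iff[OF cube_ideal(1)] by blast
      then show "nu_prod ?N bs = nu_zero ?N"
        using quot[OF ne as(2)] by (simp add: N nu_prod_free ne as(1)) (simp add: nu_quotient_def)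
    qed
  qed
  have mon_ext: "mon (u @ w) \<in> ?I" if "mon u \<in> ?I" "set w \<subseteq> {..<d}" for u w
    using that cube_ideal_mult(2)[of "mon u" d "mon w"] mon_in_free[of w d]
    by (cases "w = []") (auto simp: mon_append)
  have "nil C"
  proof -
    have "prod_list as \<in> ?I" if as: "length as = C" "set as \<subseteq> carrier ?F" for as
    proof (rule cube_ideal_from_mons)
      fix w assume "w \<in> Poly_Mapping.keys (prod_list as)"
      then have w: "length (letters w) \<ge> C" "set (letters w) \<subseteq> {..<d}"
        using keys_prod_list[OF as(2)] as(1) by auto
      have "mon (take C (letters w) @ drop C (letters w)) \<in> ?I"
        using w by (intro mon_ext zero) (auto dest: in_set_takeD in_set_dropD)
      then show "mon (letters w) \<in> ?I"
        by simp
    qed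
    then show ?thesis
      using nil_iff[of C] assms(1) by auto
  qed
  moreover have "C \<le> m" if m: "m > 0" "nil m" for m
  proof (rule ccontr)
    assume "\<not> C \<le> m"
    then have len: "m \<le> length v"
      using v(1) by simp
    have "set (map (\<lambda>x. mon [x]) (take m v)) \<subseteq> carrier ?F"
      using v(2) by (auto simp: mon_in_free dest: in_set_takeD)
    then have "mon (take m v) \<in> ?I"
      using m nil_iff[of m] len by (metis length_map length_take min.absorb2 prod_list_mon)
    then have "mon (take m v @ drop m v) \<in> ?I"
      using v(2) by (intro mon_ext) (auto dest: in_set_dropD)
    then show False
      using v(3) by simp
  qed
  ultimately have "Inf (enat ` {m. 0 < m \<and> nil m}) = enat C"
    using assms(1) by (intro antisym Inf_greatest Inf_lower) auto
  then show ?thesis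
    unfolding nilpotency_degree_def nil_def .
qed

section \<open>Upper bounds\<close>

lemma count_list_split:
  "count_list w x \<ge> Suc n \<Longrightarrow> \<exists>u v. w = u @ x # v \<and> count_list v x \<ge> n"
proof (induction w)
  case (Cons y w)
  show ?case
  proof (cases "y = x")
    case True
    then have "y # w = [] @ x # w \<and> count_list w x \<ge> n"
      using Cons.prems by simp
    then show ?thesis
      by blast
  next
    case False
    then obtain u v where "w = u @ x # v \<and> count_list v x \<ge> n"
      using Cons by auto
    then have "y # w = (y # u) @ x # v \<and> count_list v x \<ge> n"
      by simp
    then show ?thesis
      by blast
  qed
qed simp

lemma mon_with_letter_four_times:
  assumes inf: "infinite (UNIV :: 'k :: field set)"
    and w: "set w \<subseteq> {..<d}" "count_list w x \<ge> 4"
  shows "mon w \<in> (cube_ideal d :: (nat word \<Rightarrow>\<^sub>0 'k) set)"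
proof -
  interpret nil_cube "carrier (free_alg d)"
    "{f. \<forall>w\<in>Poly_Mapping.keys f. set (letters w) \<subseteq> {..<d}}"
    "cube_ideal d :: (nat word \<Rightarrow>\<^sub>0 'k) set"
    by (rule nil_cube_free[OF inf])
  have "count_list w x \<ge> Suc (Suc (Suc (Suc 0)))"
    using w(2) by simp
  then obtain u a b c v where w_eq: "w = u @ x # a @ x # b @ x # c @ x # v"
    by (metis count_list_split)
  define X :: "nat \<Rightarrow> nat word \<Rightarrow>\<^sub>0 'k" where "X = (\<lambda>y. mon [y])"
  have X: "set (map X y) \<subseteq> carrier (free_alg d)" if "set y \<subseteq> {..<d}" for y
    using that by (auto simp: X_def mon_in_free)
  have "prod_list (map X u) * (X x * prod_list (map X a) * X x * prod_list (map X b) * X x *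
      prod_list (map X c) * X x) * prod_list (map X v) \<in> cube_ideal d"
    using w(1) w_eq X X[of "[x]"] by (intro I_sandwich four_times prod_list_A1) simp_all
  then have "prod_list (map X w) \<in> cube_ideal d"
    by (simp add: w_eq mult.assoc)
  then show ?thesis
    by (simp add: X_def prod_list_mon)
qed

lemma mon_length_gt_three_times:
  assumes inf: "infinite (UNIV :: 'k :: field set)"
    and w: "set w \<subseteq> {..<d}" "length w > 3 * d"
  shows "mon w \<in> (cube_ideal d :: (nat word \<Rightarrow>\<^sub>0 'k) set)"
proof -
  have "\<exists>x<d. count_list w x \<ge> 4"
  proof (rule ccontr)
    assume "\<not> ?thesis"
    then have "(\<Sum>x<d. count_list w x) \<le> (\<Sum>x<d. 3)"
      by (intro sum_mono) auto
    then show False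
      using w sum_count_set[of w "{..<d}"] by simp
  qed
  then show ?thesis
    using mon_with_letter_four_times[OF inf w(1)] by blast
qed

lemma mon_length_six:
  assumes inf: "infinite (UNIV :: 'k :: field set)" and 2: "(2 :: 'k) \<noteq> 0" and 3: "(3 :: 'k) \<noteq> 0"
    and w: "set w \<subseteq> {..<d}" "length w = 6"
  shows "mon w \<in> (cube_ideal d :: (nat word \<Rightarrow>\<^sub>0 'k) set)"
proof -
  interpret nil_cube "carrier (free_alg d)"
    "{f. \<forall>w\<in>Poly_Mapping.keys f. set (letters w) \<subseteq> {..<d}}"
    "cube_ideal d :: (nat word \<Rightarrow>\<^sub>0 'k) set"
    by (rule nil_cube_free[OF inf])
  interpret nil_cube_no23 "carrier (free_alg d)"
    "{f. \<forall>w\<in>Poly_Mapping.keys f. set (letters w) \<subseteq> {..<d}}"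
    "cube_ideal d :: (nat word \<Rightarrow>\<^sub>0 'k) set"
    by unfold_locales (use 2 3 triple_in_cube_ideal double_in_cube_ideal in auto)
  obtain a b c e f g where w_eq: "w = [a, b, c, e, f, g]"
    using w(2) by (auto simp: numeral_eq_Suc length_Suc_conv)
  have "mon [a] * mon [b] * mon [c] * mon [e] * mon [f] * mon [g]
      \<in> (cube_ideal d :: (nat word \<Rightarrow>\<^sub>0 'k) set)"
    using w(1) w_eq by (intro six) (simp_all add: mon_in_free)
  then show ?thesis
    unfolding w_eq by (simp add: mon_def mult_single plus_word_def)
qed

text \<open>
  The excess \<open>\<Sum> (count - 1)\<close> over the repeated letters is at least 3, while each repeated letter
  contributes 1 or 2.
\<close>

lemma repeated_letters:
  fixes w :: "nat list"
  assumes w: "set w \<subseteq> {..<d}" "length w \<ge> d + 3" and small: "\<And>x. count_list w x \<le> 3"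
  obtains x y where "x \<noteq> y" "count_list w x \<ge> 3" "count_list w y \<ge> 2"
  | x y z where "x \<noteq> y" "y \<noteq> z" "x \<noteq> z" "count_list w x \<ge> 2" "count_list w y \<ge> 2" "count_list w z \<ge> 2"
proof -
  define S where "S = {x. x < d \<and> count_list w x \<ge> 2}"
  have S: "finite S" "S \<subseteq> {..<d}"
    by (auto simp: S_def)
  have "length w = (\<Sum>x<d. count_list w x)"
    using w(1) sum_count_set[of w "{..<d}"] by simp
  also have "\<dots> \<le> (\<Sum>x<d. 1 + (if x \<in> S then count_list w x - 1 else 0))"
    by (intro sum_mono) (auto simp: S_def)
  also have "\<dots> = d + (\<Sum>x<d. if x \<in> S then count_list w x - 1 else 0)"
    by (simp only: sum.distrib) simp
  also have "(\<Sum>x<d. if x \<in> S then count_list w x - 1 else 0) = (\<Sum>x\<in>S. count_list w x - 1)"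
    using S(2) sum.inter_restrict[of "{..<d}" "\<lambda>x. count_list w x - 1" S]
    by (simp add: Int_absorb1)
  finally have excess: "(\<Sum>x\<in>S. count_list w x - 1) \<ge> 3"
    using w(2) by simp
  show thesis
  proof (cases "card S \<ge> 3")
    case True
    then obtain T where "T \<subseteq> S" "card T = 3"
      by (meson obtain_subset_with_card_n)
    then obtain x y z where "T = {x, y, z}" "x \<noteq> y" "y \<noteq> z" "x \<noteq> z"
      by (metis card_3_iff)
    then show thesis
      using that(2)[of x y z] \<open>T \<subseteq> S\<close> by (auto simp: S_def)
  next
    case False
    then consider "card S = 0" | "card S = 1" | "card S = 2"
      by linarith
    then show thesis
    proof cases
      case 1
      then show thesis
        using excess S by simp
    next
      case 2
      then obtain x where "S = {x}"
        by (meson card_1_singletonE)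
      then show thesis
        using excess small[of x] by simp
    next
      case 3
      then obtain x y where xy: "S = {x, y}" "x \<noteq> y"
        by (meson card_2_iff)
      then have "(count_list w x - 1) + (count_list w y - 1) \<ge> 3"
        using excess by simp
      then have "count_list w x \<ge> 3 \<or> count_list w y \<ge> 3"
        using small[of x] small[of y] by linarith
      moreover have "count_list w x \<ge> 2" "count_list w y \<ge> 2"
        using xy(1) by (auto simp: S_def)
      ultimately show thesis
        using that(1)[of x y] that(1)[of y x] xy(2) by auto
    qed
  qed
qed

lemma mon_length_char2:
  assumes inf: "infinite (UNIV :: 'k :: field set)" and 2: "CHAR('k) = 2"
    and w: "set w \<subseteq> {..<d}" "length w \<ge> d + 3" "length w \<ge> 6"
  shows "mon w \<in> (cube_ideal d :: (nat word \<Rightarrow>\<^sub>0 'k) set)"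
proof (cases "\<exists>x. count_list w x \<ge> 4")
  case True
  then show ?thesis
    using mon_with_letter_four_times[OF inf w(1)] by blast
next
  case False
  interpret nil_cube "carrier (free_alg d)"
    "{f. \<forall>w\<in>Poly_Mapping.keys f. set (letters w) \<subseteq> {..<d}}"
    "cube_ideal d :: (nat word \<Rightarrow>\<^sub>0 'k) set"
    by (rule nil_cube_free[OF inf])
  have two: "(1 + 1 :: 'k) = 0"
    using of_nat_CHAR[where 'a = 'k] 2 by simp
  have dbl: "x + x = 0" for x :: "nat word \<Rightarrow>\<^sub>0 'k"
  proof (rule poly_mapping_eqI)
    fix k
    have "Poly_Mapping.lookup x k + Poly_Mapping.lookup x k = 0"
      using two by (metis distrib_left mult.right_neutral mult_zero_right)
    then show "Poly_Mapping.lookup (x + x) k = Poly_Mapping.lookup 0 k"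
      by (simp add: lookup_add)
  qed
  interpret nil_cube_char2 "carrier (free_alg d)"
    "{f. \<forall>w\<in>Poly_Mapping.keys f. set (letters w) \<subseteq> {..<d}}"
    "cube_ideal d :: (nat word \<Rightarrow>\<^sub>0 'k) set"
    by unfold_locales (simp_all add: dbl)
  define X :: "nat \<Rightarrow> nat word \<Rightarrow>\<^sub>0 'k" where "X = (\<lambda>y. mon [y])"
  have vanish: "mon w \<in> (cube_ideal d :: (nat word \<Rightarrow>\<^sub>0 'k) set)" if "vanishes (image_mset X (mset w))"
  proof -
    have "set (map X w) \<subseteq> carrier (free_alg d)"
      using w(1) by (auto simp: X_def mon_in_free)
    then have "prod_list (map X w) \<in> cube_ideal d"
      using that[unfolded vanishes_def, rule_format, of "map X w"] by simp
    then show ?thesis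
      by (simp add: X_def prod_list_mon)
  qed
  have X: "X x \<in> carrier (free_alg d)" if "count_list w x \<ge> 2" for x
  proof -
    have "x \<in> set w"
      using that by (metis count_list_0_iff not_numeral_le_zero)
    then show ?thesis
      using w(1) by (auto simp: X_def mon_in_free)
  qed
  have small: "count_list w x \<le> 3" for x
  proof -
    have "\<not> count_list w x \<ge> 4"
      using False by blast
    then show ?thesis
      by linarith
  qed
  from w(1,2) small show ?thesis
  proof (cases rule: repeated_letters)
    case (1 x y)
    have "{#x, x, x, y, y#} \<subseteq># mset w"
      using 1 by (intro mset_subset_eqI) (auto simp: count_mset)
    then obtain M where M: "mset w = {#x, x, x, y, y#} + M"
      unfolding subset_mset.le_iff_add by blast
    have "size (mset w) = 5 + size M"
      unfolding M by simp
    then have "M \<noteq> {#}"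
      using w(3) by auto
    have "vanishes ({#X x, X x, X x, X y, X y#} + image_mset X M)"
      using \<open>M \<noteq> {#}\<close> X 1 by (intro vanishes_cube_pair) auto
    then show ?thesis
      by (intro vanish) (simp add: M)
  next
    case (2 x y z)
    have "{#x, x, y, y, z, z#} \<subseteq># mset w"
      using 2 by (intro mset_subset_eqI) (auto simp: count_mset)
    then obtain M where M: "mset w = {#x, x, y, y, z, z#} + M"
      unfolding subset_mset.le_iff_add by blast
    have "vanishes ({#X x, X x, X y, X y, X z, X z#} + image_mset X M)"
      using X 2 by (intro vanishes_three_pairs) auto
    then show ?thesis
      by (intro vanish) (simp add: M)
  qed
qed

section \<open>Linear functionals vanishing on the ideal\<close>

text \<open>
  The cubic form attached to \<open>g\<close> has coefficients \<open>g x x x\<close> and the two kinds of sums in the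
  hypotheses. No division by 2 or 6 takes place, so the statement is available in every
  characteristic.
\<close>

lemma cubic_form_eq_zero:
  fixes c :: "'i \<Rightarrow> 'a :: comm_ring_1" and g :: "'i \<Rightarrow> 'i \<Rightarrow> 'i \<Rightarrow> 'a"
  assumes "finite S"
    and g1: "\<And>x. x \<in> S \<Longrightarrow> g x x x = 0"
    and g2: "\<And>x y. x \<in> S \<Longrightarrow> y \<in> S \<Longrightarrow> g x x y + g x y x + g y x x = 0"
    and g3: "\<And>x y z. x \<in> S \<Longrightarrow> y \<in> S \<Longrightarrow> z \<in> S \<Longrightarrow>
      g x y z + g x z y + g y x z + g y z x + g z x y + g z y x = 0"
  shows "(\<Sum>x\<in>S. \<Sum>y\<in>S. \<Sum>z\<in>S. c x * c y * c z * g x y z) = 0"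
proof -
  have quad: "(\<Sum>x\<in>S. \<Sum>y\<in>S. c x * c y * h x y) = 0"
    if "finite S" "\<And>x. x \<in> S \<Longrightarrow> h x x = 0" "\<And>x y. x \<in> S \<Longrightarrow> y \<in> S \<Longrightarrow> h x y + h y x = 0"
    for S :: "'i set" and h :: "'i \<Rightarrow> 'i \<Rightarrow> 'a"
    using that
  proof (induction S rule: finite_induct)
    case (insert s S)
    have "(\<Sum>y\<in>S. c s * c y * h s y) + (\<Sum>x\<in>S. c x * c s * h x s) = 
        (\<Sum>x\<in>S. c s * c x * (h s x + h x s))"
      by (simp add: sum.distrib algebra_simps)
    also have "\<dots> = 0"
      using insert.prems(2) by (intro sum.neutral) auto
    finally show ?case
      using insert by (simp add: sum.distrib add_ac)
  qed simp
  show ?thesis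
    using assms
  proof (induction S rule: finite_induct)
    case (insert s S)
    let ?d = "\<lambda>x y z. c x * c y * c z * g x y z"
    have 2: "(\<Sum>y\<in>S. \<Sum>z\<in>S. c y * c z * (g s y z + g y s z + g y z s)) = 0"
    proof (rule quad)
      fix x y assume "x \<in> S" "y \<in> S"
      then show "g s x y + g x s y + g x y s + (g s y x + g y s x + g y x s) = 0"
        using insert.prems(3)[of s x y] by (simp add: ac_simps)
    qed (use insert in \<open>auto simp: ac_simps\<close>)
    have 1: "(\<Sum>z\<in>S. c z * (g s s z + g s z s + g z s s)) = 0"
      using insert.prems(2) by (intro sum.neutral) auto
    have "(\<Sum>x\<in>insert s S. \<Sum>y\<in>insert s S. \<Sum>z\<in>insert s S. ?d x y z) =
        ?d s s s + c s * c s * (\<Sum>z\<in>S. c z * (g s s z + g s z s + g z s s))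
        + c s * (\<Sum>y\<in>S. \<Sum>z\<in>S. c y * c z * (g s y z + g y s z + g y z s))
        + (\<Sum>x\<in>S. \<Sum>y\<in>S. \<Sum>z\<in>S. ?d x y z)"
      using insert.hyps
      by (simp add: sum.distrib sum_distrib_left distrib_left mult.assoc mult.left_commute add_ac)
    also have "\<dots> = 0"
      unfolding 1 2 using insert.prems insert.IH by simp
    finally show ?case .
  qed simp
qed

definition pairing :: "(nat list \<Rightarrow> 'k) \<Rightarrow> (nat word \<Rightarrow>\<^sub>0 'k :: field) \<Rightarrow> 'k" where
  "pairing \<phi> f = (\<Sum>w\<in>Poly_Mapping.keys f. Poly_Mapping.lookup f w * \<phi> (letters w))"

lemma pairing_superset:
  "finite S \<Longrightarrow> Poly_Mapping.keys f \<subseteq> S \<Longrightarrow>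
    pairing \<phi> f = (\<Sum>w\<in>S. Poly_Mapping.lookup f w * \<phi> (letters w))"
  unfolding pairing_def by (rule sum.mono_neutral_left) (auto simp: in_keys_iff)

lemma pairing_add: "pairing \<phi> (f + g) = pairing \<phi> f + pairing \<phi> g"
proof -
  let ?S = "Poly_Mapping.keys f \<union> Poly_Mapping.keys g"
  have "pairing \<phi> h = (\<Sum>w\<in>?S. Poly_Mapping.lookup h w * \<phi> (letters w))" if "h \<in> {f, g, f + g}" for h
    using that keys_add[of f g] by (intro pairing_superset) auto
  then show ?thesis
    by (simp add: lookup_add distrib_right sum.distrib)
qed

lemma pairing_zero: "pairing \<phi> 0 = 0"
  by (simp add: pairing_def)

lemma pairing_sum: "pairing \<phi> (sum f S) = (\<Sum>i\<in>S. pairing \<phi> (f i))"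
  by (induction S rule: infinite_finite_induct) (simp_all add: pairing_add pairing_zero)

lemma pairing_single: "pairing \<phi> (Poly_Mapping.single w c) = c * \<phi> (letters w)"
  by (simp add: pairing_def)

lemma pairing_mult:
  "pairing \<phi> (f * g) = (\<Sum>u\<in>Poly_Mapping.keys f. \<Sum>v\<in>Poly_Mapping.keys g.
     Poly_Mapping.lookup f u * Poly_Mapping.lookup g v * \<phi> (letters u @ letters v))"
proof -
  have "f * g = (\<Sum>u\<in>Poly_Mapping.keys f. Poly_Mapping.single u (Poly_Mapping.lookup f u)) *
      (\<Sum>v\<in>Poly_Mapping.keys g. Poly_Mapping.single v (Poly_Mapping.lookup g v))"
    by (simp add: sum_single_keys)
  also have "\<dots> = (\<Sum>u\<in>Poly_Mapping.keys f. \<Sum>v\<in>Poly_Mapping.keys g.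
      Poly_Mapping.single (u + v) (Poly_Mapping.lookup f u * Poly_Mapping.lookup g v))"
    by (simp add: sum_product mult_single)
  finally show ?thesis
    by (simp add: pairing_sum pairing_single plus_word_def)
qed

lemma pairing_mult_left:
  "pairing \<phi> (f * g) = (\<Sum>u\<in>Poly_Mapping.keys f.
     Poly_Mapping.lookup f u * pairing (\<lambda>w. \<phi> (letters u @ w)) g)"
  unfolding pairing_mult unfolding pairing_def by (simp add: sum_distrib_left mult.assoc)

lemma pairing_mult_right:
  "pairing \<phi> (f * g) = (\<Sum>v\<in>Poly_Mapping.keys g.
     Poly_Mapping.lookup g v * pairing (\<lambda>w. \<phi> (w @ letters v)) f)"
  unfolding pairing_mult unfolding pairing_def
  by (subst sum.swap) (simp add: sum_distrib_left mult.left_commute mult.assoc)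

lemma pairing_cube:
  "pairing \<phi> (f * f * f) = (\<Sum>x\<in>Poly_Mapping.keys f. \<Sum>y\<in>Poly_Mapping.keys f. \<Sum>z\<in>Poly_Mapping.keys f.
     Poly_Mapping.lookup f x * Poly_Mapping.lookup f y * Poly_Mapping.lookup f z *
     \<phi> (letters x @ letters y @ letters z))"
  unfolding mult.assoc[of f f f] pairing_mult_left[of \<phi> f "f * f"] pairing_mult[of _ f f]
  by (simp add: sum_distrib_left mult.assoc)

text \<open>
  The elements killed by \<open>\<phi>\<close> together with all its translates form an ideal, which contains the cubes
  by \<open>cubic_form_eq_zero\<close>.
\<close>

lemma not_in_cube_ideal:
  fixes \<phi> :: "nat list \<Rightarrow> 'k :: field"
  assumes \<phi>1: "\<And>u a v. a \<noteq> [] \<Longrightarrow> \<phi> (u @ a @ a @ a @ v) = 0"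
    and \<phi>2: "\<And>u a b v. \<lbrakk>a \<noteq> []; b \<noteq> []\<rbrakk> \<Longrightarrow>
      \<phi> (u @ a @ a @ b @ v) + \<phi> (u @ a @ b @ a @ v) + \<phi> (u @ b @ a @ a @ v) = 0"
    and \<phi>3: "\<And>u a b c v. \<lbrakk>a \<noteq> []; b \<noteq> []; c \<noteq> []\<rbrakk> \<Longrightarrow>
      \<phi> (u @ a @ b @ c @ v) + \<phi> (u @ a @ c @ b @ v) + \<phi> (u @ b @ a @ c @ v)
        + \<phi> (u @ b @ c @ a @ v) + \<phi> (u @ c @ a @ b @ v) + \<phi> (u @ c @ b @ a @ v) = 0"
    and w: "\<phi> w \<noteq> 0"
  shows "mon w \<notin> (cube_ideal d :: (nat word \<Rightarrow>\<^sub>0 'k) set)"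
proof -
  let ?F = "free_alg d :: ('k, _) nu_algebra"
  define J where "J = {f \<in> carrier ?F. \<forall>u v. pairing (\<lambda>w. \<phi> (u @ w @ v)) f = 0}"
  have ideal: "nu_ideal J ?F"
    unfolding nu_ideal_def
  proof (intro conjI ballI allI)
    fix a b assume a: "a \<in> J" and b: "b \<in> carrier ?F"
    have "pairing (\<lambda>w. \<phi> (u @ w @ v)) (a * b) = 0" "pairing (\<lambda>w. \<phi> (u @ w @ v)) (b * a) = 0" for u v
    proof -
      have 0: "pairing (\<lambda>w. \<phi> (p @ w @ q)) a = 0" for p q
        using a by (simp add: J_def)
      show "pairing (\<lambda>w. \<phi> (u @ w @ v)) (a * b) = 0"
        unfolding pairing_mult_right using 0[of u "letters _ @ v"] by simp
      show "pairing (\<lambda>w. \<phi> (u @ w @ v)) (b * a) = 0"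
        unfolding pairing_mult_left using 0[of "u @ letters _" v] by simp
    qed
    then show "nu_mult ?F a b \<in> J" "nu_mult ?F b a \<in> J"
      using a b nonunital_algebra.mult_closed[OF nonunital_algebra_free[where 'b = 'k], of _ "{..<d}"]
      by (auto simp: J_def)
  next
    fix a b assume "a \<in> J" "b \<in> J"
    then show "nu_add ?F a b \<in> J"
      using nonunital_algebra.add_closed[OF nonunital_algebra_free[where 'b = 'k], of a "{..<d}" b]
      by (auto simp: J_def pairing_add)
  next
    fix r a assume "a \<in> J"
    then show "nu_scale ?F r a \<in> J"
      using nonunital_algebra.scale_closed[OF nonunital_algebra_free[where 'b = 'k], of a "{..<d}" r]
      by (auto simp: J_def pairing_mult_left zero_word_def)
  qed (auto simp: J_def pairing_zero carrier_free)
  have "a * a * a \<in> J" if a: "a \<in> carrier ?F" for a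
  proof -
    have ne: "letters x \<noteq> []" if "x \<in> Poly_Mapping.keys a" for x
      using a that by (auto simp: carrier_free)
    have "pairing (\<lambda>w. \<phi> (u @ w @ v)) (a * a * a) = 0" for u v
      unfolding pairing_cube
      using \<phi>1[of _ u v] \<phi>2[of _ _ u v] \<phi>3[of _ _ _ u v] ne
      by (intro cubic_form_eq_zero) simp_all
    then show ?thesis
      using a nonunital_algebra.mult_closed[OF nonunital_algebra_free[where 'b = 'k], of _ "{..<d}"]
      by (auto simp: J_def)
  qed
  then have "cube_ideal d \<subseteq> J"
    unfolding cube_ideal_def nu_genideal_def using ideal by (auto simp: cube_free)
  moreover have "pairing (\<lambda>w. \<phi> ([] @ w @ [])) (mon w) \<noteq> 0"
    using w by (simp add: mon_def pairing_single)
  then have "mon w \<notin> J"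
    unfolding J_def by blast
  ultimately show ?thesis
    by blast
qed

section \<open>A nonzero word of length five\<close>

text \<open>
  Over the integers the three conditions reduce to the last one, since 2 and 6 can be cancelled.
  The values are then reduced to the field.
\<close>

lemma not_in_cube_ideal_int:
  fixes \<phi> :: "nat list \<Rightarrow> int"
  assumes sym: "\<And>u a b c v. \<lbrakk>a \<noteq> []; b \<noteq> []; c \<noteq> []\<rbrakk> \<Longrightarrow>
      \<phi> (u @ a @ b @ c @ v) + \<phi> (u @ a @ c @ b @ v) + \<phi> (u @ b @ a @ c @ v)
        + \<phi> (u @ b @ c @ a @ v) + \<phi> (u @ c @ a @ b @ v) + \<phi> (u @ c @ b @ a @ v) = 0"
    and w: "of_int (\<phi> w) \<noteq> (0 :: 'k :: field)"
  shows "mon w \<notin> (cube_ideal d :: (nat word \<Rightarrow>\<^sub>0 'k) set)"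
proof (rule not_in_cube_ideal)
  show "of_int (\<phi> (u @ a @ a @ a @ v)) = (0 :: 'k)" if "a \<noteq> []" for u a v
    using sym[OF that that that, of u v] by simp
  show "of_int (\<phi> (u @ a @ a @ b @ v)) + of_int (\<phi> (u @ a @ b @ a @ v))
      + of_int (\<phi> (u @ b @ a @ a @ v)) = (0 :: 'k)" if "a \<noteq> []" "b \<noteq> []" for u a b v
  proof -
    have "\<phi> (u @ a @ a @ b @ v) + \<phi> (u @ a @ b @ a @ v) + \<phi> (u @ b @ a @ a @ v) = 0"
      using sym[OF that(1,1,2), of u v] by simp
    then show ?thesis
      by (metis of_int_add of_int_0)
  qed
  show "of_int (\<phi> (u @ a @ b @ c @ v)) + of_int (\<phi> (u @ a @ c @ b @ v))
      + of_int (\<phi> (u @ b @ a @ c @ v)) + of_int (\<phi> (u @ b @ c @ a @ v))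
      + of_int (\<phi> (u @ c @ a @ b @ v)) + of_int (\<phi> (u @ c @ b @ a @ v)) = (0 :: 'k)"
    if "a \<noteq> []" "b \<noteq> []" "c \<noteq> []" for u a b c v
    using sym[OF that, of u v] by (metis of_int_add of_int_0)
qed (rule w)

text \<open>
  For the word \<open>0\<^sup>p 1 0\<^sup>q 1 0\<^sup>r\<close> with \<open>p + q + r = 3\<close> this is the sign of \<open>(p, q, r)\<close> as a permutation of
  \<open>(2, 1, 0)\<close>, and 0 if two of the gaps are equal.
\<close>

definition gap_sign :: "nat list \<Rightarrow> int" where
  "gap_sign w =
    (if w \<in> {[0,0,1,0,1], [0,1,1,0,0], [1,0,0,1,0]} then 1
     else if rev w \<in> {[0,0,1,0,1], [0,1,1,0,0], [1,0,0,1,0]} then - 1 else 0)"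

definition symsum :: "(nat list \<Rightarrow> int) \<Rightarrow> nat list \<Rightarrow> nat list \<Rightarrow> nat list \<Rightarrow> nat list \<Rightarrow> nat list \<Rightarrow> int" where
  "symsum \<phi> u a b c v = \<phi> (u @ a @ b @ c @ v) + \<phi> (u @ a @ c @ b @ v) + \<phi> (u @ b @ a @ c @ v)
        + \<phi> (u @ b @ c @ a @ v) + \<phi> (u @ c @ a @ b @ v) + \<phi> (u @ c @ b @ a @ v)"

text \<open>
  Only words with three zeros and two ones matter, and they have finitely many factorizations, so
  evaluation decides the question.
\<close>

lemma symsum_gap_sign_cuts:
  "\<forall>w\<in>set (filter (\<lambda>w. sum_list w = 2) (List.n_lists 5 [0, 1])).
     \<forall>i\<in>set [0..<3]. \<forall>j\<in>set [Suc i..<4]. \<forall>k\<in>set [Suc j..<5]. \<forall>l\<in>set [Suc k..<6].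
     symsum gap_sign (take i w) (drop i (take j w)) (drop j (take k w)) (drop k (take l w))
       (drop l w) = 0"
  by code_simp

lemma symsum_gap_sign:
  assumes "a \<noteq> []" "b \<noteq> []" "c \<noteq> []"
  shows "symsum gap_sign u a b c v = 0"
proof (cases "length (u @ a @ b @ c @ v) = 5 \<and> set (u @ a @ b @ c @ v) \<subseteq> {0, 1} \<and>
    sum_list (u @ a @ b @ c @ v) = 2")
  case True
  let ?w = "u @ a @ b @ c @ v"
  have w: "?w \<in> set (filter (\<lambda>w. sum_list w = 2) (List.n_lists 5 [0, 1]))"
    using True by (simp add: set_n_lists)
  define i j k l where "i = length u" and "j = i + length a" and "k = j + length b"
    and "l = k + length c"
  have "length a > 0" "length b > 0" "length c > 0"
    "length u + length a + length b + length c + length v = 5"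
    using assms True by auto
  then have "i \<in> set [0..<3]" "j \<in> set [Suc i..<4]" "k \<in> set [Suc j..<5]" "l \<in> set [Suc k..<6]"
    unfolding set_upt atLeastLessThan_iff i_def j_def k_def l_def by linarith+
  then have "symsum gap_sign (take i ?w) (drop i (take j ?w)) (drop j (take k ?w))
      (drop k (take l ?w)) (drop l ?w) = 0"
    using symsum_gap_sign_cuts w by blast
  moreover have "take i ?w = u" "drop i (take j ?w) = a" "drop j (take k ?w) = b"
    "drop k (take l ?w) = c" "drop l ?w = v"
    by (simp_all add: i_def j_def k_def l_def)
  ultimately show ?thesis
    by simp
next
  case False
  have supp: "length w = 5 \<and> set w \<subseteq> {0, 1} \<and> sum_list w = 2" if "gap_sign w \<noteq> 0" for w
  proof -
    have "w \<in> {[0,0,1,0,1], [0,1,1,0,0], [1,0,0,1,0]} \<or>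
        rev w \<in> {[0,0,1,0,1], [0,1,1,0,0], [1,0,0,1,0]}"
      using that by (auto simp: gap_sign_def split: if_splits)
    then have "w \<in> {[0,0,1,0,1], [0,1,1,0,0], [1,0,0,1,0], [1,0,1,0,0], [0,0,1,1,0], [0,1,0,0,1]}"
      by (auto simp: rev_swap)
    then show ?thesis
      by auto
  qed
  have "gap_sign x = 0" if "mset x = mset (u @ a @ b @ c @ v)" for x
  proof -
    have "length x = length (u @ a @ b @ c @ v)" "set x = set (u @ a @ b @ c @ v)"
      "sum_list x = sum_list (u @ a @ b @ c @ v)"
      using that by (metis size_mset, metis set_mset_mset, metis sum_mset_sum_list)
    then show ?thesis
      using supp[of x] False by metis
  qed
  then show ?thesis
    by (simp add: symsum_def ac_simps)
qed

lemma mon_length_five: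
  "mon [0, 0, 1, 0, 1] \<notin> (cube_ideal d :: (nat word \<Rightarrow>\<^sub>0 'k :: field) set)"
  by (rule not_in_cube_ideal_int[where \<phi> = gap_sign, OF symsum_gap_sign[unfolded symsum_def]])
    (simp_all add: gap_sign_def)

section \<open>A nonzero word in characteristic two\<close>

fun zero_pairs :: "nat list \<Rightarrow> nat" where
  "zero_pairs (x # y # w) = (if x = 0 \<and> y = 0 then 1 else 0) + zero_pairs (y # w)"
| "zero_pairs w = 0"

definition starts0 :: "nat list \<Rightarrow> nat" where
  "starts0 w = of_bool (w \<noteq> [] \<and> hd w = 0)"

definition ends0 :: "nat list \<Rightarrow> nat" where
  "ends0 w = of_bool (w \<noteq> [] \<and> last w = 0)"

lemma zero_pairs_append: "zero_pairs (u @ v) = zero_pairs u + zero_pairs v + ends0 u * starts0 v"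
proof (induction u rule: zero_pairs.induct)
  case ("2_2" x)
  then show ?case
    by (cases v) (auto simp: ends0_def starts0_def)
qed (auto simp: ends0_def)

lemma starts0_append: "u \<noteq> [] \<Longrightarrow> starts0 (u @ v) = starts0 u"
  by (simp add: starts0_def)

lemma zero_pairs_few: "count_list w 0 \<le> 1 \<Longrightarrow> zero_pairs w = 0"
  by (induction w rule: zero_pairs.induct) (auto split: if_splits)

text \<open>
  In the sum over all orders of three factors each adjacency between two factors occurs twice, hence
  is even. When a factor \<open>a\<close> occurs twice it must be the letter 0, and then the count for \<open>uaabv\<close>,
  \<open>uabav\<close>, \<open>ubaav\<close> is even up to the adjacencies in \<open>ubv\<close>, which contains a single zero.
\<close>

lemma mon_adjacent_zeros:
  assumes 2: "CHAR('k :: field) = 2" and d: "d \<ge> 2"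
  shows "mon ([0, 0, 1, 0] @ [2..<d]) \<notin> (cube_ideal d :: (nat word \<Rightarrow>\<^sub>0 'k) set)"
proof -
  define C where "C = {#0, 0, 0#} + mset [1..<d]"
  define \<phi> :: "nat list \<Rightarrow> 'k" where "\<phi> w = (if mset w = C then of_nat (zero_pairs w) else 0)" for w
  have even: "of_nat n = (0 :: 'k)" if "even n" for n
    using that 2 by (simp add: of_nat_eq_0_iff_char_dvd)
  have count0: "count C 0 = 3"
    by (simp add: C_def)
  have count1: "count C x \<le> 1" if "x \<noteq> 0" for x
    using that by (simp add: C_def count_mset_set')
  have zero: "a = [0]" if "mset w = C" "mset a + mset a \<subseteq># mset w" "a \<noteq> []" for a w
  proof -
    have cnt: "count_list a x + count_list a x \<le> count C x" for x
      using mset_subset_eq_count[OF that(2), of x] that(1) by (simp add: count_mset)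
    have "x = 0" if "x \<in> set a" for x
    proof (rule ccontr)
      assume "x \<noteq> 0"
      then have "count_list a x = 0"
        using cnt[of x] count1[of x] by linarith
      then show False
        using that by (simp add: count_list_0_iff)
    qed
    then have "a = replicate (length a) 0"
      by (metis replicate_length_same)
    moreover have "count_list (replicate n (0 :: nat)) 0 = n" for n
      by (induction n) auto
    ultimately have "count_list a 0 = length a"
      by metis
    then have "length a \<le> 1"
      using cnt[of 0] count0 by linarith
    moreover have "length a \<noteq> 0"
      using \<open>a \<noteq> []\<close> by simp
    ultimately have "length a = 1"
      by linarith
    then show ?thesis
      using \<open>a = replicate (length a) 0\<close> by simp
  qed
  show ?thesis
  proof (rule not_in_cube_ideal[where \<phi> = \<phi>])
    fix u a v :: "nat list" assume a: "a \<noteq> []"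
    show "\<phi> (u @ a @ a @ a @ v) = 0"
    proof (cases "mset (u @ a @ a @ a @ v) = C")
      case True
      then have a0: "a = [0]"
        by (rule zero) (simp_all add: a)
      have "count_list u 0 = 0" "count_list v 0 = 0"
        using arg_cong[OF True, of "\<lambda>M. count M 0"] count0 a0 by (simp_all add: count_mset)
      then have "zero_pairs u = 0" "zero_pairs v = 0" "ends0 u = 0" "starts0 v = 0"
        using zero_pairs_few[of u] zero_pairs_few[of v]
        by (auto simp: count_list_0_iff ends0_def starts0_def) (metis last_in_set hd_in_set)+
      then have "zero_pairs (u @ a @ a @ a @ v) = 2"
        by (simp add: zero_pairs_append[of u] zero_pairs_append[of "[0, 0, 0]" v, simplified] a0)
      then show ?thesis
        using even[of 2] by (simp add: \<phi>_def)
    qed (simp add: \<phi>_def)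
  next
    fix u a b v :: "nat list" assume a: "a \<noteq> []" and b: "b \<noteq> []"
    show "\<phi> (u @ a @ a @ b @ v) + \<phi> (u @ a @ b @ a @ v) + \<phi> (u @ b @ a @ a @ v) = 0"
    proof (cases "mset (u @ a @ a @ b @ v) = C")
      case True
      then have a0: "a = [0]"
        by (rule zero) (simp_all add: a)
      have "count_list (u @ b @ v) 0 = 1"
        using arg_cong[OF True, of "\<lambda>M. count M 0"] count0 a0 by (simp add: count_mset)
      then have "zero_pairs (u @ b @ v) = 0"
        by (intro zero_pairs_few) simp
      then have "zero_pairs u = 0" "zero_pairs b = 0" "zero_pairs v = 0"
        "ends0 u * starts0 b = 0" "ends0 b * starts0 v = 0"
        by (simp_all add: zero_pairs_append starts0_append b)
      then have "zero_pairs (u @ a @ a @ b @ v) + zero_pairs (u @ a @ b @ a @ v)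
          + zero_pairs (u @ b @ a @ a @ v) = 2 * (1 + ends0 u + ends0 b + starts0 b + starts0 v)"
        by (simp add: zero_pairs_append starts0_append b a a0[unfolded a0])
          (simp add: a0 starts0_def ends0_def)
      then have "of_nat (zero_pairs (u @ a @ a @ b @ v)) + of_nat (zero_pairs (u @ a @ b @ a @ v))
          + of_nat (zero_pairs (u @ b @ a @ a @ v)) = (0 :: 'k)"
        by (metis even dvd_triv_left of_nat_add)
      moreover have "mset (u @ a @ b @ a @ v) = C" "mset (u @ b @ a @ a @ v) = C"
        using True by (simp_all add: ac_simps)
      ultimately show ?thesis
        using True by (simp add: \<phi>_def)
    next
      case False
      then have "mset (u @ a @ b @ a @ v) \<noteq> C" "mset (u @ b @ a @ a @ v) \<noteq> C"
        by (simp_all add: ac_simps)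
      then show ?thesis
        using False by (simp add: \<phi>_def)
    qed
  next
    fix u a b c v :: "nat list" assume abc: "a \<noteq> []" "b \<noteq> []" "c \<noteq> []"
    let ?s = "\<lambda>f. f (u @ a @ b @ c @ v) + f (u @ a @ c @ b @ v) + f (u @ b @ a @ c @ v)
        + f (u @ b @ c @ a @ v) + f (u @ c @ a @ b @ v) + f (u @ c @ b @ a @ v)"
    have "?s zero_pairs = 2 * (3 * (zero_pairs u + zero_pairs a + zero_pairs b + zero_pairs c
          + zero_pairs v) + ends0 u * (starts0 a + starts0 b + starts0 c)
        + ends0 a * (starts0 b + starts0 c + starts0 v) + ends0 b * (starts0 a + starts0 c + starts0 v)
        + ends0 c * (starts0 a + starts0 b + starts0 v))"
      using abc by (simp add: zero_pairs_append starts0_append algebra_simps)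
    then have "even (?s zero_pairs)"
      by simp
    then have "of_nat (?s zero_pairs) = (0 :: 'k)"
      by (rule even)
    then have s: "?s (\<lambda>w. of_nat (zero_pairs w)) = (0 :: 'k)"
      by (simp only: of_nat_add)
    have "mset (u @ a @ c @ b @ v) = mset (u @ a @ b @ c @ v)"
      "mset (u @ b @ a @ c @ v) = mset (u @ a @ b @ c @ v)"
      "mset (u @ b @ c @ a @ v) = mset (u @ a @ b @ c @ v)"
      "mset (u @ c @ a @ b @ v) = mset (u @ a @ b @ c @ v)"
      "mset (u @ c @ b @ a @ v) = mset (u @ a @ b @ c @ v)"
      by (simp_all add: ac_simps)
    then show "?s \<phi> = 0"
      using s unfolding \<phi>_def by (simp only: if_cancel split: if_split) simp
  next
    have "[1..<d] = 1 # [2..<d]"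
      using d by (simp add: upt_conv_Cons numeral_2_eq_2)
    then have "mset ([0, 0, 1, 0] @ [2..<d]) = C"
      by (simp add: C_def)
    moreover have "zero_pairs [2..<d] = 0"
      by (rule zero_pairs_few) (simp add: count_list_0_iff)
    moreover have "starts0 [2..<d] = 0"
      by (cases "2 < d") (simp_all add: starts0_def)
    ultimately show "\<phi> ([0, 0, 1, 0] @ [2..<d]) \<noteq> 0"
      unfolding \<phi>_def zero_pairs_append by simp
  qed
qed

section \<open>Path integrals with Grassmann coefficients\<close>

definition order_sign :: "nat \<Rightarrow> nat \<Rightarrow> int" where
  "order_sign i j = (if i < j then 1 else if j < i then - 1 else 0)"

locale grassmann3 =
  fixes \<xi> :: "nat \<Rightarrow> 'r :: ring_1"
  assumes anti: "\<xi> i * \<xi> j = - (\<xi> j * \<xi> i)"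
    and sq: "\<xi> i * \<xi> i = 0"
    and char3: "r + r + r = (0 :: 'r)"
begin

lemma three_mult: "3 * r = (0 :: 'r)"
proof -
  have "(1 + 1 + 1) * r = 0"
    using char3[of r] by (simp only: distrib_right mult_1_left)
  then show ?thesis
    by simp
qed

definition vec :: "nat list \<Rightarrow> 'r" where
  "vec u = sum_list (map \<xi> u)"

lemma vec_simps [simp]: "vec [] = 0" "vec (i # u) = \<xi> i + vec u" "vec (u @ v) = vec u + vec v"
  by (simp_all add: vec_def)

lemma vec_anti: "vec u * vec v = - (vec v * vec u)"
proof -
  have 1: "\<xi> i * vec v = - (vec v * \<xi> i)" for i v
    by (induction v) (simp_all add: distrib_left distrib_right anti[of i])
  show ?thesis
    by (induction u) (simp_all add: distrib_left distrib_right 1)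
qed

lemma vec_sq: "vec u * vec u = 0"
proof -
  have "vec u * vec u + vec u * vec u = 0"
    using vec_anti[of u u] by (simp add: eq_neg_iff_add_eq_0)
  then show ?thesis
    using char3[of "vec u * vec u"] by simp
qed

lemma vec_mid:
  "vec p * vec u * (vec p * vec v) = 0" "vec u * vec p * (vec v * vec p) = 0"
proof -
  have "vec p * vec u * (vec p * vec v) = vec p * (vec u * vec p) * vec v"
    by (simp add: mult.assoc)
  also have "\<dots> = 0"
    unfolding vec_anti[of u p] by (simp add: vec_sq flip: mult.assoc)
  finally show "vec p * vec u * (vec p * vec v) = 0" .
  have "vec u * vec p * (vec v * vec p) = vec u * (vec p * vec v) * vec p"
    by (simp add: mult.assoc)
  also have "\<dots> = 0"
    unfolding vec_anti[of p v] by (simp add: vec_sq mult.assoc)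
  finally show "vec u * vec p * (vec v * vec p) = 0" .
qed

text \<open>
  Central with respect to the generators; the name refers to the even part of a Grassmann algebra.
\<close>

definition even_elem :: "'r \<Rightarrow> bool" where
  "even_elem z \<longleftrightarrow> (\<forall>i. z * \<xi> i = \<xi> i * z)"

lemma even_one: "even_elem 1"
  and even_zero: "even_elem 0"
  and even_add: "even_elem z \<Longrightarrow> even_elem w \<Longrightarrow> even_elem (z + w)"
  by (auto simp: even_elem_def distrib_left distrib_right)

lemma even_mult: "even_elem z \<Longrightarrow> even_elem w \<Longrightarrow> even_elem (z * w)"
  unfolding even_elem_def by (metis mult.assoc)

lemma even_vec: "even_elem z \<Longrightarrow> z * vec u = vec u * z"
  by (induction u) (simp_all add: even_elem_def distrib_left distrib_right)

lemma even_vec_vec: "even_elem (vec u * vec v)"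
proof -
  have "vec u * vec v * vec [i] = vec [i] * (vec u * vec v)" for i
  proof -
    have "vec u * vec v * vec [i] = - (vec u * vec [i] * vec v)"
      unfolding mult.assoc vec_anti[of v "[i]"] by simp
    also have "\<dots> = vec [i] * (vec u * vec v)"
      unfolding vec_anti[of u "[i]"] by (simp add: mult.assoc)
    finally show ?thesis .
  qed
  then show ?thesis
    by (simp add: even_elem_def)
qed

lemma even_commute_vec_vec: "even_elem z \<Longrightarrow> z * (vec u * vec v) = vec u * vec v * z"
  by (metis even_vec mult.assoc)

text \<open>
  The coefficients of the quadratic 3-form behind the height. In characteristic 3 they are forced, up
  to adding the differential of a cubic, by the three properties \<open>theta_swap\<close>, \<open>theta_anti\<close> and
  \<open>theta_cyclic\<close>: for \<open>i < j\<close> the coefficient is the negative of the position (low, middle,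
  high) of \<open>k\<close>, counted as \<open>- 1, 0, 1\<close>.
\<close>

definition theta :: "nat \<Rightarrow> nat \<Rightarrow> nat \<Rightarrow> 'r" where
  "theta i j k =
    of_int ((order_sign i k + order_sign j k) * order_sign i j) * (\<xi> i * \<xi> j * \<xi> k)"

lemma xi_repeat: "\<xi> i * (\<xi> i * r) = 0" "\<xi> i * (\<xi> j * \<xi> i) = 0"
proof -
  show 1: "\<xi> i * (\<xi> i * r) = 0" for r
    using sq[of i] by (simp flip: mult.assoc)
  show "\<xi> i * (\<xi> j * \<xi> i) = 0"
    using anti[of j i] 1 by simp
qed

lemma theta_swap: "theta i j k = theta j i k"
  by (auto simp: theta_def order_sign_def anti[of i j] mult.assoc)

lemma xi_perm:
  "\<xi> i * \<xi> k * \<xi> j = - (\<xi> i * \<xi> j * \<xi> k)"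
  "\<xi> j * \<xi> k * \<xi> i = \<xi> i * \<xi> j * \<xi> k"
  "\<xi> k * \<xi> i * \<xi> j = \<xi> i * \<xi> j * \<xi> k"
proof -
  show 1: "\<xi> i * \<xi> k * \<xi> j = - (\<xi> i * \<xi> j * \<xi> k)" for i j k
    using anti[of k j] by (simp add: mult.assoc)
  have 2: "\<xi> j * \<xi> i * \<xi> k = - (\<xi> i * \<xi> j * \<xi> k)" for i j k
    using anti[of j i] by simp
  show "\<xi> j * \<xi> k * \<xi> i = \<xi> i * \<xi> j * \<xi> k"
    by (simp only: 1[of j k i] 2[of j i k] minus_minus)
  show "\<xi> k * \<xi> i * \<xi> j = \<xi> i * \<xi> j * \<xi> k"
    by (simp only: 2[of k i j] 1[of i k j] minus_minus)
qed

lemma theta_anti: "theta i j k - theta i k j = - (\<xi> i * \<xi> j * \<xi> k)"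
proof -
  define c where "c = \<xi> i * \<xi> j * \<xi> k"
  define g g' where "g = (order_sign i k + order_sign j k) * order_sign i j"
    and "g' = (order_sign i j + order_sign k j) * order_sign i k"
  have "theta i j k = of_int g * c" "theta i k j = - (of_int g' * c)"
    unfolding theta_def xi_perm(1)[of i k j] c_def g_def g'_def by simp_all
  then have "theta i j k - theta i k j + c = of_int (g + g' + 1) * c"
    by (simp add: distrib_right)
  also have "\<dots> = 0"
  proof (cases "i = j \<or> j = k \<or> i = k")
    case True
    then have "c = 0"
      by (auto simp: c_def mult.assoc sq xi_repeat)
    then show ?thesis
      by simp
  next
    case False
    then consider "i < j \<and> j < k" | "i < k \<and> k < j" | "j < i \<and> i < k" | "j < k \<and> k < i"
      | "k < i \<and> i < j" | "k < j \<and> j < i"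
      by linarith
    then show ?thesis
      using three_mult[of c] unfolding g_def g'_def
      by cases (simp_all add: order_sign_def algebra_simps)
  qed
  finally show ?thesis
    by (simp add: c_def eq_neg_iff_add_eq_0)
qed

lemma theta_cyclic: "theta i j k + theta j k i + theta k i j = 0"
proof (cases "i = j \<or> j = k \<or> i = k")
  case True
  then show ?thesis
    by (auto simp: theta_def mult.assoc sq xi_repeat)
next
  case False
  then consider "i < j \<and> j < k" | "i < k \<and> k < j" | "j < i \<and> i < k" | "j < k \<and> k < i"
    | "k < i \<and> i < j" | "k < j \<and> j < i"
    by linarith
  then show ?thesis
    unfolding theta_def xi_perm(2)[of j k i] xi_perm(3)[of k i j]
    by cases (simp_all add: order_sign_def algebra_simps)
qed

definition tri :: "nat list \<Rightarrow> nat list \<Rightarrow> nat list \<Rightarrow> 'r" where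
  "tri u v w = (\<Sum>i\<leftarrow>u. \<Sum>j\<leftarrow>v. \<Sum>k\<leftarrow>w. theta i j k)"

lemma tri_Nil [simp]: "tri [] v w = 0" "tri u [] w = 0" "tri u v [] = 0"
  by (simp_all add: tri_def)

lemma tri_append:
  "tri (u @ u') v w = tri u v w + tri u' v w"
  "tri u (v @ v') w = tri u v w + tri u v' w"
  "tri u v (w @ w') = tri u v w + tri u v w'"
  by (simp_all add: tri_def sum_list_addf)

lemma tri_Cons:
  "tri (i # u) v w = tri [i] v w + tri u v w"
  "tri u (i # v) w = tri u [i] w + tri u v w"
  "tri u v (i # w) = tri u v [i] + tri u v w"
  using tri_append(1)[of "[i]" u] tri_append(2)[of u "[i]" v] tri_append(3)[of u v "[i]" w] by simp_all

lemma tri_single: "tri [i] [j] [k] = theta i j k"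
  by (simp add: tri_def)

text \<open>
  Trilinear functions on words are determined by their values on letters.
\<close>

lemma trilinear_zero:
  fixes f :: "nat list \<Rightarrow> nat list \<Rightarrow> nat list \<Rightarrow> 'r"
  assumes nil: "\<And>v w. f [] v w = 0" "\<And>u w. f u [] w = 0" "\<And>u v. f u v [] = 0"
    and cons: "\<And>i u v w. f (i # u) v w = f [i] v w + f u v w"
      "\<And>i u v w. f u (i # v) w = f u [i] w + f u v w"
      "\<And>i u v w. f u v (i # w) = f u v [i] + f u v w"
    and single: "\<And>i j k. f [i] [j] [k] = 0"
  shows "f u v w = 0"
proof -
  have 1: "f [i] [j] w = 0" for i j w
    by (induction w) (simp add: nil, metis cons(3) single add_0)
  have 2: "f [i] v w = 0" for i v w
    by (induction v) (simp add: nil, metis cons(2) 1 add_0)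
  show ?thesis
    by (induction u) (simp add: nil, metis cons(1) 2 add_0)
qed

lemma tri_swap: "tri u v w = tri v u w"
proof -
  have "tri u v w - tri v u w = 0"
  proof (rule trilinear_zero[where f = "\<lambda>u v w. tri u v w - tri v u w"])
    fix i u v w
    show "tri (i # u) v w - tri v (i # u) w = tri [i] v w - tri v [i] w + (tri u v w - tri v u w)"
      by (simp add: tri_Cons(1)[of i u] tri_Cons(2)[of _ i u])
    show "tri u (i # v) w - tri (i # v) u w = tri u [i] w - tri [i] u w + (tri u v w - tri v u w)"
      by (simp add: tri_Cons(1)[of i v] tri_Cons(2)[of _ i v])
    show "tri u v (i # w) - tri v u (i # w) = tri u v [i] - tri v u [i] + (tri u v w - tri v u w)"
      by (simp add: tri_Cons(3)[of _ _ i w])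
  qed (simp_all add: tri_single theta_swap)
  then show ?thesis
    by simp
qed

lemma tri_anti: "tri u v w - tri u w v = - (vec u * vec v * vec w)"
proof -
  let ?f = "\<lambda>u v w. tri u v w - tri u w v + vec u * vec v * vec w"
  have "?f u v w = 0"
  proof (rule trilinear_zero[where f = ?f])
    fix i u v w
    show "?f (i # u) v w = ?f [i] v w + ?f u v w"
      by (simp add: tri_Cons(1)[of i u] distrib_right)
    show "?f u (i # v) w = ?f u [i] w + ?f u v w"
      by (simp add: tri_Cons(3)[of _ _ i v] tri_Cons(2)[of _ i v] distrib_left distrib_right)
    show "?f u v (i # w) = ?f u v [i] + ?f u v w"
      by (simp add: tri_Cons(3)[of _ _ i w] tri_Cons(2)[of _ i w] distrib_left)
  qed (simp_all add: tri_single theta_anti)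
  then show ?thesis
    by (simp add: eq_neg_iff_add_eq_0)
qed

lemma tri_cyclic: "tri u v w + tri v w u + tri w u v = 0"
proof (rule trilinear_zero[where f = "\<lambda>u v w. tri u v w + tri v w u + tri w u v"])
  fix i u v w
  show "tri (i # u) v w + tri v w (i # u) + tri w (i # u) v =
      tri [i] v w + tri v w [i] + tri w [i] v + (tri u v w + tri v w u + tri w u v)"
    by (simp add: tri_Cons(1)[of i u] tri_Cons(3)[of _ _ i u] tri_Cons(2)[of _ i u])
  show "tri u (i # v) w + tri (i # v) w u + tri w u (i # v) =
      tri u [i] w + tri [i] w u + tri w u [i] + (tri u v w + tri v w u + tri w u v)"
    by (simp add: tri_Cons(1)[of i v] tri_Cons(3)[of _ _ i v] tri_Cons(2)[of _ i v])
  show "tri u v (i # w) + tri v (i # w) u + tri (i # w) u v =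
      tri u v [i] + tri v [i] u + tri [i] u v + (tri u v w + tri v w u + tri w u v)"
    by (simp add: tri_Cons(1)[of i w] tri_Cons(3)[of _ _ i w] tri_Cons(2)[of _ i w])
qed (simp_all add: tri_single theta_cyclic)

text \<open>
  The cyclic identity alone gives only \<open>3 tri u u u = 0\<close>; the actual vanishing comes from splitting
  off one letter at a time.
\<close>

lemma tri_diag: "tri u u u = 0"
proof (induction u)
  case (Cons i u)
  have "tri [i] [i] [i] = 0"
    by (simp add: tri_single theta_def order_sign_def)
  moreover have "tri (i # u) (i # u) (i # u) =
      tri [i] [i] [i] + (tri [i] [i] u + tri [i] u [i] + tri u [i] [i])
      + (tri [i] u u + tri u u [i] + tri u [i] u) + tri u u u"
    by (simp add: tri_Cons(1)[of i u] tri_Cons(3)[of _ _ i u] tri_Cons(2)[of _ i u] algebra_simps)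
  ultimately show ?case
    using Cons tri_cyclic[of "[i]" "[i]" u] tri_cyclic[of "[i]" u u] by (simp add: algebra_simps)
qed simp

text \<open>
  The path described by \<open>w\<close> starts at the letter counts of \<open>p\<close>. \<open>transport\<close> is its product integral and
  \<open>height\<close> its line integral; \<open>area\<close> and \<open>drift\<close> are the corrections that appear when the starting
  point is changed.
\<close>

primrec transport :: "nat list \<Rightarrow> nat list \<Rightarrow> 'r" where
  "transport p [] = 1"
| "transport p (i # w) = (1 + vec p * \<xi> i) * transport (p @ [i]) w"

primrec height :: "nat list \<Rightarrow> nat list \<Rightarrow> 'r" where
  "height p [] = 0"
| "height p (i # w) = tri p p [i] + height (p @ [i]) w"

primrec area :: "nat list \<Rightarrow> nat list \<Rightarrow> 'r" where
  "area p [] = 0"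
| "area p (i # w) = vec p * \<xi> i + area (p @ [i]) w"

primrec drift :: "nat list \<Rightarrow> nat list \<Rightarrow> nat list \<Rightarrow> 'r" where
  "drift p n [] = 0"
| "drift p n (i # w) = tri p n [i] + drift p (n @ [i]) w"

lemma transport_append: "transport p (u @ v) = transport p u * transport (p @ u) v"
  by (induction u arbitrary: p) (simp_all add: mult.assoc)

lemma height_append: "height p (u @ v) = height p u + height (p @ u) v"
  by (induction u arbitrary: p) (simp_all add: add.assoc)

lemma area_append: "area p (u @ v) = area p u + area (p @ u) v"
  by (induction u arbitrary: p) (simp_all add: add.assoc)

lemma drift_append: "drift p n (u @ v) = drift p n u + drift p (n @ u) v"
  by (induction u arbitrary: n) (simp_all add: add.assoc)

lemma even_vec_xi: "even_elem (vec u * \<xi> i)"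
  using even_vec_vec[of u "[i]"] by simp

lemma even_transport: "even_elem (transport p w)"
  by (induction w arbitrary: p) (simp_all add: even_one even_add even_mult even_vec_xi)

lemma even_area: "even_elem (area p w)"
  by (induction w arbitrary: p) (simp_all add: even_zero even_add even_vec_xi)

lemma transport_shift: "transport (p @ n) w = transport n w * (1 + vec p * vec w)"
proof (induction w arbitrary: n)
  case (Cons i w)
  let ?x = "vec [i]" and ?T = "transport (n @ [i]) w"
  have "transport (p @ n) (i # w) =
      (1 + vec n * ?x + vec p * ?x) * (?T * (1 + vec p * vec w))"
    using Cons[of "n @ [i]"] by (simp add: distrib_right add_ac)
  also have "1 + vec n * ?x + vec p * ?x = (1 + vec n * ?x) * (1 + vec p * ?x)"
    using vec_mid(2)[of n "[i]" p] by (simp only: distrib_left distrib_right mult_1_left mult_1_right)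
      (simp add: add_ac)
  also have "(1 + vec n * ?x) * (1 + vec p * ?x) * (?T * (1 + vec p * vec w)) =
      (1 + vec n * ?x) * (((1 + vec p * ?x) * ?T) * (1 + vec p * vec w))"
    by (simp only: mult.assoc)
  also have "(1 + vec p * ?x) * ?T = ?T * (1 + vec p * ?x)"
    using even_commute_vec_vec[OF even_transport, of "n @ [i]" w p "[i]"]
    by (simp only: distrib_left distrib_right mult_1_left mult_1_right)
  also have "(1 + vec n * ?x) * (?T * (1 + vec p * ?x) * (1 + vec p * vec w)) =
      (1 + vec n * ?x) * ?T * ((1 + vec p * ?x) * (1 + vec p * vec w))"
    by (simp only: mult.assoc)
  also have "(1 + vec p * ?x) * (1 + vec p * vec w) = 1 + vec p * vec (i # w)"
    using vec_mid(1)[of p "[i]" w] by (simp add: distrib_left distrib_right add_ac)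
  finally show ?case
    by simp
qed simp

lemma height_shift: "height (p @ n) w = height n w + (drift p n w + drift p n w) + tri p p w"
proof (induction w arbitrary: n)
  case (Cons i w)
  have "tri (p @ n) (p @ n) [i] = tri n n [i] + (tri p n [i] + tri p n [i]) + tri p p [i]"
    by (simp add: tri_append tri_swap[of n p] algebra_simps)
  then show ?case
    using Cons[of "n @ [i]"] by (simp add: tri_Cons(3)[of _ _ i w] algebra_simps)
qed simp

lemma tri_same: "tri p [i] [i] = 0"
proof (induction p)
  case (Cons j p)
  have "theta j i i = 0"
    by (simp add: theta_def mult.assoc sq)
  then show ?case
    using Cons by (simp add: tri_Cons(1)[of j p] tri_single)
qed simp

text \<open>
  Symmetrizing the double sum over pairs of letters of \<open>w\<close> gives \<open>tri p w w\<close>; the antisymmetric rest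
  is a multiple of the enclosed area by \<open>tri_anti\<close>. Since \<open>2 = - 1\<close>, no factor is left over.
\<close>

lemma double_drift: "drift p [] w + drift p [] w = tri p w w - vec p * area [] w"
proof (induction w rule: rev_induct)
  case (snoc i w)
  have "tri p w [i] - tri p [i] w = - (vec p * vec w * \<xi> i)"
    using tri_anti[of p w "[i]"] by simp
  then have "tri p [i] w = tri p w [i] + vec p * vec w * \<xi> i"
    by (simp add: algebra_simps)
  then show ?case
    using snoc tri_same[of p i]
    by (simp add: drift_append area_append tri_append algebra_simps)
qed simp


lemma drift_append_left: "drift (p @ q) n w = drift p n w + drift q n w"
  by (induction w arbitrary: n) (simp_all add: tri_append)

lemma height_from: "height p w = height [] w + (drift p [] w + drift p [] w) + tri p p w"
  using height_shift[of p "[]" w] by simp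

lemma transport_from: "transport p w = transport [] w * (1 + vec p * vec w)"
  using transport_shift[of p "[]" w] by simp

text \<open>
  The part of the height of a concatenation that depends on \<open>x\<close> preceding \<open>y\<close>.
\<close>

definition pair_height :: "nat list \<Rightarrow> nat list \<Rightarrow> nat list \<Rightarrow> 'r" where
  "pair_height u x y = (drift x [] y + drift x [] y) + (tri u x y + tri u x y) + tri x x y"

lemma height_three:
  "height u (x @ y @ z) = height u x + height u y + height u z
    + (pair_height u x y + pair_height u x z + pair_height u y z) + (tri x y z + tri x y z)"
proof -
  have "height (u @ x) y = height u y + pair_height u x y"
    unfolding height_from[of "u @ x" y] height_from[of u y] pair_height_def
    by (simp add: drift_append_left tri_append tri_swap[of x u] ac_simps)
  moreover have "height (u @ x @ y) z = height u z + pair_height u x z + pair_height u y z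
      + (tri x y z + tri x y z)"
    unfolding height_from[of "u @ x @ y" z] height_from[of u z] pair_height_def
    by (simp add: drift_append_left tri_append tri_swap[of x u] tri_swap[of y u] tri_swap[of y x]
        ac_simps)
  ultimately show ?thesis
    by (simp add: height_append ac_simps)
qed

text \<open>
  The effect on the height of exchanging two neighbouring blocks. All terms that are not alternating
  have cancelled, which is what \<open>theta\<close> was chosen for.
\<close>

lemma pair_height_commutator:
  "pair_height u x y - pair_height u y x =
    vec y * area [] x - vec x * area [] y - (vec u * vec x * vec y + vec u * vec x * vec y)"
proof -
  have yxy: "vec y * vec x * vec y = 0"
    unfolding mult.assoc vec_anti[of x y] by (simp add: vec_sq flip: mult.assoc)
  have 1: "tri x y y = tri y y x"
    using tri_anti[of y x y] yxy by (simp add: tri_swap[of x y])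
  have 2: "tri y x x = tri x x y"
    using tri_anti[of x x y] vec_sq[of x] by (simp add: tri_swap[of y x])
  have 3: "tri u x y = tri u y x - vec u * vec x * vec y"
    using tri_anti[of u x y] by (simp add: algebra_simps)
  show ?thesis
    unfolding pair_height_def double_drift 1 2 3 by simp
qed

lemma pair_height_weighted:
  "(vec x * vec z - vec y * vec z) * (pair_height u x y - pair_height u y x) =
    vec x * vec y * vec z * (area [] y - area [] x)"
proof -
  note W = even_vec[OF even_area[of "[]"], symmetric]
  have kill: "vec x * vec z * (vec x * r) = 0" "vec y * vec z * (vec y * r) = 0" for r
  proof -
    have "vec p * vec q * vec p = 0" for p q
      unfolding mult.assoc vec_anti[of q p] by (simp add: vec_sq flip: mult.assoc)
    then show "vec x * vec z * (vec x * r) = 0" "vec y * vec z * (vec y * r) = 0"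
      by (simp_all flip: mult.assoc)
  qed
  have s: "vec u * vec x * vec y = vec x * (vec y * vec u)" "vec u * vec x * vec y = vec y * (vec u * vec x)"
    using even_vec[OF even_vec_vec[of x y], of u] even_vec[OF even_vec_vec[of u x], of y]
    by (simp_all add: mult.assoc)
  have 1: "vec x * vec z * (vec y * area [] x) = - (vec x * vec y * vec z * area [] x)"
    unfolding mult.assoc vec_anti[of z y, THEN arg_cong[where f = "\<lambda>r. r * area [] x"], unfolded mult.assoc]
    by (simp add: mult.assoc)
  have 2: "vec y * vec z * (vec x * area [] y) = vec x * vec y * vec z * area [] y"
    using even_vec[OF even_vec_vec[of y z], of x] by (simp flip: mult.assoc)
  have m1: "vec x * vec z * (pair_height u x y - pair_height u y x) = - (vec x * vec y * vec z * area [] x)"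
    unfolding pair_height_commutator right_diff_distrib distrib_left s(1) kill 1 by simp
  have m2: "vec y * vec z * (pair_height u x y - pair_height u y x) = - (vec x * vec y * vec z * area [] y)"
    unfolding pair_height_commutator right_diff_distrib distrib_left s(2) kill 2 by simp
  show ?thesis
    unfolding left_diff_distrib m1 m2 by (simp add: right_diff_distrib)
qed

text \<open>
  Bookkeeping for the sum over six orders: every term occurs three times, except for the combinations
  in the hypotheses. The letters \<open>P\<close>, \<open>Q\<close>, \<open>R\<close> stand for the products \<open>ab\<close>, \<open>ac\<close>, \<open>bc\<close>.
\<close>

lemma six_orders:
  fixes P Q R B :: 'r
  assumes t: "t1 + t2 + t3 = 0"
    and weighted: "(Q - R) * (Kab - Kba) + (P + R) * (Kac - Kca) + (Q - P) * (Kbc - Kcb) = 0"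
    and triple: "(Q + R) * t1 + (P - R) * t3 - (P + Q) * t2 = 0"
  shows "(1 + (P + Q + R)) * (B + (Kab + Kac + Kbc) + (t1 + t1))
    + (1 + (P + Q - R)) * (B + (Kac + Kab + Kcb) + (t3 + t3))
    + (1 + (Q + R - P)) * (B + (Kba + Kbc + Kac) + (t1 + t1))
    + (1 + (R - P - Q)) * (B + (Kbc + Kba + Kca) + (t2 + t2))
    + (1 + (P - Q - R)) * (B + (Kca + Kcb + Kab) + (t3 + t3))
    + (1 + (- P - Q - R)) * (B + (Kcb + Kca + Kba) + (t2 + t2)) = 0" (is "?L = 0")
proof -
  define w where "w = (Q - R) * (Kab - Kba) + (P + R) * (Kac - Kca) + (Q - P) * (Kbc - Kcb)"
  define e where "e = (Q + R) * t1 + (P - R) * t3 - (P + Q) * t2"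
  define y where "y = (B + B) + (Kab + Kba + Kac + Kca + Kbc + Kcb) + P * (Kab - Kba)
      + Q * (Kac - Kca) + R * (Kbc - Kcb) + e + (t1 + t2 + t3)"
  have "?L = w + e + (t1 + t2 + t3) + (y + y + y)"
    unfolding w_def e_def y_def by (simp add: algebra_simps)
  then show ?thesis
    using t weighted triple char3[of y] unfolding w_def e_def by simp
qed

text \<open>
  The core of the argument in characteristic 3. The areas contributed by the three exchanges cancel in
  pairs, and the values of \<open>tri\<close> at permutations of \<open>a\<close>, \<open>b\<close>, \<open>c\<close> differ by multiples of \<open>abc\<close>, which
  every product of two of the three vectors annihilates.
\<close>

lemma transport_height_three:
  "(1 + (vec a * vec b + vec a * vec c + vec b * vec c)) * (H + height u (a @ b @ c))
    + (1 + (vec a * vec c + vec a * vec b + vec c * vec b)) * (H + height u (a @ c @ b))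
    + (1 + (vec b * vec a + vec b * vec c + vec a * vec c)) * (H + height u (b @ a @ c))
    + (1 + (vec b * vec c + vec b * vec a + vec c * vec a)) * (H + height u (b @ c @ a))
    + (1 + (vec c * vec a + vec c * vec b + vec a * vec b)) * (H + height u (c @ a @ b))
    + (1 + (vec c * vec b + vec c * vec a + vec b * vec a)) * (H + height u (c @ b @ a)) = 0"
proof -
  let ?P = "vec a * vec b" and ?Q = "vec a * vec c" and ?R = "vec b * vec c"
  let ?K = "pair_height u"
  define N where "N = vec a * vec b * vec c"
  have anti: "vec b * vec a = - ?P" "vec c * vec a = - ?Q" "vec c * vec b = - ?R"
    using vec_anti by blast+
  have t: "tri a b c + tri b c a + tri a c b = 0"
    using tri_cyclic[of a b c] by (simp add: tri_swap[of c a])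
  have perm: "vec a * vec c * vec b = - N" "vec b * vec c * vec a = N"
    using anti even_vec[OF even_vec_vec[of b c], of a] by (simp_all add: N_def mult.assoc)
  have "(?Q - ?R) * (?K a b - ?K b a) = N * (area [] b - area [] a)"
    using pair_height_weighted[of a c b u] by (simp add: N_def)
  moreover have "(?P + ?R) * (?K a c - ?K c a) = - N * (area [] c - area [] a)"
    using pair_height_weighted[of a b c u] unfolding anti perm by simp
  moreover have "(?Q - ?P) * (?K b c - ?K c b) = N * (area [] c - area [] b)"
    using pair_height_weighted[of b a c u] unfolding anti perm by simp
  ultimately have weighted: "(?Q - ?R) * (?K a b - ?K b a) + (?P + ?R) * (?K a c - ?K c a)
      + (?Q - ?P) * (?K b c - ?K c b) = 0"
    by (simp add: right_diff_distrib)
  have t3: "tri a c b = tri a b c + N"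
    using tri_anti[of a b c] by (simp add: N_def algebra_simps)
  have t2: "tri b c a = tri a b c - N"
    using tri_anti[of b c a] perm(2) by (simp add: tri_swap[of b a] algebra_simps)
  have kill: "?P * N = 0" "?Q * N = 0" "?R * N = 0"
  proof -
    have "?P * N = vec a * vec b * (vec a * vec b) * vec c" "?Q * N = vec a * vec c * (vec a * vec b) * vec c"
      by (simp_all add: N_def mult.assoc)
    then show "?P * N = 0" "?Q * N = 0"
      by (simp_all add: vec_mid(1))
    have "?R * N = vec b * vec c * (vec b * vec c) * vec a"
      by (simp add: perm(2)[symmetric] mult.assoc)
    then show "?R * N = 0"
      by (simp add: vec_mid(1))
  qed
  have triple: "(?Q + ?R) * tri a b c + (?P - ?R) * tri a c b - (?P + ?Q) * tri b c a = 0"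
    unfolding t2 t3 by (simp add: algebra_simps kill[unfolded mult.assoc])
  have h: "H + height u (x @ y @ z) = (H + (height u a + height u b + height u c))
      + (?K x y + ?K x z + ?K y z) + (tri x y z + tri x y z)"
    if "height u x + height u y + height u z = height u a + height u b + height u c" for x y z
    unfolding height_three that[symmetric] by (simp add: add.assoc)
  have X: "?Q + ?P + vec c * vec b = ?P + ?Q - ?R" "vec b * vec a + ?R + ?Q = ?Q + ?R - ?P"
    "?R + vec b * vec a + vec c * vec a = ?R - ?P - ?Q"
    "vec c * vec a + vec c * vec b + ?P = ?P - ?Q - ?R"
    "vec c * vec b + vec c * vec a + vec b * vec a = - ?P - ?Q - ?R"
    unfolding anti by (simp_all add: algebra_simps)
  have heights: "H + height u (b @ a @ c) = H + (height u a + height u b + height u c)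
        + (?K b a + ?K b c + ?K a c) + (tri a b c + tri a b c)"
    "H + height u (c @ a @ b) = H + (height u a + height u b + height u c)
        + (?K c a + ?K c b + ?K a b) + (tri a c b + tri a c b)"
    "H + height u (c @ b @ a) = H + (height u a + height u b + height u c)
        + (?K c b + ?K c a + ?K b a) + (tri b c a + tri b c a)"
    using h[of b a c] h[of c a b] h[of c b a]
    by (simp_all add: ac_simps tri_swap[of b a] tri_swap[of c a] tri_swap[of c b])
  have heights': "H + height u (a @ b @ c) = H + (height u a + height u b + height u c)
        + (?K a b + ?K a c + ?K b c) + (tri a b c + tri a b c)"
    "H + height u (a @ c @ b) = H + (height u a + height u b + height u c)
        + (?K a c + ?K a b + ?K c b) + (tri a c b + tri a c b)"
    "H + height u (b @ c @ a) = H + (height u a + height u b + height u c)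
        + (?K b c + ?K b a + ?K c a) + (tri b c a + tri b c a)"
    by (intro h; simp add: ac_simps)+
  show ?thesis
    unfolding X heights heights' by (rule six_orders[OF t weighted triple])
qed

end

section \<open>Creation operators\<close>

text \<open>
  Grassmann symbols are realized as creation operators on functions of sets of indices,
  because composition of additive operators is associative for free.
\<close>

typedef (overloaded) 'k fock_op = "{f :: (nat set \<Rightarrow> 'k :: field) \<Rightarrow> nat set \<Rightarrow> 'k. \<forall>x y. f (x + y) = f x + f y}"
  morphisms app Fock_op
  by (rule exI[of _ "\<lambda>x. x"]) simp

setup_lifting type_definition_fock_op

instantiation fock_op :: (field) ring_1
begin

lift_definition zero_fock_op :: "'a fock_op" is "\<lambda>x. 0" by simp
lift_definition one_fock_op :: "'a fock_op" is "\<lambda>x. x" by simp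
lift_definition plus_fock_op :: "'a fock_op \<Rightarrow> 'a fock_op \<Rightarrow> 'a fock_op" is "\<lambda>f g x. f x + g x"
  by (simp add: algebra_simps)
lift_definition uminus_fock_op :: "'a fock_op \<Rightarrow> 'a fock_op" is "\<lambda>f x. - f x" by simp
lift_definition minus_fock_op :: "'a fock_op \<Rightarrow> 'a fock_op \<Rightarrow> 'a fock_op" is "\<lambda>f g x. f x - g x"
  by (simp add: algebra_simps)
lift_definition times_fock_op :: "'a fock_op \<Rightarrow> 'a fock_op \<Rightarrow> 'a fock_op" is "\<lambda>f g x. f (g x)" by simp

instance
proof
  fix a b c :: "'a fock_op"
  have "(1 :: nat set \<Rightarrow> 'a) \<noteq> 0"
    by (simp add: fun_eq_iff)
  then show "(0 :: 'a fock_op) \<noteq> 1"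
    by transfer (metis)
qed (transfer; simp add: algebra_simps fun_eq_iff)+

end

lemma app_simps [simp]:
  "app 0 x = 0" "app 1 x = x" "app (r + s) x = app r x + app s x" "app (- r) x = - app r x"
  "app (r - s) x = app r x - app s x" "app (r * s) x = app r (app s x)"
  by (transfer; simp)+

lift_definition create :: "nat \<Rightarrow> 'k :: field fock_op" is
  "\<lambda>i x S. if i \<in> S then (- 1) ^ card {j \<in> S. j < i} * x (S - {i}) else 0"
  by (auto simp: fun_eq_iff distrib_left)

lemma app_create: "app (create i) x S = (if i \<in> S then (- 1) ^ card {j \<in> S. j < i} * x (S - {i}) else 0)"
  by transfer simp

lemma create_sq: "create i * create i = 0"
  by (rule app_inject[THEN iffD1]) (simp add: fun_eq_iff app_create)

lemma create_anticommute: "create i * create j = - (create j * create i :: 'k :: field fock_op)"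
proof -
  have less: "app (create i * create j) x S = - app (create j * create i) x S" if "i < j" for i j S and x :: "nat set \<Rightarrow> 'k"
  proof (cases "i \<in> S \<and> j \<in> S")
    case True
    have "{k \<in> S. k < j} = insert i {k \<in> S - {i}. k < j}"
      using True that by auto
    then have c: "card {k \<in> S. k < j} = Suc (card {k \<in> S - {i}. k < j})"
      by simp
    have "{k \<in> S - {j}. k < i} = {k \<in> S. k < i}"
      using that by auto
    moreover have "S - {i} - {j} = S - {j} - {i}"
      by auto
    ultimately show ?thesis
      using True that c by (simp add: app_create)
  next
    case False
    then show ?thesis
      by (auto simp: app_create)
  qed
  consider "i < j" | "i = j" | "j < i"
    by linarith
  then have "app (create i * create j) x S = - app (create j * create i) x S" for S and x :: "nat set \<Rightarrow> 'k"
  proof cases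
    case 2
    show ?thesis
      unfolding 2 create_sq by simp
  next
    case 3
    show ?thesis
      using less[OF 3, of x S] by (metis minus_minus)
  qed (rule less)
  then show ?thesis
    by (intro app_inject[THEN iffD1]) (simp add: fun_eq_iff)
qed

lemma fock_op_char3:
  assumes "CHAR('k :: field) = 3"
  shows "(r :: 'k fock_op) + r + r = 0"
proof -
  have "(1 + 1 + 1 :: 'k) = 0"
    using of_nat_CHAR[where 'a = 'k] assms by (simp add: numeral_3_eq_3)
  then have "c + c + c = 0" for c :: 'k
    by (metis distrib_left mult.right_neutral mult_zero_right)
  then show ?thesis
    by (intro app_inject[THEN iffD1]) (simp add: fun_eq_iff)
qed

section \<open>A nonzero word in characteristic three\<close>

text \<open>
  A loop modulo 3 in the letters \<open>x\<close> and \<open>x + 1\<close> that encloses a nonzero area.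
\<close>

definition pair_block :: "nat \<Rightarrow> nat list" where
  "pair_block x = [x, x, Suc x, x, Suc x, Suc x]"

text \<open>
  A loop modulo 3 in three letters with nonzero height.
\<close>

definition triple_block :: "nat list" where
  "triple_block = [0, 0, 1, 1, 2, 0, 1, 2, 2]"

primrec pair_blocks :: "nat \<Rightarrow> nat \<Rightarrow> nat list" where
  "pair_blocks b 0 = []"
| "pair_blocks b (Suc m) = pair_blocks b m @ pair_block (b + 2 * m)"

context grassmann3 begin

lemma even_commute_transport: "even_elem z \<Longrightarrow> z * transport p w = transport p w * z"
proof (induction w arbitrary: p)
  case (Cons i w)
  have "z * (vec p * vec [i]) = vec p * vec [i] * z"
    using Cons.prems by (rule even_commute_vec_vec)
  then have "z * (1 + vec p * \<xi> i) = (1 + vec p * \<xi> i) * z"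
    by (simp add: distrib_left distrib_right)
  then show ?case
    using Cons.IH[OF Cons.prems, of "p @ [i]"] by simp (metis mult.assoc)
qed simp

text \<open>
  The part of the transport of \<open>u x y z v\<close> that is insensitive to the order of \<open>x\<close>, \<open>y\<close>, \<open>z\<close>.
\<close>

definition order_factor :: "nat list \<Rightarrow> nat list \<Rightarrow> nat list \<Rightarrow> nat list \<Rightarrow> nat list \<Rightarrow> 'r" where
  "order_factor u x y z v = transport [] u * (transport [] x * transport [] y * transport [] z)
     * ((1 + vec u * vec (x @ y @ z)) * (transport [] v * (1 + vec (u @ x @ y @ z) * vec v)))"

lemma transport_order:
  "transport [] (u @ x @ y @ z @ v) =
    order_factor u x y z v * (1 + (vec x * vec y + vec x * vec z + vec y * vec z))"
proof -
  let ?X = "vec x * vec y + vec x * vec z + vec y * vec z"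
  let ?r = "(1 + vec u * vec (x @ y @ z)) * (transport [] v * (1 + vec (u @ x @ y @ z) * vec v))"
  have xyz: "transport [] (x @ y @ z) = transport [] x * transport [] y * transport [] z * (1 + ?X)"
  proof -
    have "transport [] (x @ y @ z) = transport [] x * (transport [] y * (transport [] z * (1 + vec y * vec z))
        * (1 + vec x * vec (y @ z)))"
      by (simp only: transport_append[of "[]" x "y @ z"] transport_from[of x "y @ z"]
          transport_append[of "[]" y z] transport_from[of y z] append_Nil)
    also have "\<dots> = transport [] x * transport [] y * transport [] z
        * ((1 + vec y * vec z) * (1 + vec x * vec (y @ z)))"
      by (simp only: mult.assoc)
    also have "(1 + vec y * vec z) * (1 + vec x * vec (y @ z)) = 1 + ?X"
    proof -
      have "vec y * vec z * (vec x * vec y) = 0"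
        unfolding vec_anti[of y z] using vec_mid(2)[of z y x] by simp
      moreover have "vec y * vec z * (vec x * vec z) = 0"
        by (rule vec_mid)
      ultimately show ?thesis
        by (simp add: distrib_left distrib_right add_ac)
    qed
    finally show ?thesis .
  qed
  have "(1 + ?X) * r = r * (1 + ?X)" if "even_elem r" for r
    using that by (simp add: distrib_left distrib_right even_commute_vec_vec)
  then have comm: "(1 + ?X) * ?r = ?r * (1 + ?X)"
    using even_mult even_add even_one even_vec_vec even_transport by presburger
  have "transport [] (u @ (x @ y @ z) @ v) = transport [] u * (transport [] (x @ y @ z) * ?r)"
    by (simp only: transport_append[of "[]" u "(x @ y @ z) @ v"] transport_append[of u "x @ y @ z" v]
        transport_from[of u "x @ y @ z"] transport_from[of "u @ x @ y @ z" v] append_Nil mult.assoc)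
  also have "\<dots> = transport [] u * (transport [] x * transport [] y * transport [] z * ((1 + ?X) * ?r))"
    unfolding xyz by (simp only: mult.assoc)
  also have "\<dots> = order_factor u x y z v * (1 + ?X)"
    unfolding comm order_factor_def by (simp only: mult.assoc)
  finally show ?thesis
    by simp
qed

lemma order_factor_swap:
  "order_factor u y x z v = order_factor u x y z v" "order_factor u x z y v = order_factor u x y z v"
proof -
  have comm: "transport [] x * transport [] y = transport [] y * transport [] x" for x y
    by (rule even_commute_transport[OF even_transport])
  have "transport [] y * transport [] x * transport [] z = transport [] x * transport [] y * transport [] z"
    using comm[of x y] by simp
  moreover have "transport [] x * transport [] z * transport [] y = transport [] x * transport [] y * transport [] z"
    using comm[of y z] by (simp add: mult.assoc)
  ultimately show "order_factor u y x z v = order_factor u x y z v"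
    "order_factor u x z y v = order_factor u x y z v"
    unfolding order_factor_def by (simp_all add: add_ac)
qed

definition outer_height :: "nat list \<Rightarrow> nat list \<Rightarrow> nat list \<Rightarrow> nat list \<Rightarrow> nat list \<Rightarrow> 'r" where
  "outer_height u x y z v = height [] u + height (u @ x @ y @ z) v"

lemma height_order:
  "height [] (u @ x @ y @ z @ v) = outer_height u x y z v + height u (x @ y @ z)"
  using height_append[of "[]" u "(x @ y @ z) @ v"] height_append[of u "x @ y @ z" v]
  by (simp add: outer_height_def add_ac)

lemma outer_height_swap:
  "outer_height u y x z v = outer_height u x y z v" "outer_height u x z y v = outer_height u x y z v"
  unfolding outer_height_def height_from[of "u @ _"]
  by (simp_all add: drift_append_left tri_append add_ac)

lemma sum_orders_transport_height:
  "transport [] (u @ a @ b @ c @ v) * (H + height [] (u @ a @ b @ c @ v))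
    + transport [] (u @ a @ c @ b @ v) * (H + height [] (u @ a @ c @ b @ v))
    + transport [] (u @ b @ a @ c @ v) * (H + height [] (u @ b @ a @ c @ v))
    + transport [] (u @ b @ c @ a @ v) * (H + height [] (u @ b @ c @ a @ v))
    + transport [] (u @ c @ a @ b @ v) * (H + height [] (u @ c @ a @ b @ v))
    + transport [] (u @ c @ b @ a @ v) * (H + height [] (u @ c @ b @ a @ v)) = 0"
proof -
  let ?G = "order_factor u a b c v" and ?H = "outer_height u a b c v"
  have G: "order_factor u a c b v = ?G" "order_factor u b a c v = ?G" "order_factor u b c a v = ?G"
    "order_factor u c a b v = ?G" "order_factor u c b a v = ?G"
    using order_factor_swap by metis+
  have H: "outer_height u a c b v = ?H" "outer_height u b a c v = ?H" "outer_height u b c a v = ?H"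
    "outer_height u c a b v = ?H" "outer_height u c b a v = ?H"
    using outer_height_swap by metis+
  show ?thesis
    unfolding transport_order height_order G H add.assoc[of H ?H, symmetric] mult.assoc[of ?G]
      distrib_left[of ?G, symmetric] transport_height_three by simp
qed

text \<open>
  The difference of two instances of \<open>sum_orders_transport_height\<close>, for \<open>H = 1\<close> and \<open>H = 0\<close>.
\<close>

lemma sum_orders_transport:
  "transport [] (u @ a @ b @ c @ v) + transport [] (u @ a @ c @ b @ v) + transport [] (u @ b @ a @ c @ v)
    + transport [] (u @ b @ c @ a @ v) + transport [] (u @ c @ a @ b @ v) + transport [] (u @ c @ b @ a @ v) = 0"
  using sum_orders_transport_height[of u a b c v 1] sum_orders_transport_height[of u a b c v 0]
  by (simp add: distrib_left add_ac)

lemma transport_cubed: "transport p w * transport p w * transport p w = 1"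
proof (induction w arbitrary: p)
  case (Cons i w)
  let ?q = "1 + vec p * \<xi> i" and ?T = "transport (p @ [i]) w"
  have comm: "?T * ?q = ?q * ?T"
    using even_commute_transport[OF even_add[OF even_one even_vec_xi], of p i "p @ [i]" w] by simp
  have qq: "vec p * \<xi> i * (vec p * \<xi> i) = 0"
    using vec_mid(1)[of p "[i]" "[i]"] by simp
  have "?q * ?T * (?q * ?T) * (?q * ?T) = ?q * (?T * ?q) * (?T * ?q) * ?T"
    by (simp only: mult.assoc)
  also have "\<dots> = ?q * (?q * ?T) * (?q * ?T) * ?T"
    by (simp only: comm)
  also have "\<dots> = ?q * ?q * (?T * ?q) * (?T * ?T)"
    by (simp only: mult.assoc)
  also have "\<dots> = ?q * ?q * (?q * ?T) * (?T * ?T)"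
    by (simp only: comm)
  also have "\<dots> = ?q * ?q * ?q * (?T * ?T * ?T)"
    by (simp only: mult.assoc)
  also have "?q * ?q * ?q = 1 + (vec p * \<xi> i + vec p * \<xi> i + vec p * \<xi> i)"
  proof -
    have "?q * ?q = 1 + (vec p * \<xi> i + vec p * \<xi> i)"
      using qq by (simp add: distrib_left distrib_right add_ac)
    then show ?thesis
      using qq by (simp add: distrib_left distrib_right add_ac)
  qed
  finally show ?case
    using Cons.IH char3 by simp
qed simp

lemma transport_cube_cancel: "transport [] (u @ a @ a @ a @ v) = transport [] (u @ v)"
proof -
  have vec3: "vec (a @ a @ a) = 0" "vec (u @ a @ a @ a) = vec u"
    using char3[of "vec a"] by (simp_all add: add.assoc)
  have "transport [] (u @ a @ a @ a @ v) = transport [] u * (transport [] v * (1 + vec u * vec v))"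
    unfolding transport_order order_factor_def transport_cubed vec3 vec_sq by simp
  then show ?thesis
    by (simp add: transport_append transport_from[of u])
qed

lemma triple_zero: "r + (r + r) = (0 :: 'r)" "r + (r + (r + s)) = s"
  using char3[of r] by (simp_all add: add.assoc[symmetric])

text \<open>
  A cube is a loop modulo 3 with trivial transport and height. It can therefore be deleted, and the
  functional then vanishes because the letters of \<open>a\<close> are missing from the rest.
\<close>

lemma height_cube_cancel: "height [] (u @ a @ a @ a @ v) = height [] (u @ v)"
proof -
  have "height u (a @ a @ a) = 0"
    unfolding height_three by (simp add: char3 tri_diag)
  moreover have "height (u @ a @ a @ a) v = height u v"
    unfolding height_from[of "u @ _"] height_from[of u v]
    by (simp add: drift_append_left tri_append add.assoc add.left_commute triple_zero)
  ultimately show ?thesis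
    by (simp add: height_order outer_height_def height_append)
qed

lemma of_int_closed:
  assumes "P 0" "P 1" and add: "\<And>r s. P r \<Longrightarrow> P s \<Longrightarrow> P (r + s)" and "\<And>r. P r \<Longrightarrow> P (- r)"
  shows "P (of_int n :: 'r)"
proof -
  have "P (of_nat m)" for m
    by (induction m) (auto intro: assms)
  then show ?thesis
    by (cases n rule: int_cases2) (auto intro: assms)
qed

lemma generated:
  assumes "P 0" "P 1" and add: "\<And>r s. P r \<Longrightarrow> P s \<Longrightarrow> P (r + s)" and "\<And>r. P r \<Longrightarrow> P (- r)"
    and mult: "\<And>r s. P r \<Longrightarrow> P s \<Longrightarrow> P (r * s)"
    and gen: "\<And>i. i \<in> set p \<union> set w \<Longrightarrow> P (\<xi> i)"
  shows "P (transport p w)" "P (height p w)"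
proof -
  have vec: "P (vec u)" if "\<And>i. i \<in> set u \<Longrightarrow> P (\<xi> i)" for u
    using that by (induction u) (auto intro: assms)
  show "P (transport p w)"
    using gen
  proof (induction w arbitrary: p)
    case (Cons i w)
    have "P (transport (p @ [i]) w)"
      using Cons.prems by (intro Cons.IH) auto
    moreover have "P (vec p)" "P (\<xi> i)"
      using Cons.prems by (auto intro: vec)
    ultimately show ?case
      by (auto intro: assms)
  qed (simp add: assms)
  have sum: "P (sum_list (map g xs))" if "\<And>x. x \<in> set xs \<Longrightarrow> P (g x)" for g :: "nat \<Rightarrow> 'r" and xs
    using that by (induction xs) (auto intro: assms)
  show "P (height p w)"
    using gen
  proof (induction w arbitrary: p)
    case (Cons i w)
    have "P (height (p @ [i]) w)"
      using Cons.prems by (intro Cons.IH) auto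
    moreover have "P (tri p p [i])"
      unfolding tri_def theta_def using Cons.prems
      by (intro sum mult of_int_closed[of P]) (auto intro: assms)
    ultimately show ?case
      by (auto intro: add)
  qed (simp add: assms)
qed

definition loop :: "nat list \<Rightarrow> bool" where
  "loop p \<longleftrightarrow> vec p = 0 \<and> (\<forall>v w. tri p v w = 0)"

lemma loop_append: "loop p \<Longrightarrow> loop q \<Longrightarrow> loop (p @ q)"
  by (simp add: loop_def tri_append)

lemma transport_loop: "loop p \<Longrightarrow> transport [] (p @ w) = transport [] p * transport [] w"
  by (simp add: transport_append transport_from[of p] loop_def)

lemma height_loop:
  assumes "loop p"
  shows "height [] (p @ w) = height [] p + height [] w"
proof -
  have "drift p n w = 0" for n
    using assms by (induction w arbitrary: n) (simp_all add: loop_def)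
  then show ?thesis
    using assms by (simp add: height_append height_from[of p] loop_def)
qed

lemma xi_absorbed:
  assumes "l \<in> {i, j, k}"
  shows "\<xi> l * (\<xi> i * \<xi> j * \<xi> k) = 0"
proof -
  have "\<xi> p * (\<xi> p * \<xi> q * \<xi> r) = 0" for p q r
    by (simp add: mult.assoc xi_repeat)
  then show ?thesis
    using assms xi_perm(2)[of j k i] xi_perm(3)[of k i j] by (metis empty_iff insert_iff)
qed

lemma transport_absorbed:
  assumes "\<And>i. i \<in> set w \<Longrightarrow> \<xi> i * m = 0"
  shows "transport p w * m = m"
  using assms by (induction w arbitrary: p) (simp_all add: mult.assoc distrib_right)

lemma loop_pair_block: "loop (pair_block x)"
proof -
  have "vec (pair_block x) = 0"
    by (simp add: pair_block_def triple_zero add.left_commute)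
  moreover have "tri (pair_block x) v w = 0" for v w
  proof -
    have "tri (pair_block x) v w = (tri [x] v w + tri [x] v w + tri [x] v w)
        + (tri [Suc x] v w + tri [Suc x] v w + tri [Suc x] v w)"
      unfolding pair_block_def
      by (simp add: tri_Cons(1)[of x "_ # _"] tri_Cons(1)[of "Suc x" "_ # _"] add_ac)
    then show ?thesis
      by (simp only: char3 add_0)
  qed
  ultimately show ?thesis
    by (simp add: loop_def)
qed

lemma transport_pair_block: "transport [] (pair_block x) = 1 + \<xi> x * \<xi> (Suc x)"
proof -
  let ?x = "\<xi> x" and ?y = "\<xi> (Suc x)"
  have "?y * ?x = - (?x * ?y)"
    by (rule anti)
  then show ?thesis
    unfolding pair_block_def
    by (simp add: distrib_left distrib_right sq mult.assoc xi_repeat triple_zero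
        right_diff_distrib left_diff_distrib)
qed

lemma theta_repeat [simp]: "theta i i k = 0" "theta i j i = 0" "theta i j j = 0"
  by (simp_all add: theta_def mult.assoc sq xi_repeat)

lemma height_pair_block: "height [] (pair_block x) = 0"
  by (simp add: pair_block_def tri_def)

lemma loop_triple_block: "loop triple_block"
proof -
  have "vec triple_block = 0"
    by (simp add: triple_block_def triple_zero add.left_commute)
  moreover have "tri triple_block v w = 0" for v w
  proof -
    have "tri triple_block v w = (tri [0] v w + tri [0] v w + tri [0] v w)
        + (tri [1] v w + tri [1] v w + tri [1] v w) + (tri [2] v w + tri [2] v w + tri [2] v w)"
      unfolding triple_block_def
      by (simp add: tri_Cons(1)[of 0 "_ # _"] tri_Cons(1)[of "Suc 0" "_ # _"] tri_Cons(1)[of 2 "_ # _"] add_ac)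
    then show ?thesis
      by (simp only: char3 add_0)
  qed
  ultimately show ?thesis
    by (simp add: loop_def)
qed

lemma height_triple_block: "height [] triple_block = - (\<xi> 0 * \<xi> 1 * \<xi> 2)"
proof -
  define c where "c = \<xi> 0 * \<xi> (Suc 0) * \<xi> 2"
  have "c + c + c = 0"
    by (rule char3)
  then have twice: "2 * c = - c"
    by (simp add: eq_neg_iff_add_eq_0 mult_2)
  have "theta 0 (Suc 0) 2 = - c"
    by (simp add: theta_def order_sign_def twice flip: c_def)
  moreover have "theta (Suc 0) 2 0 = c"
    unfolding theta_def xi_perm(2)[of "Suc 0" 2 0] c_def[symmetric] by (simp add: order_sign_def twice)
  moreover have "theta 0 2 (Suc 0) = 0"
    by (simp add: theta_def order_sign_def)
  ultimately have th: "theta 0 (Suc 0) 2 = - c" "theta (Suc 0) 0 2 = - c" "theta (Suc 0) 2 0 = c"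
    "theta 2 (Suc 0) 0 = c" "theta 0 2 (Suc 0) = 0" "theta 2 0 (Suc 0) = 0"
    using theta_swap by metis+
  have "height [] triple_block = - c"
    unfolding triple_block_def by (simp add: tri_def th triple_zero)
  then show ?thesis
    by (simp add: c_def)
qed

lemma pair_blocks:
  "loop (pair_blocks b m)" "height [] (pair_blocks b m) = 0"
  "transport [] (pair_blocks b (Suc m)) =
    (1 + \<xi> (b + 2 * m) * \<xi> (Suc (b + 2 * m))) * transport [] (pair_blocks b m)"
proof -
  show loop: "loop (pair_blocks b m)" for m
    by (induction m) (simp_all add: loop_append loop_pair_block, simp add: loop_def)
  show "height [] (pair_blocks b m) = 0"
    by (induction m) (simp_all add: height_loop loop height_pair_block)
  have "even_elem (1 + \<xi> (b + 2 * m) * \<xi> (Suc (b + 2 * m)))"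
    using even_add[OF even_one even_vec_xi[of "[b + 2 * m]"]] by simp
  then show "transport [] (pair_blocks b (Suc m)) =
    (1 + \<xi> (b + 2 * m) * \<xi> (Suc (b + 2 * m))) * transport [] (pair_blocks b m)"
    by (simp add: transport_loop loop transport_pair_block even_commute_transport)
qed

end

definition vacuum :: "nat set \<Rightarrow> 'k :: field" where
  "vacuum S = of_bool (S = {})"

text \<open>
  Operators that never create the index \<open>x\<close>. They contribute nothing to the coefficient at a set
  containing \<open>x\<close>.
\<close>

definition avoids :: "nat \<Rightarrow> 'k :: field fock_op \<Rightarrow> bool" where
  "avoids x r \<longleftrightarrow> (\<forall>\<psi>. (\<forall>S. x \<in> S \<longrightarrow> \<psi> S = 0) \<longrightarrow> (\<forall>S. x \<in> S \<longrightarrow> app r \<psi> S = 0))"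

lemma avoids_closed:
  "avoids x 0" "avoids x 1" "avoids x r \<Longrightarrow> avoids x s \<Longrightarrow> avoids x (r + s)"
  "avoids x r \<Longrightarrow> avoids x (- r)" "avoids x r \<Longrightarrow> avoids x s \<Longrightarrow> avoids x (r * s)"
  "i \<noteq> x \<Longrightarrow> avoids x (create i)"
  by (simp_all add: avoids_def app_create)

lemma grassmann3_create:
  assumes "CHAR('k :: field) = 3"
  shows "grassmann3 (create :: nat \<Rightarrow> 'k fock_op)"
  by standard (rule create_anticommute create_sq fock_op_char3[OF assms])+

definition top_coeff :: "nat \<Rightarrow> 'k :: field fock_op \<Rightarrow> 'k" where
  "top_coeff d r = app r vacuum {..<d}"

lemma top_coeff_add: "top_coeff d (r + s) = top_coeff d r + top_coeff d s"
  by (simp add: top_coeff_def)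

lemma top_coeff_zero: "top_coeff d 0 = 0"
  by (simp add: top_coeff_def)

lemma top_coeff_avoids: "avoids x r \<Longrightarrow> x < d \<Longrightarrow> top_coeff d r = 0"
proof -
  assume "avoids x r" "x < d"
  moreover have "\<forall>S. x \<in> S \<longrightarrow> vacuum S = (0 :: 'a)"
    by (auto simp: vacuum_def)
  ultimately show "top_coeff d r = 0"
    unfolding avoids_def top_coeff_def by blast
qed

text \<open>
  Each block contributes a factor \<open>1 + \<xi>\<^sub>x \<xi>\<^sub>x\<^sub>+\<^sub>1\<close> in two new indices, so only the product of all second
  summands reaches the full set of indices.
\<close>

lemma pair_blocks_top:
  assumes "CHAR('k :: field) = 3"
    and supp: "\<And>S. \<not> S \<subseteq> {..<b} \<Longrightarrow> \<psi> S = (0 :: 'k)"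
  shows "(\<forall>S. \<not> S \<subseteq> {..<b + 2 * m} \<longrightarrow>
      app (grassmann3.transport create [] (pair_blocks b m)) \<psi> S = 0) \<and>
    app (grassmann3.transport create [] (pair_blocks b m)) \<psi> {..<b + 2 * m} = \<psi> {..<b}"
proof -
  interpret grassmann3 "create :: nat \<Rightarrow> 'k fock_op"
    by (rule grassmann3_create[OF assms(1)])
  show ?thesis
  proof (induction m)
    case 0
    then show ?case
      by (simp add: supp)
  next
    case (Suc m)
    define x \<chi> where "x = b + 2 * m" and "\<chi> = app (transport [] (pair_blocks b m)) \<psi>"
    have step: "app (transport [] (pair_blocks b (Suc m))) \<psi> S =
        \<chi> S + app (create x) (app (create (Suc x)) \<chi>) S" for S
      unfolding pair_blocks(3) by (simp add: x_def \<chi>_def)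
    have IH: "\<chi> S = 0" if "\<not> S \<subseteq> {..<x}" for S
      using Suc that by (simp add: x_def \<chi>_def)
    have IH': "\<chi> {..<x} = \<psi> {..<b}"
      using Suc by (simp add: x_def \<chi>_def)
    have "app (transport [] (pair_blocks b (Suc m))) \<psi> S = 0" if "\<not> S \<subseteq> {..<x + 2}" for S
    proof -
      have "\<not> S \<subseteq> {..<x}" "\<not> S - {x} - {Suc x} \<subseteq> {..<x}"
        using that by (force simp: subset_iff)+
      then show ?thesis
        unfolding step by (simp add: IH app_create)
    qed
    moreover have "app (transport [] (pair_blocks b (Suc m))) \<psi> {..<x + 2} = \<psi> {..<b}"
    proof -
      have "\<chi> {..<x + 2} = 0"
        by (rule IH) auto
      moreover have "{j \<in> {..<x + 2}. j < x} = {..<x}" "{j \<in> {..<x + 2} - {x}. j < Suc x} = {..<x}"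
        "{..<x + 2} - {x} - {Suc x} = {..<x}"
        by auto
      ultimately show ?thesis
        unfolding step by (simp add: app_create IH' flip: power_add mult.assoc)
    qed
    ultimately show ?case
      by (simp add: x_def)
  qed
qed

definition longest_word :: "nat \<Rightarrow> nat list" where
  "longest_word d = (if even d then pair_blocks 0 (d div 2) else triple_block @ pair_blocks 3 ((d - 3) div 2))"

lemma count_list_pair_blocks:
  "count_list (pair_blocks b m) x = (if b \<le> x \<and> x < b + 2 * m then 3 else 0)"
  by (induction m) (auto simp: pair_block_def)

lemma count_list_longest_word:
  assumes "d \<ge> 2"
  shows "count_list (longest_word d) x = (if x < d then 3 else 0)"
proof (cases "even d")
  case True
  then show ?thesis
    by (auto simp: longest_word_def count_list_pair_blocks)
next
  case False
  then have "d \<ge> 3"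
    using assms by presburger
  then have d: "3 + 2 * ((d - 3) div 2) = d"
    using False by presburger
  have "count_list triple_block x = (if x < 3 then 3 else 0)"
    by (auto simp: triple_block_def)
  then show ?thesis
    using False \<open>d \<ge> 3\<close> count_list_pair_blocks[of 3 "(d - 3) div 2" x] unfolding d
    by (auto simp: longest_word_def)
qed

lemma mon_longest_word_char3:
  assumes char: "CHAR('k :: field) = 3" and d: "d \<ge> 2"
  shows "mon (longest_word d) \<notin> (cube_ideal d :: (nat word \<Rightarrow>\<^sub>0 'k) set)"
proof -
  interpret grassmann3 "create :: nat \<Rightarrow> 'k fock_op"
    by (rule grassmann3_create[OF char])
  define full where "full w \<longleftrightarrow> (\<forall>x. count_list w x = (if x < d then 3 else 0))" for w
  define \<Phi> where "\<Phi> w = (if even d then transport [] w else transport [] w * height [] w)" for w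
  define \<phi> where "\<phi> w = (if full w then top_coeff d (\<Phi> w) else 0)" for w
  let ?s = "\<lambda>f u a b c v. f (u @ a @ b @ c @ v) + f (u @ a @ c @ b @ v) + f (u @ b @ a @ c @ v)
        + f (u @ b @ c @ a @ v) + f (u @ c @ a @ b @ v) + f (u @ c @ b @ a @ v)"
  have full_perm: "full (u @ a @ c @ b @ v) = full (u @ a @ b @ c @ v)"
    "full (u @ b @ a @ c @ v) = full (u @ a @ b @ c @ v)" for u a b c v
    by (simp_all add: full_def add_ac)
  have sym: "?s \<phi> u a b c v = 0" for u a b c v
  proof -
    have "?s \<Phi> u a b c v = 0"
      using sum_orders_transport[of u a b c v] sum_orders_transport_height[of u a b c v 0]
      by (simp add: \<Phi>_def)
    then have "?s (\<lambda>w. top_coeff d (\<Phi> w)) u a b c v = 0"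
      by (simp only: top_coeff_zero flip: top_coeff_add)
    moreover have "full (u @ a @ c @ b @ v) = full (u @ a @ b @ c @ v)"
      "full (u @ b @ a @ c @ v) = full (u @ a @ b @ c @ v)"
      "full (u @ b @ c @ a @ v) = full (u @ a @ b @ c @ v)"
      "full (u @ c @ a @ b @ v) = full (u @ a @ b @ c @ v)"
      "full (u @ c @ b @ a @ v) = full (u @ a @ b @ c @ v)"
      using full_perm by metis+
    ultimately show ?thesis
      unfolding \<phi>_def by (cases "full (u @ a @ b @ c @ v)") simp_all
  qed
  have "(1 + 1 + 1 :: 'k) = 0"
    using of_nat_CHAR[where 'a = 'k] char by (simp add: numeral_3_eq_3)
  then have two: "(2 :: 'k) \<noteq> 0"
    by (metis add_0 one_add_one zero_neq_one)
  show ?thesis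
  proof (rule not_in_cube_ideal[where \<phi> = \<phi>])
    fix u a v :: "nat list" assume "a \<noteq> []"
    show "\<phi> (u @ a @ a @ a @ v) = 0"
    proof (cases "full (u @ a @ a @ a @ v)")
      case True
      obtain x where x: "x \<in> set a"
        using \<open>a \<noteq> []\<close> by (cases a) auto
      then have "count_list a x \<noteq> 0"
        by (simp add: count_list_0_iff)
      moreover have "count_list u x + (count_list a x + (count_list a x + (count_list a x
          + count_list v x))) = (if x < d then 3 else 0)"
        using True[unfolded full_def, THEN spec, of x] by simp
      ultimately have "x < d" "count_list (u @ v) x = 0"
        by (auto split: if_splits)
      then have "x \<notin> set (u @ v)"
        by (simp add: count_list_0_iff)
      then have "avoids x (transport [] (u @ v))" "avoids x (height [] (u @ v))"
        by (intro generated[of "avoids x"] avoids_closed; auto)+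
      then have "avoids x (\<Phi> (u @ a @ a @ a @ v))"
        by (simp add: \<Phi>_def transport_cube_cancel height_cube_cancel avoids_closed)
      then have "top_coeff d (\<Phi> (u @ a @ a @ a @ v)) = 0"
        using \<open>x < d\<close> by (rule top_coeff_avoids)
      then show ?thesis
        by (simp add: \<phi>_def)
    qed (simp add: \<phi>_def)
  next
    fix u a b v
    have double: "P + Q + P + Q + R + R = 2 * (P + Q + R)" for P Q R :: 'k
      by (simp add: algebra_simps)
    have "2 * (\<phi> (u @ a @ a @ b @ v) + \<phi> (u @ a @ b @ a @ v) + \<phi> (u @ b @ a @ a @ v)) = 0"
      using sym[of u a a b v] unfolding double .
    then show "\<phi> (u @ a @ a @ b @ v) + \<phi> (u @ a @ b @ a @ v) + \<phi> (u @ b @ a @ a @ v) = 0"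
      using two unfolding mult_eq_0_iff by blast
  next
    fix u a b c v
    show "?s \<phi> u a b c v = 0"
      by (rule sym)
  next
    have "top_coeff d (\<Phi> (longest_word d)) \<noteq> 0"
    proof (cases "even d")
      case True
      then have "top_coeff d (\<Phi> (longest_word d)) = vacuum {..<0}"
        using pair_blocks_top[OF char, of 0 vacuum "d div 2"]
        by (auto simp: \<Phi>_def longest_word_def top_coeff_def vacuum_def)
      then show ?thesis
        by (simp add: vacuum_def)
    next
      case False
      then have "d \<ge> 3"
        using d by presburger
      then have d': "3 + 2 * ((d - 3) div 2) = d"
        using False by presburger
      let ?p = "pair_blocks 3 ((d - 3) div 2)"
      define c where "c = - (create 0 * create 1 * create 2 :: 'k fock_op)"
      have "create i * c = 0" if "i \<in> set triple_block" for i
        using that xi_absorbed[of i 0 1 2] by (auto simp: triple_block_def c_def)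
      then have "transport [] triple_block * c = c"
        by (rule transport_absorbed)
      moreover have "transport [] triple_block * transport [] ?p = transport [] ?p * transport [] triple_block"
        by (rule even_commute_transport[OF even_transport])
      ultimately have "transport [] triple_block * transport [] ?p * c = transport [] ?p * c"
        by (simp add: mult.assoc)
      then have "\<Phi> (longest_word d) = transport [] ?p * c"
        using False by (simp add: \<Phi>_def longest_word_def transport_loop height_loop loop_triple_block
            height_triple_block pair_blocks(2) c_def)
      moreover have "app c vacuum S = (if S = {..<3} then - 1 else 0)" for S :: "nat set"
      proof (cases "0 \<in> S \<and> 1 \<in> S \<and> 2 \<in> S")
        case True
        have empty: "S - {0} - {1} - {2} = {} \<longleftrightarrow> S = {..<3}"
          using True by (auto simp: numeral_3_eq_3 numeral_2_eq_2 less_Suc_eq)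
        have below: "{j \<in> S. j < 0} = {}" "{j \<in> S - {0}. j < 1} = {}" "{j \<in> S - {0} - {1}. j < 2} = {}"
          by (auto simp: numeral_2_eq_2 less_Suc_eq)
        have "app c vacuum S = - ((- 1) ^ card {j \<in> S. j < 0} * ((- 1) ^ card {j \<in> S - {0}. j < 1} *
            ((- 1) ^ card {j \<in> S - {0} - {1}. j < 2} * vacuum (S - {0} - {1} - {2}))))"
          using True by (simp add: c_def app_create)
        then show ?thesis
          unfolding below vacuum_def empty by simp
      next
        case False
        then have "S \<noteq> {..<3}"
          by auto
        then show ?thesis
          using False by (auto simp: c_def app_create)
      qed
      ultimately show ?thesis
        using pair_blocks_top[OF char, of 3 "app c vacuum" "(d - 3) div 2"]
        unfolding d' by (simp add: top_coeff_def)
    qed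
    moreover have "full (longest_word d)"
      unfolding full_def using count_list_longest_word[OF d] by blast
    ultimately show "\<phi> (longest_word d) \<noteq> 0"
      by (simp add: \<phi>_def)
  qed
qed


section \<open>The nilpotency degrees\<close>

lemma longest_word:
  assumes "d \<ge> 2"
  shows "set (longest_word d) \<subseteq> {..<d}" "length (longest_word d) = 3 * d"
proof -
  show sub: "set (longest_word d) \<subseteq> {..<d}"
  proof
    fix x assume "x \<in> set (longest_word d)"
    then have "count_list (longest_word d) x \<noteq> 0"
      by (simp add: count_list_0_iff)
    then show "x \<in> {..<d}"
      by (simp add: count_list_longest_word[OF assms] split: if_splits)
  qed
  have "length (longest_word d) = (\<Sum>x<d. count_list (longest_word d) x)"
    using sum_count_set[OF sub] by simp
  also have "\<dots> = (\<Sum>x<d. 3)"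
    by (rule sum.cong) (simp_all add: count_list_longest_word[OF assms])
  finally show "length (longest_word d) = 3 * d"
    by simp
qed

theorem mainTheorem1:
  fixes d p :: nat
    and N :: "('k :: field, (nat word \<Rightarrow>\<^sub>0 'k) set) nu_algebra"
  assumes "infinite (UNIV :: 'k set)"
    and "CHAR('k) = p"
    and "d > 1"
    and "N = nil_relatively_free 3 d"
  shows "(p = 0 \<or> p > 3 \<longrightarrow> nilpotency_degree N = enat 6) \<and>
         (p = 2 \<longrightarrow> (d \<ge> 3 \<longrightarrow> nilpotency_degree N = enat (d + 3)) \<and>
                    (d = 2 \<longrightarrow> nilpotency_degree N = enat 6)) \<and>
         (p = 3 \<longrightarrow> nilpotency_degree N = enat (3 * d + 1))"
proof (intro conjI impI)
  note inf = assms(1) and char = assms(2) and d = assms(3) and N = assms(4)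
  have five: "length [0, 0, 1, 0, 1 :: nat] = 6 - 1" "set [0, 0, 1, 0, 1] \<subseteq> {..<d}"
    using d by auto
  show "nilpotency_degree N = enat 6" if p: "p = 0 \<or> p > 3"
  proof -
    have "\<not> p dvd 2" "\<not> p dvd 3"
      using p by (auto dest: dvd_imp_le)
    then have "(of_nat 2 :: 'k) \<noteq> 0" "(of_nat 3 :: 'k) \<noteq> 0"
      unfolding of_nat_eq_0_iff_char_dvd char by simp_all
    then have nz: "(2 :: 'k) \<noteq> 0" "(3 :: 'k) \<noteq> 0"
      by simp_all
    show ?thesis
      unfolding N
      by (rule nilpotency_degree_eqI[OF _ mon_length_six[OF inf nz] five mon_length_five]) simp_all
  qed
  show "nilpotency_degree N = enat (d + 3)" if "p = 2" "d \<ge> 3"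
    unfolding N
  proof (rule nilpotency_degree_eqI)
    show "mon ([0, 0, 1, 0] @ [2..<d]) \<notin> (cube_ideal d :: (nat word \<Rightarrow>\<^sub>0 'k) set)"
      using char that by (intro mon_adjacent_zeros) simp_all
    show "mon w \<in> (cube_ideal d :: (nat word \<Rightarrow>\<^sub>0 'k) set)" if "length w = d + 3" "set w \<subseteq> {..<d}" for w
      using inf char \<open>p = 2\<close> \<open>d \<ge> 3\<close> that by (intro mon_length_char2) simp_all
  qed (use that in auto)
  show "nilpotency_degree N = enat 6" if "p = 2" "d = 2"
    unfolding N
  proof (rule nilpotency_degree_eqI[OF _ _ five mon_length_five])
    show "mon w \<in> (cube_ideal d :: (nat word \<Rightarrow>\<^sub>0 'k) set)" if "length w = 6" "set w \<subseteq> {..<d}" for w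
      using inf char \<open>p = 2\<close> \<open>d = 2\<close> that by (intro mon_length_char2) simp_all
  qed simp
  show "nilpotency_degree N = enat (3 * d + 1)" if "p = 3"
    unfolding N
  proof (rule nilpotency_degree_eqI)
    show "mon (longest_word d) \<notin> (cube_ideal d :: (nat word \<Rightarrow>\<^sub>0 'k) set)"
      using char that d by (intro mon_longest_word_char3) simp_all
    show "mon w \<in> (cube_ideal d :: (nat word \<Rightarrow>\<^sub>0 'k) set)" if "length w = 3 * d + 1" "set w \<subseteq> {..<d}" for w
      using inf that by (intro mon_length_gt_three_times) simp_all
  qed (use d longest_word[of d] in auto)
qed

end
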